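(* Let $(A,\Delta)$ be a regular $I$-partial multiplier bialgebra. Then $(A,\Delta)$ (forgetting the grading of $A$ and viewing $\Delta$ as a map $A\to M(A\otimes A)$) is a regular weak multiplier bialgebra.
   Context: Conventions. Algebras are associative over $\mathbb C$, not necessarily unital; for subspaces, $VW$ is the span of products. $M(A)$ is the multiplier algebra of $A$: pairs $m=(\lambda,\rho)$ of linear maps on $A$, written $ma=\lambda(a)$, $am=\rho(a)$, with $a(mb)=(am)b$; strict convergence $m_\alpha\to m$ means that for each $a\in A$ eventually $m_\alpha a=ma$ and $am_\alpha=am$. An algebra $B$ is left (right) non-degenerate if $bB=0$ (resp. $Bb=0$) implies $b=0$, non-degenerate if both, and idempotent if $BB=B$. Partial algebras. For a set $J$, a $J$-partial algebra is an algebra $A=\bigoplus_{r,s\in J}A(r,s)$ with $A(r,s)A(s',t)=0$ for $s\neq s'$ and $A(r,s)A(s,t)\subseteq A(r,t)$. Its base units $\mathbf 1(r)\in M(A)$ are given by $\mathbf 1(r)a=\delta_{r,r'}a$, $a\mathbf 1(s)=\delta_{s,s'}a$ for $a\in A(r',s')$. It is non-degenerate if all algebras $A\mathbf 1(r)$ are left non-degenerate and all $\mathbf 1(r)A$ are right non-degenerate; idempotent if all $A\mathbf 1(r)$ and $\mathbf 1(r)A$ are idempotent. A morphism $A\to B$ of non-degenerate idempotent $J$-partial algebras is a homomorphism $f:A\to M(B)$ with $B\mathbf 1(r)\cdot f(A\mathbf 1(r))=B\mathbf 1(r)$ and $f(\mathbf 1(r)A)\cdot\mathbf 1(r)B=\mathbf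 1(r)B$ for all $r$; it extends uniquely to a unital homomorphism $M(A)\to M(B)$. Partial multiplier bialgebras. Fix a set $I$. In an $I^2$-partial algebra ($J=I\times I$, indices written as columns) the base units are $\mathbf 1\binom rt$ and the components are ${}^r_tA^s_u=\mathbf 1\binom rtA\mathbf 1\binom su$. Put $\mathbf 1^r=\sum_t\mathbf 1\binom rt$, $\mathbf 1_t=\sum_r\mathbf 1\binom rt$ (strict sums in $M(A)$). Omitted indices are summed over: $A^s=A\mathbf 1^s$, $A_u=A\mathbf 1_u$, ${}^rA=\mathbf 1^rA$, ${}_tA=\mathbf 1_tA$, $A^s_u=A\mathbf 1\binom su$, etc. $A\otimes^IB=\bigoplus\,{}^r_tA^s_u\otimes{}^t_vB^u_w\subseteq A\otimes B$ is an $I^2$-partial algebra with ${}^r_v(A\otimes^IB)^s_w=\bigoplus_{t,u}{}^r_tA^s_u\otimes{}^t_vB^u_w$; it equals $E_0(A\otimes B)E_0$ with $E_0=\sum_t\mathbf 1_t\otimes\mathbf 1^t$, and one identifies $M(A\otimes^IB)=E_0\,M(A\otimes B)E_0\subseteq M(A\otimes B)$. For a non-degenerate idempotent $I^2$-partial algebra $A$, a regular comultiplication is a morphism $\Delta$ from $A$ to $A\otimes^IA$ such that $\Delta(a)(b\otimes1),\Delta(a)(1\otimes b),(b\otimes1)\Delta(a),(1\otimes b)\Delta(a)\in A\otimes A$ for all $a,b\in A$ and $(\Delta\otimes\mathrm{id})\Delta=(\mathrm{id}\otimes\Delta)\Delta$. For a functional $\omega$, $(\mathrm{id}\otimes\omega)\Delta(a)\in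 M(A)$ is the multiplier $b\mapsto(\mathrm{id}\otimes\omega)(\Delta(a)(b\otimes1))$, $b\mapsto(\mathrm{id}\otimes\omega)((b\otimes1)\Delta(a))$; similarly $(\omega\otimes\mathrm{id})\Delta(a)$. $(A,\Delta)$ is a regular $I$-partial multiplier bialgebra if there is a functional $\varepsilon:A\to\mathbb C$ with: $\varepsilon({}^r_tA^s_u)=0$ if $r\ne t$ or $s\neq u$; $\varepsilon(A_r)\neq0\neq\varepsilon({}_rA)$ for all $r$; $\varepsilon(ab)=\varepsilon(a)\varepsilon(b)$ for $a\in A^s_t$, $b\in{}^s_tA$; $(\mathrm{id}\otimes\varepsilon)\Delta(a)=a=(\varepsilon\otimes\mathrm{id})\Delta(a)$. Regular weak multiplier bialgebra (Böhm, Gómez-Torrecillas, López-Centella). Let $A$ be an idempotent non-degenerate algebra with multiplication $\mu$, and $\Delta:A\to M(A\otimes A)$ a multiplicative linear map. $(A,\Delta)$ is a regular weak multiplier bialgebra if there exist an idempotent $E\in M(A\otimes A)$ and a linear map $\varepsilon:A\to\mathbb C$ such that: (i) $T_1(a\otimes b)=\Delta(a)(1\otimes b)$, $T_2(a\otimes b)=(a\otimes1)\Delta(b)$, $T_3(a\otimes b)=(1\otimes b)\Delta(a)$, $T_4(a\otimes b)=\Delta(b)(a\otimes1)$ define maps $A\otimes A\to A\otimes A$; (ii) $(T_2\otimes\mathrm{id})(\mathrm{id}\otimes T_1)=(\mathrm{id}\otimes T_1)(T_2\otimes\mathrm{id})$ (equivalently $(T_4\otimes\mathrm{id})(\mathrm{id}\otimes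 T_3)=(\mathrm{id}\otimes T_3)(T_4\otimes\mathrm{id})$); (iii) $(\varepsilon\otimes\mathrm{id})T_1=\mu=(\mathrm{id}\otimes\varepsilon)T_2$ (equivalently $(\varepsilon\otimes\mathrm{id})T_3=\mu^{\mathrm{op}}=(\mathrm{id}\otimes\varepsilon)T_4$); (iv) $\mathrm{Span}\{\Delta(a)(b\otimes c)\}=\mathrm{Span}\{E(b\otimes c)\}$ and $\mathrm{Span}\{(a\otimes b)\Delta(c)\}=\mathrm{Span}\{(a\otimes b)E\}$; (v) $(E\otimes1)(1\otimes E)=(1\otimes E)(E\otimes1)=(\Delta\otimes\mathrm{id})(E)=(\mathrm{id}\otimes\Delta)(E)$ in $M(A\otimes A\otimes A)$, where $\Delta\otimes\mathrm{id}$ and $\mathrm{id}\otimes\Delta$ are extended canonically to $M(A\otimes A)$ (sending $1$ to $E\otimes1$, resp. $1\otimes E$); (vi) for all $a,b,c\in A$: $(\varepsilon\otimes\mathrm{id})((1\otimes a)E(b\otimes c))=(\varepsilon\otimes\mathrm{id})(\Delta(a)(b\otimes c))$ and $(\varepsilon\otimes\mathrm{id})((a\otimes b)E(1\otimes c))=(\varepsilon\otimes\mathrm{id})((a\otimes b)\Delta(c))$. *)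

theory Defs
  imports Complex_Main "HOL-Library.Poly_Mapping"
begin

section \<open>Complex vector spaces and (not necessarily unital) complex algebras\<close>

class complex_vector = ab_group_add +
  fixes scaleC :: "complex \<Rightarrow> 'a \<Rightarrow> 'a"  (infixr \<open>*\<^sub>C\<close> 75)
  assumes scaleC_add_right: "c *\<^sub>C (x + y) = c *\<^sub>C x + c *\<^sub>C y"
    and scaleC_add_left: "(c + d) *\<^sub>C x = c *\<^sub>C x + d *\<^sub>C x"
    and scaleC_scaleC: "c *\<^sub>C d *\<^sub>C x = (c * d) *\<^sub>C x"
    and scaleC_one: "1 *\<^sub>C x = x"

class complex_algebra = complex_vector + ring +
  assumes mult_scaleC_left: "(c *\<^sub>C x) * y = c *\<^sub>C (x * y)"
    and mult_scaleC_right: "x * (c *\<^sub>C y) = c *\<^sub>C (x * y)"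

global_interpretation complex_vector:
  vector_space "scaleC :: complex \<Rightarrow> 'a \<Rightarrow> 'a::complex_vector"
  by standard (simp_all add: scaleC_add_right scaleC_add_left scaleC_scaleC scaleC_one)

abbreviation cspan :: "'a::complex_vector set \<Rightarrow> 'a set"
  where "cspan \<equiv> module.span scaleC"

abbreviation csubspace :: "'a::complex_vector set \<Rightarrow> bool"
  where "csubspace \<equiv> module.subspace scaleC"

abbreviation clinear :: "('a::complex_vector \<Rightarrow> 'b::complex_vector) \<Rightarrow> bool"
  where "clinear \<equiv> Vector_Spaces.linear scaleC scaleC"

lemma clinear_iff:
  "clinear f \<longleftrightarrow> (\<forall>x y. f (x + y) = f x + f y) \<and> (\<forall>c x. f (c *\<^sub>C x) = c *\<^sub>C f x)"
  by (simp add: Vector_Spaces.linear_def module_hom_def module_hom_axioms_def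
      complex_vector.vector_space_axioms complex_vector.module_axioms)

lemma clinearI:
  assumes "\<And>x y. f (x + y) = f x + f y" and "\<And>c x. f (c *\<^sub>C x) = c *\<^sub>C f x"
  shows "clinear f"
  using assms by (simp add: clinear_iff)

lemma clinear_add: "clinear f \<Longrightarrow> f (x + y) = f x + f y"
  and clinear_scaleC: "clinear f \<Longrightarrow> f (c *\<^sub>C x) = c *\<^sub>C f x"
  by (simp_all add: clinear_iff)

lemma clinear_0: "clinear f \<Longrightarrow> f 0 = 0"
  by (metis add_cancel_right_left clinear_add add_0)

lemma clinear_minus: "clinear f \<Longrightarrow> f (- x) = - f x"
  by (metis add.right_inverse clinear_0 clinear_add minus_unique)

lemma clinear_diff: "clinear f \<Longrightarrow> f (x - y) = f x - f y"
  by (metis add_uminus_conv_diff clinear_add clinear_minus)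

lemma clinear_compose: "clinear f \<Longrightarrow> clinear g \<Longrightarrow> clinear (\<lambda>x. g (f x))"
  by (simp add: clinear_iff)

lemma clinear_id [simp]: "clinear (\<lambda>x. x)"
  by (simp add: clinear_iff)

lemma scaleC_zero_right [simp]: "c *\<^sub>C (0::'a::complex_vector) = 0"
  by (rule complex_vector.scale_zero_right)

lemma scaleC_zero_left [simp]: "0 *\<^sub>C (x::'a::complex_vector) = 0"
  by (rule complex_vector.scale_zero_left)

definition cbilinear :: "('a::complex_vector \<Rightarrow> 'b::complex_vector \<Rightarrow> 'c::complex_vector) \<Rightarrow> bool"
  where "cbilinear h \<longleftrightarrow> (\<forall>x. clinear (h x)) \<and> (\<forall>y. clinear (\<lambda>x. h x y))"

lemma cbilinearI:
  assumes "\<And>x x' y. h (x + x') y = h x y + h x' y"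
    and "\<And>c x y. h (c *\<^sub>C x) y = c *\<^sub>C h x y"
    and "\<And>x y y'. h x (y + y') = h x y + h x y'"
    and "\<And>c x y. h x (c *\<^sub>C y) = c *\<^sub>C h x y"
  shows "cbilinear h"
  using assms by (simp add: cbilinear_def clinear_iff)

instantiation complex :: complex_algebra
begin
definition scaleC_complex :: "complex \<Rightarrow> complex \<Rightarrow> complex"
  where "scaleC_complex c x = c * x"
instance by standard (simp_all add: scaleC_complex_def algebra_simps)
end

instantiation poly_mapping :: (type, complex_vector) complex_vector
begin
definition scaleC_poly_mapping :: "complex \<Rightarrow> ('a \<Rightarrow>\<^sub>0 'b) \<Rightarrow> ('a \<Rightarrow>\<^sub>0 'b)"
  where "scaleC_poly_mapping c p = Poly_Mapping.map (scaleC c) p"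
lemma lookup_scaleC: "Poly_Mapping.lookup (c *\<^sub>C p) k = c *\<^sub>C Poly_Mapping.lookup p k"
  for p :: "'a \<Rightarrow>\<^sub>0 'b"
  by (simp add: scaleC_poly_mapping_def Poly_Mapping.map.rep_eq when_def)
instance
  by standard (auto intro!: poly_mapping_eqI simp: lookup_scaleC lookup_add scaleC_add_right
      scaleC_add_left scaleC_scaleC scaleC_one)
end


section \<open>The algebraic tensor product\<close>

text \<open>The free vector space on pairs, modulo the bilinearity relations.\<close>

definition tensor_relators :: "('a::complex_vector \<times> 'b::complex_vector \<Rightarrow>\<^sub>0 complex) set"
  where "tensor_relators =
     {Poly_Mapping.single (x + x', y) 1 - Poly_Mapping.single (x, y) 1
        - Poly_Mapping.single (x', y) 1 | x x' y. True}
   \<union> {Poly_Mapping.single (x, y + y') 1 - Poly_Mapping.single (x, y) 1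
        - Poly_Mapping.single (x, y') 1 | x y y'. True}
   \<union> {Poly_Mapping.single (c *\<^sub>C x, y) 1 - c *\<^sub>C Poly_Mapping.single (x, y) 1 | c x y. True}
   \<union> {Poly_Mapping.single (x, c *\<^sub>C y) 1 - c *\<^sub>C Poly_Mapping.single (x, y) 1 | c x y. True}"

definition tensor_eq :: "('a::complex_vector \<times> 'b::complex_vector \<Rightarrow>\<^sub>0 complex)
    \<Rightarrow> ('a \<times> 'b \<Rightarrow>\<^sub>0 complex) \<Rightarrow> bool"
  where "tensor_eq p q \<longleftrightarrow> p - q \<in> cspan tensor_relators"

lemma equivp_tensor_eq:
  "equivp (tensor_eq :: ('a::complex_vector \<times> 'b::complex_vector \<Rightarrow>\<^sub>0 complex) \<Rightarrow> _)"
proof (rule equivpI)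
  show "reflp tensor_eq"
    by (auto intro!: reflpI simp: tensor_eq_def complex_vector.span_zero)
  show "symp tensor_eq"
    by (rule sympI) (metis tensor_eq_def complex_vector.span_neg minus_diff_eq)
  show "transp (tensor_eq :: ('a \<times> 'b \<Rightarrow>\<^sub>0 complex) \<Rightarrow> _)"
  proof (rule transpI)
    fix p q r :: "'a \<times> 'b \<Rightarrow>\<^sub>0 complex"
    assume "tensor_eq p q" "tensor_eq q r"
    then have "(p - q) + (q - r) \<in> cspan tensor_relators"
      unfolding tensor_eq_def by (rule complex_vector.span_add)
    then show "tensor_eq p r" by (simp add: tensor_eq_def)
  qed
qed

quotient_type (overloaded) ('a, 'b) tensor (infixr \<open>\<otimes>\<close> 75) =
  "'a::complex_vector \<times> 'b::complex_vector \<Rightarrow>\<^sub>0 complex" / tensor_eq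
  by (rule equivp_tensor_eq)

instantiation tensor :: (complex_vector, complex_vector) complex_vector
begin

lift_definition zero_tensor :: "'a \<otimes> 'b" is "0" .

lift_definition plus_tensor :: "'a \<otimes> 'b \<Rightarrow> 'a \<otimes> 'b \<Rightarrow> 'a \<otimes> 'b" is "(+)"
proof -
  fix p p' q q' :: "'a \<times> 'b \<Rightarrow>\<^sub>0 complex"
  assume "tensor_eq p p'" "tensor_eq q q'"
  then have "(p - p') + (q - q') \<in> cspan tensor_relators"
    unfolding tensor_eq_def by (rule complex_vector.span_add)
  then show "tensor_eq (p + q) (p' + q')" by (simp add: tensor_eq_def algebra_simps)
qed

lift_definition uminus_tensor :: "'a \<otimes> 'b \<Rightarrow> 'a \<otimes> 'b" is "uminus"
  unfolding tensor_eq_def by (metis minus_diff_minus complex_vector.span_neg)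

lift_definition minus_tensor :: "'a \<otimes> 'b \<Rightarrow> 'a \<otimes> 'b \<Rightarrow> 'a \<otimes> 'b" is "(-)"
proof -
  fix p p' q q' :: "'a \<times> 'b \<Rightarrow>\<^sub>0 complex"
  assume "tensor_eq p p'" "tensor_eq q q'"
  then have "(p - p') - (q - q') \<in> cspan tensor_relators"
    unfolding tensor_eq_def by (rule complex_vector.span_diff)
  then show "tensor_eq (p - q) (p' - q')" by (simp add: tensor_eq_def algebra_simps)
qed

lift_definition scaleC_tensor :: "complex \<Rightarrow> 'a \<otimes> 'b \<Rightarrow> 'a \<otimes> 'b" is "scaleC"
  unfolding tensor_eq_def by (metis complex_vector.scale_right_diff_distrib complex_vector.span_scale)

instance
  by standard
    (transfer, simp add: tensor_eq_def complex_vector.span_zero algebra_simps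
      scaleC_add_right scaleC_add_left scaleC_scaleC scaleC_one; fail)+

end

lift_definition tensor_pure :: "'a::complex_vector \<Rightarrow> 'b::complex_vector \<Rightarrow> 'a \<otimes> 'b"  (infixr \<open>\<otimes>\<close> 75)
  is "\<lambda>x y. Poly_Mapping.single (x, y) 1" .

lemma cbilinear_tensor_pure: "cbilinear (\<otimes>)"
proof (rule cbilinearI)
  show "(x + x') \<otimes> y = x \<otimes> y + x' \<otimes> y" for x x' :: 'a and y :: 'b
  proof transfer
    fix x x' :: 'a and y :: 'b
    have "Poly_Mapping.single (x + x', y) 1 - Poly_Mapping.single (x, y) 1
        - Poly_Mapping.single (x', y) 1 \<in> cspan tensor_relators"
      unfolding tensor_relators_def by (rule complex_vector.span_base) blast
    then show "tensor_eq (Poly_Mapping.single (x + x', y) 1)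
        (Poly_Mapping.single (x, y) 1 + Poly_Mapping.single (x', y) 1)"
      by (simp add: tensor_eq_def diff_diff_eq)
  qed
  show "x \<otimes> (y + y') = x \<otimes> y + x \<otimes> y'" for x :: 'a and y y' :: 'b
  proof transfer
    fix x :: 'a and y y' :: 'b
    have "Poly_Mapping.single (x, y + y') 1 - Poly_Mapping.single (x, y) 1
        - Poly_Mapping.single (x, y') 1 \<in> cspan tensor_relators"
      unfolding tensor_relators_def by (rule complex_vector.span_base) blast
    then show "tensor_eq (Poly_Mapping.single (x, y + y') 1)
        (Poly_Mapping.single (x, y) 1 + Poly_Mapping.single (x, y') 1)"
      by (simp add: tensor_eq_def diff_diff_eq)
  qed
  show "(c *\<^sub>C x) \<otimes> y = c *\<^sub>C (x \<otimes> y)" for c and x :: 'a and y :: 'b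
    by transfer (unfold tensor_eq_def tensor_relators_def, rule complex_vector.span_base, blast)
  show "x \<otimes> (c *\<^sub>C y) = c *\<^sub>C (x \<otimes> y)" for c and x :: 'a and y :: 'b
    by transfer (unfold tensor_eq_def tensor_relators_def, rule complex_vector.span_base, blast)
qed

lemma tensor_add_left: "(x + x') \<otimes> y = x \<otimes> y + x' \<otimes> y"
  and tensor_add_right: "x \<otimes> (y + y') = x \<otimes> y + x \<otimes> y'"
  and tensor_scaleC_left: "(c *\<^sub>C x) \<otimes> y = c *\<^sub>C (x \<otimes> y)"
  and tensor_scaleC_right: "x \<otimes> (c *\<^sub>C y) = c *\<^sub>C (x \<otimes> y)"
  using cbilinear_tensor_pure[where 'a='a and 'b='b] by (simp_all add: cbilinear_def clinear_iff)

lemma free_span: "p \<in> cspan (range (\<lambda>k. Poly_Mapping.single k (1::complex)))"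
proof -
  have *: "p = (\<Sum>k\<in>Poly_Mapping.keys p. Poly_Mapping.lookup p k *\<^sub>C Poly_Mapping.single k 1)"
  proof (rule poly_mapping_eqI)
    fix k
    have "(\<Sum>x\<in>Poly_Mapping.keys p. Poly_Mapping.lookup p x * (if x = k then 1 else 0)) =
        (\<Sum>x\<in>Poly_Mapping.keys p. if k = x then Poly_Mapping.lookup p x else 0)"
      by (rule sum.cong) auto
    then show "Poly_Mapping.lookup p k = Poly_Mapping.lookup
        (\<Sum>k\<in>Poly_Mapping.keys p. Poly_Mapping.lookup p k *\<^sub>C Poly_Mapping.single k 1) k"
      by (simp add: lookup_sum lookup_scaleC lookup_single scaleC_complex_def when_def
         sum.delta in_keys_iff)
  qed
  show ?thesis
    by (subst *) (intro complex_vector.span_sum complex_vector.span_scale complex_vector.span_base rangeI)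
qed

lemma tensor_induct [case_names zero add]:
  fixes P :: "'a::complex_vector \<otimes> 'b::complex_vector \<Rightarrow> bool"
  assumes zero: "P 0" and add: "\<And>a b t. P t \<Longrightarrow> P (a \<otimes> b + t)"
  shows "P t"
proof (induction t rule: tensor.abs_induct)
  fix p :: "'a \<times> 'b \<Rightarrow>\<^sub>0 complex"
  show "P (abs_tensor p)"
    using free_span[of p]
  proof (induction p rule: complex_vector.span_induct_alt)
    case base
    then show ?case using zero by (simp add: zero_tensor_def)
  next
    case (step c x y)
    then obtain a b where x: "x = Poly_Mapping.single (a, b) 1" by auto
    have "abs_tensor (c *\<^sub>C x + y) = (c *\<^sub>C a) \<otimes> b + abs_tensor y"
      unfolding tensor_scaleC_left
      by (simp only: x plus_tensor.abs_eq[symmetric] scaleC_tensor.abs_eq[symmetric] tensor_pure.abs_eq)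
    then show ?case using add[OF step(2)] by simp
  qed
qed

text \<open>Only meaningful for bilinear \<open>h\<close>.\<close>

definition tensor_lift ::
    "('a::complex_vector \<Rightarrow> 'b::complex_vector \<Rightarrow> 'c::complex_vector) \<Rightarrow> 'a \<otimes> 'b \<Rightarrow> 'c"
  where "tensor_lift h = (THE F. clinear F \<and> (\<forall>a b. F (a \<otimes> b) = h a b))"

lemma clinear_tensor_ext:
  assumes "clinear F" "clinear F'" "\<And>a b. F (a \<otimes> b) = F' (a \<otimes> b)"
  shows "F = F'"
proof
  show "F t = F' t" for t
    by (induction t rule: tensor_induct) (simp_all add: assms clinear_0 clinear_add)
qed

lemma tensor_lift_exists:
  fixes h :: "'a::complex_vector \<Rightarrow> 'b::complex_vector \<Rightarrow> 'c::complex_vector"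
  assumes h: "cbilinear h"
  shows "\<exists>F. clinear F \<and> (\<forall>a b. F (a \<otimes> b) = h a b)"
proof -
  define L where "L p = (\<Sum>k\<in>Poly_Mapping.keys p. Poly_Mapping.lookup p k *\<^sub>C h (fst k) (snd k))"
    for p :: "'a \<times> 'b \<Rightarrow>\<^sub>0 complex"
  have L_eq: "L p = (\<Sum>k\<in>S. Poly_Mapping.lookup p k *\<^sub>C h (fst k) (snd k))"
    if "finite S" "Poly_Mapping.keys p \<subseteq> S" for p S
    unfolding L_def using that
    by (intro sum.mono_neutral_left) (auto simp: in_keys_iff)
  have L_add: "L (p + q) = L p + L q" for p q
  proof -
    let ?S = "Poly_Mapping.keys p \<union> Poly_Mapping.keys q"
    have "Poly_Mapping.keys (p + q) \<subseteq> ?S" by (rule keys_add)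
    then show ?thesis
      by (simp add: L_eq[of ?S] lookup_add scaleC_add_left sum.distrib)
  qed
  have L_scale: "L (c *\<^sub>C p) = c *\<^sub>C L p" for c p
  proof -
    have "Poly_Mapping.keys (c *\<^sub>C p) \<subseteq> Poly_Mapping.keys p"
      by (auto simp: in_keys_iff lookup_scaleC)
    then show ?thesis
      by (simp add: L_eq[of "Poly_Mapping.keys p"] lookup_scaleC scaleC_complex_def
          complex_vector.scale_sum_right scaleC_scaleC)
  qed
  have L: "clinear L" by (rule clinearI) (simp_all add: L_add L_scale)
  have L_single: "L (Poly_Mapping.single (a, b) 1) = h a b" for a b
    by (simp add: L_def scaleC_one)
  have L_rel: "L r = 0" if "r \<in> cspan tensor_relators" for r
    using that
  proof (induction r rule: complex_vector.span_induct_alt)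
    case base
    then show ?case by (rule clinear_0[OF L])
  next
    case (step c x y)
    have "L x = 0"
      using step(1) h unfolding tensor_relators_def
      by (auto simp: clinear_diff[OF L] L_scale L_single cbilinear_def clinear_iff)
    then show ?case using step(2) by (simp add: L_add L_scale)
  qed
  define F where "F t = L (rep_tensor t)" for t
  have F_abs: "F (abs_tensor p) = L p" for p
  proof -
    have "tensor_eq (rep_tensor (abs_tensor p)) p"
      by (rule Quotient3_rep_abs[OF Quotient3_tensor]) (simp add: tensor_eq_def complex_vector.span_zero)
    then have "L (rep_tensor (abs_tensor p) - p) = 0"
      unfolding tensor_eq_def by (rule L_rel)
    then show ?thesis by (simp add: F_def clinear_diff[OF L])
  qed
  have "clinear F"
  proof (rule clinearI)
    show "F (x + y) = F x + F y" for x y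
      by (induction x rule: tensor.abs_induct, induction y rule: tensor.abs_induct)
         (simp add: plus_tensor.abs_eq F_abs L_add)
    show "F (c *\<^sub>C x) = c *\<^sub>C F x" for c x
      by (induction x rule: tensor.abs_induct) (simp add: scaleC_tensor.abs_eq F_abs L_scale)
  qed
  moreover have "F (a \<otimes> b) = h a b" for a b
    by (simp add: tensor_pure.abs_eq F_abs L_single)
  ultimately show ?thesis by blast
qed

lemma
  assumes "cbilinear h"
  shows clinear_tensor_lift: "clinear (tensor_lift h)"
    and tensor_lift_pure: "tensor_lift h (a \<otimes> b) = h a b"
proof -
  have "\<exists>!F. clinear F \<and> (\<forall>a b. F (a \<otimes> b) = h a b)"
    using tensor_lift_exists[OF assms] by (auto intro: clinear_tensor_ext)
  from theI'[OF this] show "clinear (tensor_lift h)" "tensor_lift h (a \<otimes> b) = h a b"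
    by (auto simp: tensor_lift_def)
qed

lemma tensor_lift_add:
  assumes "cbilinear h" "cbilinear h'"
  shows "tensor_lift (\<lambda>a b. h a b + h' a b) t = tensor_lift h t + tensor_lift h' t"
proof -
  have *: "cbilinear (\<lambda>a b. h a b + h' a b)"
    using assms by (auto simp: cbilinear_def clinear_iff scaleC_add_right algebra_simps)
  show ?thesis
    by (induction t rule: tensor_induct)
       (simp_all only: clinear_0[OF clinear_tensor_lift] clinear_add[OF clinear_tensor_lift]
         tensor_lift_pure assms * add_ac add_0)
qed

lemma tensor_lift_scaleC:
  assumes "cbilinear h"
  shows "tensor_lift (\<lambda>a b. k *\<^sub>C h a b) t = k *\<^sub>C tensor_lift h t"
proof -
  have *: "cbilinear (\<lambda>a b. k *\<^sub>C h a b)"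
    using assms by (auto simp: cbilinear_def clinear_iff scaleC_add_right scaleC_scaleC mult.commute)
  show ?thesis
    by (induction t rule: tensor_induct)
       (simp_all only: clinear_0[OF clinear_tensor_lift] clinear_add[OF clinear_tensor_lift]
         tensor_lift_pure assms * scaleC_add_right scaleC_zero_right)
qed

lemma cbilinear_lift_param:
  assumes "\<And>a b. cbilinear (h a b)" and "\<And>c d. cbilinear (\<lambda>a b. h a b c d)"
  shows "cbilinear (\<lambda>a b. tensor_lift (h a b) t)"
proof (rule cbilinearI)
  have "h (x + x') y c d = h x y c d + h x' y c d" "h (k *\<^sub>C x) y c d = k *\<^sub>C h x y c d"
    "h x (y + y') c d = h x y c d + h x y' c d" "h x (k *\<^sub>C y) c d = k *\<^sub>C h x y c d"
    for x x' y y' c d k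
    using assms(2)[of c d] by (simp_all add: cbilinear_def clinear_iff)
  then have h: "h (x + x') y = (\<lambda>c d. h x y c d + h x' y c d)"
    "h (k *\<^sub>C x) y = (\<lambda>c d. k *\<^sub>C h x y c d)"
    "h x (y + y') = (\<lambda>c d. h x y c d + h x y' c d)"
    "h x (k *\<^sub>C y) = (\<lambda>c d. k *\<^sub>C h x y c d)"
    for x x' y y' k by (auto simp: fun_eq_iff)
  show "tensor_lift (h (x + x') y) t = tensor_lift (h x y) t + tensor_lift (h x' y) t" for x x' y
    unfolding h by (rule tensor_lift_add) (rule assms)+
  show "tensor_lift (h (k *\<^sub>C x) y) t = k *\<^sub>C tensor_lift (h x y) t" for k x y
    unfolding h by (rule tensor_lift_scaleC) (rule assms)
  show "tensor_lift (h x (y + y')) t = tensor_lift (h x y) t + tensor_lift (h x y') t" for x y y'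
    unfolding h by (rule tensor_lift_add) (rule assms)+
  show "tensor_lift (h x (k *\<^sub>C y)) t = k *\<^sub>C tensor_lift (h x y) t" for k x y
    unfolding h by (rule tensor_lift_scaleC) (rule assms)
qed

instantiation tensor :: (complex_algebra, complex_algebra) complex_algebra
begin

definition times_tensor :: "'a \<otimes> 'b \<Rightarrow> 'a \<otimes> 'b \<Rightarrow> 'a \<otimes> 'b"
  where "x * y = tensor_lift (\<lambda>a b. tensor_lift (\<lambda>c d. (a * c) \<otimes> (b * d)) y) x"

lemma
  fixes x y :: "'a \<otimes> 'b"
  shows clinear_tensor_times_left: "clinear (\<lambda>x. x * y)"
    and clinear_tensor_times_right: "clinear (\<lambda>y. x * y)"
    and tensor_times_pure: "(a \<otimes> b) * (c \<otimes> d) = (a * c) \<otimes> (b * d)"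
proof -
  have 1: "cbilinear (\<lambda>c d. (a * c) \<otimes> (b * d))" for a :: 'a and b :: 'b
    by (rule cbilinearI)
       (simp_all add: ring_distribs mult_scaleC_right tensor_add_left tensor_add_right
         tensor_scaleC_left tensor_scaleC_right)
  have 2: "cbilinear (\<lambda>a b. (a * c) \<otimes> (b * d))" for c :: 'a and d :: 'b
    by (rule cbilinearI)
       (simp_all add: ring_distribs mult_scaleC_left tensor_add_left tensor_add_right
         tensor_scaleC_left tensor_scaleC_right)
  note 3 = cbilinear_lift_param[OF 1 2]
  show lin: "clinear (\<lambda>x. x * y)" for y :: "'a \<otimes> 'b"
    unfolding times_tensor_def by (rule clinear_tensor_lift[OF 3])
  have pure: "(a \<otimes> b) * y = tensor_lift (\<lambda>c d. (a * c) \<otimes> (b * d)) y"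
    for a :: 'a and b :: 'b and y
    unfolding times_tensor_def by (rule tensor_lift_pure[OF 3])
  show "(a \<otimes> b) * (c \<otimes> d) = (a * c) \<otimes> (b * d)"
    by (simp add: pure tensor_lift_pure[OF 1])
  note lin1 = clinear_tensor_lift[OF 1]
  show "clinear (\<lambda>y. x * y)" for x :: "'a \<otimes> 'b"
  proof (rule clinearI)
    show "x * (y + y') = x * y + x * y'" for y y'
      by (induction x rule: tensor_induct)
         (simp_all add: clinear_0[OF lin] clinear_add[OF lin] pure clinear_add[OF lin1])
    show "x * (k *\<^sub>C y) = k *\<^sub>C (x * y)" for k y
      by (induction x rule: tensor_induct)
         (simp_all add: clinear_0[OF lin] clinear_add[OF lin] pure clinear_scaleC[OF lin1]
           scaleC_add_right)
  qed
qed

instance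
proof
  fix x y z :: "'a \<otimes> 'b" and c :: complex
  note l = clinear_tensor_times_left and r = clinear_tensor_times_right
  show "(x + y) * z = x * z + y * z" by (rule clinear_add[OF l])
  show "x * (y + z) = x * y + x * z" by (rule clinear_add[OF r])
  show "(c *\<^sub>C x) * y = c *\<^sub>C (x * y)" by (rule clinear_scaleC[OF l])
  show "x * (c *\<^sub>C y) = c *\<^sub>C (x * y)" by (rule clinear_scaleC[OF r])
  note simps = clinear_0[OF l] clinear_0[OF r] clinear_add[OF l] clinear_add[OF r] tensor_times_pure
  have 1: "(a \<otimes> b) * (c \<otimes> d) * z = (a \<otimes> b) * ((c \<otimes> d) * z)" for a c :: 'a and b d :: 'b and z
    by (induction z rule: tensor_induct) (simp_all add: simps mult.assoc)
  have 2: "(a \<otimes> b) * y * z = (a \<otimes> b) * (y * z)" for a :: 'a and b :: 'b and y z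
    by (induction y rule: tensor_induct) (simp_all add: simps(1-4) 1)
  show "x * y * z = x * (y * z)"
    by (induction x rule: tensor_induct) (simp_all add: simps(1-4) 2)
qed

end

definition tensor_map :: "('a::complex_vector \<Rightarrow> 'c::complex_vector)
    \<Rightarrow> ('b::complex_vector \<Rightarrow> 'd::complex_vector) \<Rightarrow> 'a \<otimes> 'b \<Rightarrow> 'c \<otimes> 'd"
  where "tensor_map f g = tensor_lift (\<lambda>a b. f a \<otimes> g b)"

lemma
  assumes "clinear f" "clinear g"
  shows clinear_tensor_map: "clinear (tensor_map f g)"
    and tensor_map_pure: "tensor_map f g (a \<otimes> b) = f a \<otimes> g b"
proof -
  have *: "cbilinear (\<lambda>a b. f a \<otimes> g b)"
    using assms by (intro cbilinearI)
      (simp_all add: clinear_add clinear_scaleC tensor_add_left tensor_add_right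
        tensor_scaleC_left tensor_scaleC_right)
  show "clinear (tensor_map f g)" "tensor_map f g (a \<otimes> b) = f a \<otimes> g b"
    unfolding tensor_map_def by (rule clinear_tensor_lift[OF *] tensor_lift_pure[OF *])+
qed

definition tensor_assoc ::
    "('a::complex_vector \<otimes> 'b::complex_vector) \<otimes> 'c::complex_vector \<Rightarrow> 'a \<otimes> ('b \<otimes> 'c)"
  where "tensor_assoc = tensor_lift (\<lambda>t c. tensor_lift (\<lambda>a b. a \<otimes> (b \<otimes> c)) t)"

definition tensor_assoc_inv ::
    "'a::complex_vector \<otimes> ('b::complex_vector \<otimes> 'c::complex_vector) \<Rightarrow> ('a \<otimes> 'b) \<otimes> 'c"
  where "tensor_assoc_inv = tensor_lift (\<lambda>a t. tensor_lift (\<lambda>b c. (a \<otimes> b) \<otimes> c) t)"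

lemma
  fixes a :: "'a::complex_vector" and b :: "'b::complex_vector" and c :: "'c::complex_vector"
  shows clinear_tensor_assoc: "clinear (tensor_assoc :: ('a \<otimes> 'b) \<otimes> 'c \<Rightarrow> _)"
    and tensor_assoc_pure: "tensor_assoc ((a \<otimes> b) \<otimes> c) = a \<otimes> (b \<otimes> c)"
proof -
  have 1: "cbilinear (\<lambda>a b. a \<otimes> (b \<otimes> c))" for c :: 'c
    by (rule cbilinearI)
       (simp_all add: tensor_add_left tensor_add_right tensor_scaleC_left tensor_scaleC_right)
  note lin = clinear_tensor_lift[OF 1] and pure = tensor_lift_pure[OF 1]
  have 2: "cbilinear (\<lambda>t c. tensor_lift (\<lambda>(a::'a) (b::'b). a \<otimes> (b \<otimes> (c::'c))) t)"
  proof (rule cbilinearI)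
    show "tensor_lift (\<lambda>a b. a \<otimes> (b \<otimes> (c + c'))) t
        = tensor_lift (\<lambda>a b. a \<otimes> (b \<otimes> c)) t + tensor_lift (\<lambda>a b. a \<otimes> (b \<otimes> c')) t"
      for t :: "'a \<otimes> 'b" and c c' :: 'c
      by (simp add: tensor_add_right tensor_lift_add 1)
    show "tensor_lift (\<lambda>a b. a \<otimes> (b \<otimes> (k *\<^sub>C c))) t = k *\<^sub>C tensor_lift (\<lambda>a b. a \<otimes> (b \<otimes> c)) t"
      for t :: "'a \<otimes> 'b" and k and c :: 'c
      by (simp add: tensor_scaleC_right tensor_lift_scaleC 1)
  qed (simp_all add: clinear_add[OF lin] clinear_scaleC[OF lin])
  show "clinear (tensor_assoc :: ('a \<otimes> 'b) \<otimes> 'c \<Rightarrow> _)"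
    unfolding tensor_assoc_def by (rule clinear_tensor_lift[OF 2])
  show "tensor_assoc ((a \<otimes> b) \<otimes> c) = a \<otimes> (b \<otimes> c)"
    by (simp add: tensor_assoc_def tensor_lift_pure[OF 2] pure)
qed

lemma
  fixes a :: "'a::complex_vector" and b :: "'b::complex_vector" and c :: "'c::complex_vector"
  shows clinear_tensor_assoc_inv: "clinear (tensor_assoc_inv :: 'a \<otimes> ('b \<otimes> 'c) \<Rightarrow> _)"
    and tensor_assoc_inv_pure: "tensor_assoc_inv (a \<otimes> (b \<otimes> c)) = (a \<otimes> b) \<otimes> c"
proof -
  have 1: "cbilinear (\<lambda>b c. (a \<otimes> b) \<otimes> c)" for a :: 'a
    by (rule cbilinearI)
       (simp_all add: tensor_add_left tensor_add_right tensor_scaleC_left tensor_scaleC_right)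
  note lin = clinear_tensor_lift[OF 1] and pure = tensor_lift_pure[OF 1]
  have 2: "cbilinear (\<lambda>a t. tensor_lift (\<lambda>(b::'b) (c::'c). ((a::'a) \<otimes> b) \<otimes> c) t)"
  proof (rule cbilinearI)
    show "tensor_lift (\<lambda>b c. ((a + a') \<otimes> b) \<otimes> c) t
        = tensor_lift (\<lambda>b c. (a \<otimes> b) \<otimes> c) t + tensor_lift (\<lambda>b c. (a' \<otimes> b) \<otimes> c) t"
      for t :: "'b \<otimes> 'c" and a a' :: 'a
      by (simp add: tensor_add_left tensor_lift_add 1)
    show "tensor_lift (\<lambda>b c. ((k *\<^sub>C a) \<otimes> b) \<otimes> c) t = k *\<^sub>C tensor_lift (\<lambda>b c. (a \<otimes> b) \<otimes> c) t"
      for t :: "'b \<otimes> 'c" and k and a :: 'a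
      by (simp add: tensor_scaleC_left tensor_lift_scaleC 1)
  qed (simp_all add: clinear_add[OF lin] clinear_scaleC[OF lin])
  show "clinear (tensor_assoc_inv :: 'a \<otimes> ('b \<otimes> 'c) \<Rightarrow> _)"
    unfolding tensor_assoc_inv_def by (rule clinear_tensor_lift[OF 2])
  show "tensor_assoc_inv (a \<otimes> (b \<otimes> c)) = (a \<otimes> b) \<otimes> c"
    by (simp add: tensor_assoc_inv_def tensor_lift_pure[OF 2] pure)
qed

lemma tensor3_induct [case_names zero add]:
  fixes P :: "('a::complex_vector \<otimes> 'b::complex_vector) \<otimes> 'c::complex_vector \<Rightarrow> bool"
  assumes zero: "P 0" and add: "\<And>a b c t. P t \<Longrightarrow> P ((a \<otimes> b) \<otimes> c + t)"
  shows "P t"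
proof (induction t rule: tensor_induct)
  case zero
  show ?case by (rule assms(1))
next
  case (add x c t)
  then show ?case
  proof (induction x arbitrary: t rule: tensor_induct)
    case zero
    have "(0::'a \<otimes> 'b) \<otimes> c = 0"
      using tensor_scaleC_left[of 0 "0::'a \<otimes> 'b" c] by simp
    then show ?case using zero by simp
  next
    case (add a b x)
    then show ?case using assms(2) by (simp add: tensor_add_left add.assoc)
  qed
qed

lemma tensor_assoc_inv_assoc [simp]: "tensor_assoc_inv (tensor_assoc t) = t"
  by (induction t rule: tensor3_induct)
     (simp_all add: clinear_0 clinear_add clinear_tensor_assoc clinear_tensor_assoc_inv
       tensor_assoc_pure tensor_assoc_inv_pure)

lemma tensor_assoc_mult: "tensor_assoc (x * y) = tensor_assoc x * tensor_assoc y"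
proof -
  have 1: "tensor_assoc (((a \<otimes> b) \<otimes> c) * y) = (a \<otimes> (b \<otimes> c)) * tensor_assoc y"
    for a :: 'a and b :: 'b and c :: 'c and y
    by (induction y rule: tensor3_induct)
       (simp_all add: clinear_0[OF clinear_tensor_assoc] clinear_add[OF clinear_tensor_assoc]
         tensor_assoc_pure tensor_times_pure distrib_left)
  show ?thesis
    by (induction x rule: tensor3_induct)
       (simp_all add: clinear_0[OF clinear_tensor_assoc] clinear_add[OF clinear_tensor_assoc]
         tensor_assoc_pure 1 distrib_right)
qed

lemma tensor_assoc_assoc_inv [simp]: "tensor_assoc (tensor_assoc_inv t) = t"
proof (induction t rule: tensor_induct)
  case zero
  show ?case by (simp add: clinear_0 clinear_tensor_assoc clinear_tensor_assoc_inv)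
next
  case (add a s t)
  have "tensor_assoc (tensor_assoc_inv (a \<otimes> s)) = a \<otimes> s"
  proof (induction s rule: tensor_induct)
    case zero
    have "a \<otimes> (0::'b \<otimes> 'c) = 0"
      using tensor_scaleC_right[of a 0 "0::'b \<otimes> 'c"] by simp
    then show ?case by (simp add: clinear_0 clinear_tensor_assoc clinear_tensor_assoc_inv)
  next
    case (add b c s)
    then show ?case
      by (simp add: tensor_add_right clinear_add clinear_tensor_assoc clinear_tensor_assoc_inv
          tensor_assoc_pure tensor_assoc_inv_pure)
  qed
  then show ?case
    using add by (simp add: clinear_add clinear_tensor_assoc clinear_tensor_assoc_inv)
qed

text \<open>The slice maps $\mathrm{id}\otimes\omega$ and $\omega\otimes\mathrm{id}$.\<close>

definition id_slice :: "('b::complex_vector \<Rightarrow> complex) \<Rightarrow> 'a::complex_vector \<otimes> 'b \<Rightarrow> 'a"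
  where "id_slice \<omega> = tensor_lift (\<lambda>a b. \<omega> b *\<^sub>C a)"

definition slice_id :: "('a::complex_vector \<Rightarrow> complex) \<Rightarrow> 'a \<otimes> 'b::complex_vector \<Rightarrow> 'b"
  where "slice_id \<omega> = tensor_lift (\<lambda>a b. \<omega> a *\<^sub>C b)"


section \<open>Multiplier algebras\<close>

typedef (overloaded) 'a multiplier =
  "{(l, r). clinear l \<and> clinear r \<and> (\<forall>a b::'a::complex_algebra. a * l b = r a * b)}"
  by (rule exI[of _ "(\<lambda>x. x, \<lambda>x. x)"]) simp

setup_lifting type_definition_multiplier

lift_definition lact :: "'a::complex_algebra multiplier \<Rightarrow> 'a \<Rightarrow> 'a"  (infixr \<open>\<rhd>\<close> 72) is fst .

lift_definition ract :: "'a::complex_algebra \<Rightarrow> 'a multiplier \<Rightarrow> 'a"  (infixl \<open>\<lhd>\<close> 72)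
  is "\<lambda>a m. snd m a" .

lemma multiplier_eqI:
  assumes "\<And>a. m \<rhd> a = n \<rhd> a" and "\<And>a. a \<lhd> m = a \<lhd> n"
  shows "m = n"
  using assms by transfer (auto simp: prod_eq_iff)

lemma clinear_lact: "clinear (\<lambda>a. m \<rhd> a)"
  and clinear_ract: "clinear (\<lambda>a. a \<lhd> m)"
  and mult_lact: "a * (m \<rhd> b) = (a \<lhd> m) * b"
  by (transfer, auto)+

instantiation multiplier :: (complex_algebra) "{complex_algebra, monoid_mult}"
begin

lift_definition zero_multiplier :: "'a multiplier" is "(\<lambda>_. 0, \<lambda>_. 0)"
  by (simp add: clinear_iff)

lift_definition plus_multiplier :: "'a multiplier \<Rightarrow> 'a multiplier \<Rightarrow> 'a multiplier"
  is "\<lambda>(l, r) (l', r'). (\<lambda>a. l a + l' a, \<lambda>a. r a + r' a)"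
  by (auto simp: clinear_iff ring_distribs scaleC_add_right)

lift_definition uminus_multiplier :: "'a multiplier \<Rightarrow> 'a multiplier"
  is "\<lambda>(l, r). (\<lambda>a. - l a, \<lambda>a. - r a)"
  by (auto simp: clinear_iff)

lift_definition minus_multiplier :: "'a multiplier \<Rightarrow> 'a multiplier \<Rightarrow> 'a multiplier"
  is "\<lambda>(l, r) (l', r'). (\<lambda>a. l a - l' a, \<lambda>a. r a - r' a)"
  by (auto simp: clinear_iff ring_distribs complex_vector.scale_right_diff_distrib)

lift_definition scaleC_multiplier :: "complex \<Rightarrow> 'a multiplier \<Rightarrow> 'a multiplier"
  is "\<lambda>c (l, r). (\<lambda>a. c *\<^sub>C l a, \<lambda>a. c *\<^sub>C r a)"
  by (auto simp: clinear_iff scaleC_add_right scaleC_scaleC mult.commute mult_scaleC_left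
      mult_scaleC_right)

lift_definition one_multiplier :: "'a multiplier" is "(\<lambda>a. a, \<lambda>a. a)"
  by simp

lift_definition times_multiplier :: "'a multiplier \<Rightarrow> 'a multiplier \<Rightarrow> 'a multiplier"
  is "\<lambda>(l, r) (l', r'). (\<lambda>a. l (l' a), \<lambda>a. r' (r a))"
  by (auto simp: clinear_iff)

lemma lact_simps [simp]:
  "0 \<rhd> a = 0" "(m + n) \<rhd> a = m \<rhd> a + n \<rhd> a" "(- m) \<rhd> a = - (m \<rhd> a)"
  "(m - n) \<rhd> a = m \<rhd> a - n \<rhd> a" "(c *\<^sub>C m) \<rhd> a = c *\<^sub>C (m \<rhd> a)"
  "1 \<rhd> a = a" "(m * n) \<rhd> a = m \<rhd> n \<rhd> a"
  by (transfer, auto)+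

lemma ract_simps [simp]:
  "a \<lhd> 0 = 0" "a \<lhd> (m + n) = a \<lhd> m + a \<lhd> n" "a \<lhd> (- m) = - (a \<lhd> m)"
  "a \<lhd> (m - n) = a \<lhd> m - a \<lhd> n" "a \<lhd> (c *\<^sub>C m) = c *\<^sub>C (a \<lhd> m)"
  "a \<lhd> 1 = a" "a \<lhd> (m * n) = a \<lhd> m \<lhd> n"
  by (transfer, auto)+

instance
  by standard
    (auto intro!: multiplier_eqI simp: algebra_simps clinear_add[OF clinear_lact]
      clinear_add[OF clinear_ract] clinear_scaleC[OF clinear_lact] clinear_scaleC[OF clinear_ract]
      scaleC_add_right scaleC_add_left scaleC_scaleC scaleC_one)

end

lift_definition embed :: "'a::complex_algebra \<Rightarrow> 'a multiplier" is "\<lambda>a. (\<lambda>x. a * x, \<lambda>x. x * a)"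
  by (auto simp: clinear_iff ring_distribs mult_scaleC_left mult_scaleC_right mult.assoc)

text \<open>\<open>m \<otimes>\<^sub>M n\<close> is the image of \<open>m \<otimes> n\<close> under $M(A)\otimes M(B)\to M(A\otimes B)$.\<close>

lift_definition multiplier_tensor ::
    "'a::complex_algebra multiplier \<Rightarrow> 'b::complex_algebra multiplier \<Rightarrow> ('a \<otimes> 'b) multiplier"
    (infixr \<open>\<otimes>\<^sub>M\<close> 75)
  is "\<lambda>(l, r) (l', r'). (tensor_map l l', tensor_map r r')"
proof clarsimp
  fix l r :: "'a \<Rightarrow> 'a" and l' r' :: "'b \<Rightarrow> 'b"
  assume lin: "clinear l" "clinear r" "clinear l'" "clinear r'"
    and m: "\<forall>a b. a * l b = r a * b" "\<forall>a b. a * l' b = r' a * b"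
  note L = clinear_tensor_map[OF lin(1,3)] and R = clinear_tensor_map[OF lin(2,4)]
  note p = tensor_map_pure[OF lin(1,3)] tensor_map_pure[OF lin(2,4)]
  have 1: "(a \<otimes> b) * tensor_map l l' y = tensor_map r r' (a \<otimes> b) * y" for a b y
    by (induction y rule: tensor_induct)
       (simp_all add: clinear_0[OF L] clinear_add[OF L] p distrib_left tensor_times_pure m)
  have "x * tensor_map l l' y = tensor_map r r' x * y" for x y
    by (induction x rule: tensor_induct)
       (simp_all add: clinear_0[OF R] clinear_add[OF R] distrib_right 1)
  with L R show "clinear (tensor_map l l') \<and> clinear (tensor_map r r') \<and>
      (\<forall>x y. x * tensor_map l l' y = tensor_map r r' x * y)" by blast
qed

text \<open>Threefold tensor products are bracketed to the left; multipliers of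
  $A\otimes(B\otimes C)$ are transported along the associator.\<close>

lift_definition multiplier_assoc ::
    "('a::complex_algebra \<otimes> ('b::complex_algebra \<otimes> 'c::complex_algebra)) multiplier
      \<Rightarrow> (('a \<otimes> 'b) \<otimes> 'c) multiplier"
  is "\<lambda>(l, r). (\<lambda>t. tensor_assoc_inv (l (tensor_assoc t)), \<lambda>t. tensor_assoc_inv (r (tensor_assoc t)))"
proof clarsimp
  fix l r :: "'a \<otimes> ('b \<otimes> 'c) \<Rightarrow> 'a \<otimes> ('b \<otimes> 'c)"
  assume lin: "clinear l" "clinear r" and m: "\<forall>a b. a * l b = r a * b"
  have "x * tensor_assoc_inv (l (tensor_assoc y)) = tensor_assoc_inv (r (tensor_assoc x)) * y"
    for x y
  proof -
    have "tensor_assoc (x * tensor_assoc_inv (l (tensor_assoc y))) =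
        tensor_assoc (tensor_assoc_inv (r (tensor_assoc x)) * y)"
      by (simp add: tensor_assoc_mult m)
    then show ?thesis by (metis tensor_assoc_inv_assoc)
  qed
  with lin show "clinear (\<lambda>t. tensor_assoc_inv (l (tensor_assoc t))) \<and>
      clinear (\<lambda>t. tensor_assoc_inv (r (tensor_assoc t))) \<and>
      (\<forall>x y. x * tensor_assoc_inv (l (tensor_assoc y)) = tensor_assoc_inv (r (tensor_assoc x)) * y)"
    by (intro conjI allI)
       (auto intro: clinear_compose[OF _ clinear_tensor_assoc_inv]
         clinear_compose[OF clinear_tensor_assoc])
qed

definition strict_limit ::
    "('x \<Rightarrow> 'a::complex_algebra multiplier) \<Rightarrow> 'a multiplier \<Rightarrow> 'x filter \<Rightarrow> bool"
  where "strict_limit f m F \<longleftrightarrow>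
    (\<forall>a. eventually (\<lambda>i. f i \<rhd> a = m \<rhd> a \<and> a \<lhd> f i = a \<lhd> m) F)"

definition strict_sum :: "('x \<Rightarrow> 'a::complex_algebra multiplier) \<Rightarrow> 'x set \<Rightarrow> 'a multiplier"
  where "strict_sum f S = (THE m. strict_limit (\<lambda>F. sum f F) m (finite_subsets_at_top S))"

text \<open>Let \<open>p\<close> and \<open>e\<close> be idempotent multipliers of $A$ and $B$ and let \<open>f\<close> be a homomorphism
  $pAp\to eM(B)e$. The following is its extension to a homomorphism $pM(A)p\to eM(B)e$
  with \<open>p \<mapsto> e\<close>, precomposed with the compression \<open>m \<mapsto> p * m * p\<close> in order to be a total
  function on $M(A)$. It is meant for situations where such an extension exists and is unique.\<close>

definition multiplier_ext :: "'a::complex_algebra multiplier \<Rightarrow> ('a \<Rightarrow> 'b::complex_algebra multiplier)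
    \<Rightarrow> 'b multiplier \<Rightarrow> 'a multiplier \<Rightarrow> 'b multiplier"
  where "multiplier_ext p f e = (THE F. clinear F
    \<and> (\<forall>m. F (p * m * p) = F m)
    \<and> (\<forall>m n. F ((p * m * p) * (p * n * p)) = F m * F n)
    \<and> F p = e
    \<and> (\<forall>a. F (embed ((p \<rhd> a) \<lhd> p)) = f ((p \<rhd> a) \<lhd> p)))"


section \<open>Non-degenerate and idempotent algebras, partial algebras\<close>

definition left_nondegenerate :: "'a::complex_algebra set \<Rightarrow> bool"
  where "left_nondegenerate B \<longleftrightarrow> (\<forall>b\<in>B. (\<forall>x\<in>B. b * x = 0) \<longrightarrow> b = 0)"

definition right_nondegenerate :: "'a::complex_algebra set \<Rightarrow> bool"
  where "right_nondegenerate B \<longleftrightarrow> (\<forall>b\<in>B. (\<forall>x\<in>B. x * b = 0) \<longrightarrow> b = 0)"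

definition idempotent_algebra :: "'a::complex_algebra set \<Rightarrow> bool"
  where "idempotent_algebra B \<longleftrightarrow> cspan {x * y | x y. x \<in> B \<and> y \<in> B} = B"

text \<open>A \<open>J\<close>-partial algebra is given by its components \<open>G r s\<close> (for \<open>r, s \<in> J\<close>) inside an ambient
  algebra; the algebra itself is their span.\<close>

definition pa_carrier :: "'j set \<Rightarrow> ('j \<Rightarrow> 'j \<Rightarrow> 'a::complex_algebra set) \<Rightarrow> 'a set"
  where "pa_carrier J G = cspan (\<Union>r\<in>J. \<Union>s\<in>J. G r s)"

definition partial_algebra :: "'j set \<Rightarrow> ('j \<Rightarrow> 'j \<Rightarrow> 'a::complex_algebra set) \<Rightarrow> bool"
  where "partial_algebra J G \<longleftrightarrow>
    (\<forall>r\<in>J. \<forall>s\<in>J. csubspace (G r s))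
    \<and> (\<forall>S x. finite S \<and> S \<subseteq> J \<times> J \<and> (\<forall>(r, s)\<in>S. x (r, s) \<in> G r s) \<and> (\<Sum>k\<in>S. x k) = 0
          \<longrightarrow> (\<forall>k\<in>S. x k = 0))
    \<and> (\<forall>r\<in>J. \<forall>s\<in>J. \<forall>s'\<in>J. \<forall>t\<in>J. \<forall>a\<in>G r s. \<forall>b\<in>G s' t. s \<noteq> s' \<longrightarrow> a * b = 0)
    \<and> (\<forall>r\<in>J. \<forall>s\<in>J. \<forall>t\<in>J. \<forall>a\<in>G r s. \<forall>b\<in>G s t. a * b \<in> G r t)"

text \<open>\<open>pa_row J G r\<close> is $\mathbf 1(r)A$ and \<open>pa_col J G s\<close> is $A\mathbf 1(s)$.\<close>

definition pa_row :: "'j set \<Rightarrow> ('j \<Rightarrow> 'j \<Rightarrow> 'a::complex_algebra set) \<Rightarrow> 'j \<Rightarrow> 'a set"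
  where "pa_row J G r = cspan (\<Union>s\<in>J. G r s)"

definition pa_col :: "'j set \<Rightarrow> ('j \<Rightarrow> 'j \<Rightarrow> 'a::complex_algebra set) \<Rightarrow> 'j \<Rightarrow> 'a set"
  where "pa_col J G s = cspan (\<Union>r\<in>J. G r s)"

definition base_unit :: "'j set \<Rightarrow> ('j \<Rightarrow> 'j \<Rightarrow> 'a::complex_algebra set) \<Rightarrow> 'j \<Rightarrow> 'a multiplier"
  where "base_unit J G r = (THE m. \<forall>r'\<in>J. \<forall>s'\<in>J. \<forall>a\<in>G r' s'.
    m \<rhd> a = (if r = r' then a else 0) \<and> a \<lhd> m = (if r = s' then a else 0))"

definition pa_nondegenerate :: "'j set \<Rightarrow> ('j \<Rightarrow> 'j \<Rightarrow> 'a::complex_algebra set) \<Rightarrow> bool"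
  where "pa_nondegenerate J G \<longleftrightarrow>
    (\<forall>r\<in>J. left_nondegenerate (pa_col J G r) \<and> right_nondegenerate (pa_row J G r))"

definition pa_idempotent :: "'j set \<Rightarrow> ('j \<Rightarrow> 'j \<Rightarrow> 'a::complex_algebra set) \<Rightarrow> bool"
  where "pa_idempotent J G \<longleftrightarrow>
    (\<forall>r\<in>J. idempotent_algebra (pa_col J G r) \<and> idempotent_algebra (pa_row J G r))"

text \<open>A morphism from a partial algebra that is a whole type to the partial algebra with
  components \<open>H\<close>, whose multiplier algebra is identified with a corner $eM(B)e$ of the multiplier
  algebra of the ambient algebra $B$.\<close>

definition pa_morphism :: "'j set \<Rightarrow> ('j \<Rightarrow> 'j \<Rightarrow> 'a::complex_algebra set)
    \<Rightarrow> ('j \<Rightarrow> 'j \<Rightarrow> 'b::complex_algebra set) \<Rightarrow> 'b multiplier \<Rightarrow> ('a \<Rightarrow> 'b multiplier) \<Rightarrow> bool"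
  where "pa_morphism J G H e f \<longleftrightarrow>
    (\<forall>a. e * f a * e = f a)
    \<and> clinear f \<and> (\<forall>a b. f (a * b) = f a * f b)
    \<and> (\<forall>r\<in>J. cspan {b \<lhd> f a | a b. a \<in> pa_col J G r \<and> b \<in> pa_col J H r} = pa_col J H r)
    \<and> (\<forall>r\<in>J. cspan {f a \<rhd> b | a b. a \<in> pa_row J G r \<and> b \<in> pa_row J H r} = pa_row J H r)"


section \<open>Regular partial multiplier bialgebras\<close>

text \<open>For \<open>J = I \<times> I\<close>, the component ${}^r_tA^s_u$ is \<open>G (r, t) (s, u)\<close>.\<close>

type_synonym ('i, 'a) grading2 = "'i \<times> 'i \<Rightarrow> 'i \<times> 'i \<Rightarrow> 'a set"

definition upper_unit :: "'i set \<Rightarrow> ('i, 'a::complex_algebra) grading2 \<Rightarrow> 'i \<Rightarrow> 'a multiplier"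
  where "upper_unit I G r = strict_sum (\<lambda>t. base_unit (I \<times> I) G (r, t)) I"

definition lower_unit :: "'i set \<Rightarrow> ('i, 'a::complex_algebra) grading2 \<Rightarrow> 'i \<Rightarrow> 'a multiplier"
  where "lower_unit I G t = strict_sum (\<lambda>r. base_unit (I \<times> I) G (r, t)) I"

text \<open>The components of $A\otimes^I A$, and the multiplier $E_0$ for which
  $M(A\otimes^I A)$ is identified with $E_0M(A\otimes A)E_0$.\<close>

definition tensor_grading ::
    "'i set \<Rightarrow> ('i, 'a::complex_algebra) grading2 \<Rightarrow> ('i, 'a \<otimes> 'a) grading2"
  where "tensor_grading I G = (\<lambda>(r, v) (s, w).
    cspan (\<Union>t\<in>I. \<Union>u\<in>I. {a \<otimes> b | a b. a \<in> G (r, t) (s, u) \<and> b \<in> G (t, v) (u, w)}))"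

definition tensor_unit :: "'i set \<Rightarrow> ('i, 'a::complex_algebra) grading2 \<Rightarrow> ('a \<otimes> 'a) multiplier"
  where "tensor_unit I G = strict_sum (\<lambda>t. lower_unit I G t \<otimes>\<^sub>M upper_unit I G t) I"

text \<open>$\Delta\otimes\mathrm{id}$ and $\mathrm{id}\otimes\Delta$ as maps
  $A\otimes A\to M(A\otimes A\otimes A)$.\<close>

definition comult_id :: "('a::complex_algebra \<Rightarrow> ('a \<otimes> 'a) multiplier)
    \<Rightarrow> 'a \<otimes> 'a \<Rightarrow> (('a \<otimes> 'a) \<otimes> 'a) multiplier"
  where "comult_id \<Delta> = tensor_lift (\<lambda>a b. \<Delta> a \<otimes>\<^sub>M embed b)"

definition id_comult :: "('a::complex_algebra \<Rightarrow> ('a \<otimes> 'a) multiplier)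
    \<Rightarrow> 'a \<otimes> 'a \<Rightarrow> (('a \<otimes> 'a) \<otimes> 'a) multiplier"
  where "id_comult \<Delta> = tensor_lift (\<lambda>a b. multiplier_assoc (embed a \<otimes>\<^sub>M \<Delta> b))"

text \<open>The unit of $M(A\otimes^I A\otimes^I A)$ is $(E_0\otimes 1)(1\otimes E_0)$.\<close>

definition coassociative ::
    "'i set \<Rightarrow> ('i, 'a::complex_algebra) grading2 \<Rightarrow> ('a \<Rightarrow> ('a \<otimes> 'a) multiplier) \<Rightarrow> bool"
  where "coassociative I G \<Delta> \<longleftrightarrow>
    (let E0 = tensor_unit I G; E3 = (E0 \<otimes>\<^sub>M 1) * multiplier_assoc (1 \<otimes>\<^sub>M E0) in
     \<forall>a. multiplier_ext E0 (comult_id \<Delta>) E3 (\<Delta> a) = multiplier_ext E0 (id_comult \<Delta>) E3 (\<Delta> a))"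

definition regular_comultiplication ::
    "'i set \<Rightarrow> ('i, 'a::complex_algebra) grading2 \<Rightarrow> ('a \<Rightarrow> ('a \<otimes> 'a) multiplier) \<Rightarrow> bool"
  where "regular_comultiplication I G \<Delta> \<longleftrightarrow>
    pa_morphism (I \<times> I) G (tensor_grading I G) (tensor_unit I G) \<Delta>
    \<and> (\<forall>a b. \<Delta> a * (embed b \<otimes>\<^sub>M 1) \<in> range embed \<and> \<Delta> a * (1 \<otimes>\<^sub>M embed b) \<in> range embed
          \<and> (embed b \<otimes>\<^sub>M 1) * \<Delta> a \<in> range embed \<and> (1 \<otimes>\<^sub>M embed b) * \<Delta> a \<in> range embed)
    \<and> coassociative I G \<Delta>"

text \<open>$(\mathrm{id}\otimes\omega)(m)$ and $(\omega\otimes\mathrm{id})(m)$ for a multiplier $m$ such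
  that the products with $b\otimes1$, resp. $1\otimes b$, lie in the algebra. On a non-degenerate
  algebra \<open>embed\<close> is injective.\<close>

definition id_slice_multiplier ::
    "('a::complex_algebra \<Rightarrow> complex) \<Rightarrow> ('a \<otimes> 'a) multiplier \<Rightarrow> 'a multiplier"
  where "id_slice_multiplier \<omega> m = Abs_multiplier
    (\<lambda>b. id_slice \<omega> (the_inv embed (m * (embed b \<otimes>\<^sub>M 1))),
     \<lambda>b. id_slice \<omega> (the_inv embed ((embed b \<otimes>\<^sub>M 1) * m)))"

definition slice_id_multiplier ::
    "('a::complex_algebra \<Rightarrow> complex) \<Rightarrow> ('a \<otimes> 'a) multiplier \<Rightarrow> 'a multiplier"
  where "slice_id_multiplier \<omega> m = Abs_multiplier
    (\<lambda>b. slice_id \<omega> (the_inv embed (m * (1 \<otimes>\<^sub>M embed b))),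
     \<lambda>b. slice_id \<omega> (the_inv embed ((1 \<otimes>\<^sub>M embed b) * m)))"

definition partial_counit :: "'i set \<Rightarrow> ('i, 'a::complex_algebra) grading2
    \<Rightarrow> ('a \<Rightarrow> ('a \<otimes> 'a) multiplier) \<Rightarrow> ('a \<Rightarrow> complex) \<Rightarrow> bool"
  where "partial_counit I G \<Delta> \<epsilon> \<longleftrightarrow>
    clinear \<epsilon>
    \<and> (\<forall>r\<in>I. \<forall>t\<in>I. \<forall>s\<in>I. \<forall>u\<in>I. \<forall>a\<in>G (r, t) (s, u). r \<noteq> t \<or> s \<noteq> u \<longrightarrow> \<epsilon> a = 0)
    \<and> (\<forall>r\<in>I. (\<exists>a. \<epsilon> (a \<lhd> lower_unit I G r) \<noteq> 0) \<and> (\<exists>a. \<epsilon> (lower_unit I G r \<rhd> a) \<noteq> 0))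
    \<and> (\<forall>s\<in>I. \<forall>t\<in>I. \<forall>a\<in>pa_col (I \<times> I) G (s, t). \<forall>b\<in>pa_row (I \<times> I) G (s, t).
          \<epsilon> (a * b) = \<epsilon> a * \<epsilon> b)
    \<and> (\<forall>a. id_slice_multiplier \<epsilon> (\<Delta> a) = embed a \<and> slice_id_multiplier \<epsilon> (\<Delta> a) = embed a)"

definition regular_partial_multiplier_bialgebra ::
    "'i set \<Rightarrow> ('i, 'a::complex_algebra) grading2 \<Rightarrow> ('a \<Rightarrow> ('a \<otimes> 'a) multiplier) \<Rightarrow> bool"
  where "regular_partial_multiplier_bialgebra I G \<Delta> \<longleftrightarrow>
    partial_algebra (I \<times> I) G \<and> pa_carrier (I \<times> I) G = UNIV
    \<and> pa_nondegenerate (I \<times> I) G \<and> pa_idempotent (I \<times> I) G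
    \<and> regular_comultiplication I G \<Delta>
    \<and> (\<exists>\<epsilon>. partial_counit I G \<Delta> \<epsilon>)"


section \<open>Regular weak multiplier bialgebras\<close>

definition comult_T1 :: "('a::complex_algebra \<Rightarrow> ('a \<otimes> 'a) multiplier) \<Rightarrow> 'a \<otimes> 'a \<Rightarrow> 'a \<otimes> 'a"
  where "comult_T1 \<Delta> = tensor_lift (\<lambda>a b. the_inv embed (\<Delta> a * (1 \<otimes>\<^sub>M embed b)))"

definition comult_T2 :: "('a::complex_algebra \<Rightarrow> ('a \<otimes> 'a) multiplier) \<Rightarrow> 'a \<otimes> 'a \<Rightarrow> 'a \<otimes> 'a"
  where "comult_T2 \<Delta> = tensor_lift (\<lambda>a b. the_inv embed ((embed a \<otimes>\<^sub>M 1) * \<Delta> b))"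

text \<open>The clause on \<open>range embed\<close> says that all four maps $T_1,\dots,T_4$ are defined on
  $A\otimes A$; $T_3$ and $T_4$ do not occur elsewhere, because the
  exchange law and the counit law are stated in their equivalent forms for $T_1$, $T_2$.\<close>

definition regular_weak_multiplier_bialgebra ::
    "('a::complex_algebra \<Rightarrow> ('a \<otimes> 'a) multiplier) \<Rightarrow> bool"
  where "regular_weak_multiplier_bialgebra \<Delta> \<longleftrightarrow>
    idempotent_algebra (UNIV :: 'a set)
    \<and> left_nondegenerate (UNIV :: 'a set) \<and> right_nondegenerate (UNIV :: 'a set)
    \<and> clinear \<Delta> \<and> (\<forall>a b. \<Delta> (a * b) = \<Delta> a * \<Delta> b)
    \<and> (\<exists>E \<epsilon>. E * E = E \<and> clinear \<epsilon>
      \<and> (\<forall>a b. \<Delta> a * (1 \<otimes>\<^sub>M embed b) \<in> range embed \<and> (embed a \<otimes>\<^sub>M 1) * \<Delta> b \<in> range embed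
            \<and> (1 \<otimes>\<^sub>M embed b) * \<Delta> a \<in> range embed \<and> \<Delta> b * (embed a \<otimes>\<^sub>M 1) \<in> range embed)
      \<and> (let T2_id = tensor_map (comult_T2 \<Delta>) id;
             id_T1 = tensor_assoc_inv \<circ> tensor_map id (comult_T1 \<Delta>) \<circ> tensor_assoc
         in T2_id \<circ> id_T1 = id_T1 \<circ> T2_id)
      \<and> slice_id \<epsilon> \<circ> comult_T1 \<Delta> = tensor_lift (*)
      \<and> id_slice \<epsilon> \<circ> comult_T2 \<Delta> = tensor_lift (*)
      \<and> cspan {\<Delta> a \<rhd> (b \<otimes> c) | a b c. True} = cspan {E \<rhd> (b \<otimes> c) | b c. True}
      \<and> cspan {(a \<otimes> b) \<lhd> \<Delta> c | a b c. True} = cspan {(a \<otimes> b) \<lhd> E | a b. True}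
      \<and> (let E_1 = E \<otimes>\<^sub>M 1; one_E = multiplier_assoc (1 \<otimes>\<^sub>M E) in
           E_1 * one_E = one_E * E_1
           \<and> one_E * E_1 = multiplier_ext 1 (comult_id \<Delta>) E_1 E
           \<and> multiplier_ext 1 (comult_id \<Delta>) E_1 E = multiplier_ext 1 (id_comult \<Delta>) one_E E)
      \<and> (\<forall>a b c. slice_id \<epsilon> ((1 \<otimes>\<^sub>M embed a) \<rhd> E \<rhd> (b \<otimes> c)) = slice_id \<epsilon> (\<Delta> a \<rhd> (b \<otimes> c)))
      \<and> (\<forall>a b c. slice_id \<epsilon> ((a \<otimes> b) \<lhd> E \<lhd> (1 \<otimes>\<^sub>M embed c)) = slice_id \<epsilon> ((a \<otimes> b) \<lhd> \<Delta> c)))"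

end

theory Submission
  imports Defs
begin

text \<open>
  The idempotent of the weak multiplier bialgebra is the multiplier $E=\sum_t{\bf 1}_t\otimes{\bf 1}^t$
  that cuts $A\otimes^I A$ out of $A\otimes A$, and its counit is the given functional
  $\varepsilon$. On homogeneous elements everything is explicit: $E(a\otimes b)$ is $a\otimes b$ if the
  left lower index of $a$ equals the left upper index of $b$, and $0$ otherwise, and similarly on the
  right.

  Three facts carry the proof. First, idempotency of the rows and columns of $A$ gives local units
  $A(p,q)\subseteq A(p,p)A$, hence $E(A\otimes A)=B(A\otimes A)$ for $B=A\otimes^I A$. Since $\Delta$ is
  a morphism of partial algebras, $\Delta(A)(A\otimes A)=E(A\otimes A)$ and
  $(A\otimes A)\Delta(A)=(A\otimes A)E$ follow
  (\<open>nondeg_hom_comult\<close>). In particular $\Delta\otimes\mathrm{id}$ and $\mathrm{id}\otimes\Delta$ are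
  non-degenerate, and so have unique extensions $F_1$, $F_2$ to $M(A\otimes A)$, because
  $A\otimes A\otimes A$ is again non-degenerate (\<open>nondeg_hom_extend_multiplier\<close>,
  \<open>multiplier_ext_unique\<close>). They restrict to the extensions from the corner $EM(A\otimes A)E$
  in which coassociativity is stated (\<open>multiplier_ext_corner\<close>), so that
  $F_1\circ\Delta=F_2\circ\Delta$. This is the exchange law, whose two sides at $a\otimes b\otimes c$
  are $(a\otimes1\otimes1)F_1(\Delta(b))(1\otimes1\otimes c)$ and the same expression with $F_2$.

  Secondly, $\Delta(a)=({\bf 1}^r\otimes{\bf 1}_v)\Delta(a)$ for $a\in{\bf 1}\binom rvA$
  (\<open>comult_base_unit\<close>). Therefore $E$, applied to the last two legs of $\Delta(a)\otimes b$ or to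
  the first two legs of $a\otimes\Delta(b)$, is determined by the indices of $a$ and $b$, just as
  $E(a\otimes b)$ is. This gives $F_1(E)=F_2(E)=(E\otimes1)(1\otimes E)$.

  Thirdly, the partial multiplicativity of $\varepsilon$ together with its vanishing off the diagonal
  amounts to $\varepsilon(xb)=\varepsilon(x{\bf 1}_t)\varepsilon(b)$ for $b\in{\bf 1}\binom rtA$
  (\<open>counit_mult_right\<close>). With $E({\bf 1}_t\otimes{\bf 1}^s)=\delta_{t,s}{\bf 1}_t\otimes{\bf 1}^t$
  it yields the two identities between $\varepsilon$, $E$ and $\Delta$.
\<close>


section \<open>Spans and tensors\<close>

lemma clinear_in_cspan:
  assumes f: "clinear f" and x: "x \<in> cspan S" and S: "\<And>s. s \<in> S \<Longrightarrow> f s \<in> cspan T"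
  shows "f x \<in> cspan T"
  using x
proof (induction x rule: complex_vector.span_induct_alt)
  case base
  show ?case by (simp add: clinear_0[OF f] complex_vector.span_zero)
next
  case (step c x y)
  then show ?case
    by (simp add: clinear_add[OF f] clinear_scaleC[OF f] S complex_vector.span_add
        complex_vector.span_scale)
qed

lemma clinear_eq_on_cspan:
  assumes f: "clinear f" and g: "clinear g" and x: "x \<in> cspan S"
    and S: "\<And>s. s \<in> S \<Longrightarrow> f s = g s"
  shows "f x = g x"
  using x
proof (induction x rule: complex_vector.span_induct_alt)
  case base
  show ?case by (simp add: clinear_0[OF f] clinear_0[OF g])
next
  case (step c x y)
  then show ?case
    by (simp add: clinear_add[OF f] clinear_scaleC[OF f] clinear_add[OF g] clinear_scaleC[OF g] S)
qed

lemma clinear_mult_left: "clinear (\<lambda>y. x * y)" and clinear_mult_right: "clinear (\<lambda>x. x * y)"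
  for x y :: "'a::complex_algebra"
  by (simp_all add: clinear_iff distrib_left distrib_right mult_scaleC_left mult_scaleC_right)

lemma clinear_tensor_left: "clinear (\<lambda>x. x \<otimes> y)"
  and clinear_tensor_right: "clinear (\<lambda>y. x \<otimes> y)"
  by (simp_all add: clinear_iff tensor_add_left tensor_add_right tensor_scaleC_left
      tensor_scaleC_right)

lemma tensor_0_left [simp]: "0 \<otimes> y = 0" and tensor_0_right [simp]: "x \<otimes> 0 = 0"
  by (rule clinear_0[OF clinear_tensor_left] clinear_0[OF clinear_tensor_right])+

lemma clinear_const_0: "clinear (\<lambda>x. 0)"
  by (simp add: clinear_iff)

lemma clinear_sum: "clinear f \<Longrightarrow> f (\<Sum>i\<in>S. g i) = (\<Sum>i\<in>S. f (g i))"
  by (induction S rule: infinite_finite_induct) (simp_all add: clinear_0 clinear_add)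

lemma tensor_in_cspan:
  assumes a: "a \<in> cspan S" and b: "b \<in> cspan T"
  shows "a \<otimes> b \<in> cspan {s \<otimes> t | s t. s \<in> S \<and> t \<in> T}"
proof (rule clinear_in_cspan[OF clinear_tensor_left a])
  fix s assume "s \<in> S"
  then show "s \<otimes> b \<in> cspan {s \<otimes> t | s t. s \<in> S \<and> t \<in> T}"
    by (intro clinear_in_cspan[OF clinear_tensor_right b] complex_vector.span_base) blast
qed

lemma cspan_tensor_UNIV:
  assumes "cspan S = UNIV" "cspan T = UNIV"
  shows "cspan {s \<otimes> t | s t. s \<in> S \<and> t \<in> T} = UNIV"
proof -
  have "t \<in> cspan {s \<otimes> t | s t. s \<in> S \<and> t \<in> T}" for t
    by (induction t rule: tensor_induct)
       (auto intro!: complex_vector.span_zero complex_vector.span_add tensor_in_cspan simp: assms)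
  then show ?thesis by auto
qed

lemma
  assumes "clinear \<omega>"
  shows clinear_slice_id: "clinear (slice_id \<omega>)"
    and slice_id_pure: "slice_id \<omega> (a \<otimes> b) = \<omega> a *\<^sub>C b"
    and clinear_id_slice: "clinear (id_slice \<omega>)"
    and id_slice_pure: "id_slice \<omega> (c \<otimes> d) = \<omega> d *\<^sub>C c"
proof -
  have 1: "cbilinear (\<lambda>a b. \<omega> a *\<^sub>C b)" and 2: "cbilinear (\<lambda>a b. \<omega> b *\<^sub>C a)"
    using assms by (auto simp: cbilinear_def clinear_iff scaleC_add_left scaleC_add_right
        scaleC_scaleC scaleC_complex_def mult.commute)
  show "clinear (slice_id \<omega>)" "slice_id \<omega> (a \<otimes> b) = \<omega> a *\<^sub>C b"
    unfolding slice_id_def by (rule clinear_tensor_lift[OF 1] tensor_lift_pure[OF 1])+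
  show "clinear (id_slice \<omega>)" "id_slice \<omega> (c \<otimes> d) = \<omega> d *\<^sub>C c"
    unfolding id_slice_def by (rule clinear_tensor_lift[OF 2] tensor_lift_pure[OF 2])+
qed

text \<open>Expanding the first leg in a Hamel basis shows that the functionals of the first factor
  separate the points of a tensor product.\<close>

lemma slice_id_separates:
  fixes t :: "'a::complex_vector \<otimes> 'b::complex_vector"
  assumes "\<And>\<omega>. clinear \<omega> \<Longrightarrow> slice_id \<omega> t = 0"
  shows "t = 0"
proof -
  define K where "K = complex_vector.extend_basis ({} :: 'a set)"
  have K: "\<not> complex_vector.dependent K" "cspan K = UNIV"
    using complex_vector.independent_extend_basis[of "{} :: 'a set"]
      complex_vector.span_extend_basis[of "{} :: 'a set"]
    by (auto simp: K_def complex_vector.independent_empty)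
  define \<omega> where "\<omega> k a = complex_vector.representation K a k" for k a
  have \<omega>: "clinear (\<omega> k)" for k
    unfolding clinear_iff \<omega>_def
    by (simp add: complex_vector.representation_add complex_vector.representation_scale K
        scaleC_complex_def)
  note lin = clinear_slice_id[OF \<omega>]
  have "\<exists>F. finite F \<and> (\<forall>F'. finite F' \<and> F \<subseteq> F' \<longrightarrow> t = (\<Sum>k\<in>F'. k \<otimes> slice_id (\<omega> k) t))" for t :: "'a \<otimes> 'b"
  proof (induction t rule: tensor_induct)
    case zero
    then show ?case by (auto simp: clinear_0[OF lin])
  next
    case (add a b t)
    then obtain F where F: "finite F"
      "\<And>F'. finite F' \<Longrightarrow> F \<subseteq> F' \<Longrightarrow> t = (\<Sum>k\<in>F'. k \<otimes> slice_id (\<omega> k) t)" by auto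
    let ?S = "{k. \<omega> k a \<noteq> 0}"
    have S: "finite ?S" by (simp add: \<omega>_def complex_vector.finite_representation)
    have "a \<otimes> b + t = (\<Sum>k\<in>F'. k \<otimes> slice_id (\<omega> k) (a \<otimes> b + t))"
      if F': "finite F'" "F \<union> ?S \<subseteq> F'" for F'
    proof -
      have "a = (\<Sum>k\<in>?S. \<omega> k a *\<^sub>C k)"
        unfolding \<omega>_def by (rule complex_vector.sum_nonzero_representation_eq[symmetric])
          (simp_all add: K)
      also have "\<dots> = (\<Sum>k\<in>F'. \<omega> k a *\<^sub>C k)"
        using F' by (intro sum.mono_neutral_left) auto
      finally have "a \<otimes> b = (\<Sum>k\<in>F'. (\<omega> k a *\<^sub>C k) \<otimes> b)"
        by (metis (no_types) clinear_sum[OF clinear_tensor_left])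
      also have "\<dots> = (\<Sum>k\<in>F'. k \<otimes> slice_id (\<omega> k) (a \<otimes> b))"
        by (simp add: slice_id_pure[OF \<omega>] tensor_scaleC_left tensor_scaleC_right)
      finally have ab: "a \<otimes> b = (\<Sum>k\<in>F'. k \<otimes> slice_id (\<omega> k) (a \<otimes> b))" .
      have t: "t = (\<Sum>k\<in>F'. k \<otimes> slice_id (\<omega> k) t)" using F(2)[of F'] F' by simp
      show ?thesis
        unfolding clinear_add[OF lin] tensor_add_right sum.distrib using ab t by simp
    qed
    then show ?case using F(1) S by (intro exI[of _ "F \<union> ?S"]) simp
  qed
  from this[of t] obtain F where "t = (\<Sum>k\<in>F. k \<otimes> slice_id (\<omega> k) t)" by blast
  then show ?thesis by (simp add: assms[OF \<omega>])
qed

text \<open>The flip $a\otimes b\mapsto b\otimes a$.\<close>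

definition tensor_swap :: "'a::complex_vector \<otimes> 'b::complex_vector \<Rightarrow> 'b \<otimes> 'a"
  where "tensor_swap = tensor_lift (\<lambda>a b. b \<otimes> a)"

lemma clinear_tensor_swap: "clinear tensor_swap"
  and tensor_swap_pure: "tensor_swap (a \<otimes> b) = b \<otimes> a"
proof -
  have *: "cbilinear (\<lambda>a b. b \<otimes> a)"
    by (simp add: cbilinear_def clinear_tensor_left clinear_tensor_right)
  show "clinear tensor_swap" "tensor_swap (a \<otimes> b) = b \<otimes> a"
    unfolding tensor_swap_def by (rule clinear_tensor_lift[OF *] tensor_lift_pure[OF *])+
qed

lemma tensor_swap_swap: "tensor_swap (tensor_swap t) = t"
  by (induction t rule: tensor_induct)
     (simp_all add: clinear_0[OF clinear_tensor_swap] clinear_add[OF clinear_tensor_swap]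
       tensor_swap_pure)

lemma id_slice_separates:
  fixes t :: "'a::complex_vector \<otimes> 'b::complex_vector"
  assumes "\<And>\<omega>. clinear \<omega> \<Longrightarrow> id_slice \<omega> t = 0"
  shows "t = 0"
proof -
  have "slice_id \<omega> (tensor_swap t) = id_slice \<omega> t" if "clinear \<omega>" for \<omega> and t :: "'a \<otimes> 'b"
    by (induction t rule: tensor_induct)
       (simp_all add: clinear_0 clinear_add clinear_tensor_swap clinear_slice_id
         clinear_id_slice that tensor_swap_pure slice_id_pure id_slice_pure)
  then have "tensor_swap t = 0" by (intro slice_id_separates) (simp only: assms)
  then show ?thesis using tensor_swap_swap[of t] by (simp add: clinear_0[OF clinear_tensor_swap])
qed


section \<open>Non-degenerate algebras and their multipliers\<close>

text \<open>Two-sided non-degeneracy.\<close>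

definition nondegenerate :: "'a::complex_algebra set \<Rightarrow> bool"
  where "nondegenerate B \<longleftrightarrow> left_nondegenerate B \<and> right_nondegenerate B"

lemma nondegenerate_leftD:
  "nondegenerate (UNIV :: 'a::complex_algebra set) \<Longrightarrow> (\<And>x. a * x = 0) \<Longrightarrow> a = (0::'a)"
  and nondegenerate_rightD:
  "nondegenerate (UNIV :: 'a set) \<Longrightarrow> (\<And>x. x * a = 0) \<Longrightarrow> a = (0::'a)"
  unfolding nondegenerate_def left_nondegenerate_def right_nondegenerate_def by blast+

text \<open>If $t(a\otimes b)=0$ for all $a,b$, then for every functional $\omega$ the slice
  $(\omega\otimes\mathrm{id})(t(a\otimes1))$ annihilates $B$, so $t(a\otimes1)=0$; slicing in the
  second leg then gives $t=0$.\<close>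

lemma nondegenerate_tensor:
  assumes A: "nondegenerate (UNIV :: 'a::complex_algebra set)"
    and B: "nondegenerate (UNIV :: 'b::complex_algebra set)"
  shows "nondegenerate (UNIV :: ('a \<otimes> 'b) set)"
proof -
  have lin: "clinear (tensor_map (\<lambda>x. x * a) (\<lambda>x::'b. x))"
    "clinear (tensor_map (\<lambda>x. a * x) (\<lambda>x::'b. x))" for a :: 'a
    by (intro clinear_tensor_map clinear_mult_left clinear_mult_right clinear_id)+
  have pure: "tensor_map (\<lambda>x. x * a) (\<lambda>x. x) (x \<otimes> y) = (x * a) \<otimes> y"
    "tensor_map (\<lambda>x. a * x) (\<lambda>x. x) (x \<otimes> y) = (a * x) \<otimes> y" for a x :: 'a and y :: 'b
    by (intro tensor_map_pure clinear_mult_left clinear_mult_right clinear_id)+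
  have "t = 0" if t: "\<And>x. t * x = 0" for t :: "'a \<otimes> 'b"
  proof (rule id_slice_separates)
    fix \<omega> :: "'b \<Rightarrow> complex" assume \<omega>: "clinear \<omega>"
    show "id_slice \<omega> t = 0"
    proof (rule nondegenerate_leftD[OF A])
      fix a
      let ?s = "tensor_map (\<lambda>x. x * a) (\<lambda>x. x) :: 'a \<otimes> 'b \<Rightarrow> 'a \<otimes> 'b"
      have "?s t = 0"
      proof (rule slice_id_separates)
        fix \<eta> :: "'a \<Rightarrow> complex" assume \<eta>: "clinear \<eta>"
        show "slice_id \<eta> (?s t) = 0"
        proof (rule nondegenerate_leftD[OF B])
          fix b
          have "slice_id \<eta> (?s u) * b = slice_id \<eta> (u * (a \<otimes> b))" for u
            by (induction u rule: tensor_induct)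
               (simp_all add: clinear_0[OF lin(1)] clinear_add[OF lin(1)] pure
                 clinear_0[OF clinear_slice_id[OF \<eta>]] clinear_add[OF clinear_slice_id[OF \<eta>]]
                 slice_id_pure[OF \<eta>] tensor_times_pure distrib_right mult_scaleC_left)
          then show "slice_id \<eta> (?s t) * b = 0"
            by (simp add: t clinear_0[OF clinear_slice_id[OF \<eta>]])
        qed
      qed
      moreover have "id_slice \<omega> u * a = id_slice \<omega> (?s u)" for u
        by (induction u rule: tensor_induct)
           (simp_all add: clinear_0[OF lin(1)] clinear_add[OF lin(1)] pure
             clinear_0[OF clinear_id_slice[OF \<omega>]] clinear_add[OF clinear_id_slice[OF \<omega>]]
             id_slice_pure[OF \<omega>] distrib_right mult_scaleC_left)
      ultimately show "id_slice \<omega> t * a = 0"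
        by (simp add: clinear_0[OF clinear_id_slice[OF \<omega>]])
    qed
  qed
  moreover have "t = 0" if t: "\<And>x. x * t = 0" for t :: "'a \<otimes> 'b"
  proof (rule id_slice_separates)
    fix \<omega> :: "'b \<Rightarrow> complex" assume \<omega>: "clinear \<omega>"
    show "id_slice \<omega> t = 0"
    proof (rule nondegenerate_rightD[OF A])
      fix a
      let ?s = "tensor_map (\<lambda>x. a * x) (\<lambda>x. x) :: 'a \<otimes> 'b \<Rightarrow> 'a \<otimes> 'b"
      have "?s t = 0"
      proof (rule slice_id_separates)
        fix \<eta> :: "'a \<Rightarrow> complex" assume \<eta>: "clinear \<eta>"
        show "slice_id \<eta> (?s t) = 0"
        proof (rule nondegenerate_rightD[OF B])
          fix b
          have "b * slice_id \<eta> (?s u) = slice_id \<eta> ((a \<otimes> b) * u)" for u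
            by (induction u rule: tensor_induct)
               (simp_all add: clinear_0[OF lin(2)] clinear_add[OF lin(2)] pure
                 clinear_0[OF clinear_slice_id[OF \<eta>]] clinear_add[OF clinear_slice_id[OF \<eta>]]
                 slice_id_pure[OF \<eta>] tensor_times_pure distrib_left mult_scaleC_right)
          then show "b * slice_id \<eta> (?s t) = 0"
            by (simp add: t clinear_0[OF clinear_slice_id[OF \<eta>]])
        qed
      qed
      moreover have "a * id_slice \<omega> u = id_slice \<omega> (?s u)" for u
        by (induction u rule: tensor_induct)
           (simp_all add: clinear_0[OF lin(2)] clinear_add[OF lin(2)] pure
             clinear_0[OF clinear_id_slice[OF \<omega>]] clinear_add[OF clinear_id_slice[OF \<omega>]]
             id_slice_pure[OF \<omega>] distrib_left mult_scaleC_right)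
      ultimately show "a * id_slice \<omega> t = 0"
        by (simp add: clinear_0[OF clinear_id_slice[OF \<omega>]])
    qed
  qed
  ultimately show ?thesis
    unfolding nondegenerate_def left_nondegenerate_def right_nondegenerate_def by blast
qed

lemma lact_embed [simp]: "embed a \<rhd> b = a * b" and ract_embed [simp]: "b \<lhd> embed a = b * a"
  by (transfer, simp)+

lemma
  assumes "clinear l" "clinear r" "\<And>a b. a * l b = r a * b"
  shows lact_Abs_multiplier: "Abs_multiplier (l, r) \<rhd> x = l x"
    and ract_Abs_multiplier: "x \<lhd> Abs_multiplier (l, r) = r x"
proof -
  have "(l, r) \<in> {(l, r). clinear l \<and> clinear r \<and> (\<forall>a b. a * l b = r a * b)}"
    using assms by blast
  then show "Abs_multiplier (l, r) \<rhd> x = l x" "x \<lhd> Abs_multiplier (l, r) = r x"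
    by (simp_all add: lact.rep_eq ract.rep_eq Abs_multiplier_inverse)
qed

lemma tensor_lift_eqI:
  assumes "clinear F" "\<And>a b. F (a \<otimes> b) = h a b"
  shows "tensor_lift h = F"
  unfolding tensor_lift_def
proof (rule the_equality)
  show "F' = F" if "clinear F' \<and> (\<forall>a b. F' (a \<otimes> b) = h a b)" for F'
    using that assms by (intro clinear_tensor_ext) auto
qed (use assms in blast)

lemma clinear_embed: "clinear embed"
  by (rule clinearI; rule multiplier_eqI)
     (simp_all add: distrib_left distrib_right mult_scaleC_left mult_scaleC_right)

lemma embed_mult: "embed (a * b) = embed a * embed b"
  by (rule multiplier_eqI) (simp_all add: mult.assoc)

lemma clinear_lact_arg: "clinear (\<lambda>m. m \<rhd> a)" and clinear_ract_arg: "clinear (\<lambda>m. a \<lhd> m)"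
  by (simp_all add: clinear_iff)

lemmas lact_linear [simp] = clinear_0[OF clinear_lact] clinear_add[OF clinear_lact]
  clinear_scaleC[OF clinear_lact] clinear_diff[OF clinear_lact]

lemmas ract_linear [simp] = clinear_0[OF clinear_ract] clinear_add[OF clinear_ract]
  clinear_scaleC[OF clinear_ract] clinear_diff[OF clinear_ract]

context
  assumes nondeg: "nondegenerate (UNIV :: 'a::complex_algebra set)"
begin

text \<open>On a non-degenerate algebra either of its two actions determines a multiplier, and \<open>embed\<close>
  identifies the algebra with an ideal of its multiplier algebra.\<close>

lemma multiplier_eqI_left:
  assumes "\<And>a. m \<rhd> a = n \<rhd> a"
  shows "m = (n :: 'a multiplier)"
proof (rule multiplier_eqI[OF assms])
  fix a
  have "(a \<lhd> m - a \<lhd> n) * x = 0" for x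
    by (simp add: left_diff_distrib mult_lact[symmetric] assms)
  from nondegenerate_leftD[OF nondeg this] show "a \<lhd> m = a \<lhd> n" by simp
qed

lemma multiplier_eqI_right:
  assumes "\<And>a. a \<lhd> m = a \<lhd> n"
  shows "m = (n :: 'a multiplier)"
proof (rule multiplier_eqI[OF _ assms])
  fix a
  have "x * (m \<rhd> a - n \<rhd> a) = 0" for x
    by (simp add: right_diff_distrib mult_lact assms)
  from nondegenerate_rightD[OF nondeg this] show "m \<rhd> a = n \<rhd> a" by simp
qed

lemma mult_embed: "m * embed a = embed (m \<rhd> a)" for a :: 'a
  by (rule multiplier_eqI_right) (simp add: mult_lact)

lemma embed_mult_multiplier: "embed a * m = embed (a \<lhd> m)" for a :: 'a
  by (rule multiplier_eqI_left) (simp add: mult_lact)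

lemma embed_eqD: "embed a = embed b \<Longrightarrow> a = b" for a b :: 'a
proof -
  assume "embed a = embed b"
  then have "embed a \<rhd> x = embed b \<rhd> x" for x by simp
  then have "(a - b) * x = 0" for x by (simp add: left_diff_distrib)
  from nondegenerate_leftD[OF nondeg this] show ?thesis by simp
qed

lemma embed_the_inv: "m \<in> range embed \<Longrightarrow> embed (the_inv embed m) = m" for m :: "'a multiplier"
  by (rule f_the_inv_into_f) (auto intro: injI dest: embed_eqD)

lemma cbilinear_the_inv_embed:
  fixes h :: "'b::complex_vector \<Rightarrow> 'c::complex_vector \<Rightarrow> 'a multiplier"
  assumes "cbilinear h" "\<And>x y. h x y \<in> range embed"
  shows "cbilinear (\<lambda>x y. the_inv embed (h x y))"
proof -
  have lin: "clinear (h x)" "clinear (\<lambda>x. h x y)" for x y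
    using assms(1) by (simp_all add: cbilinear_def)
  show ?thesis
    by (intro cbilinearI; rule embed_eqD)
       (simp_all only: clinear_add[OF clinear_embed] clinear_scaleC[OF clinear_embed]
          embed_the_inv[OF assms(2)],
        simp_all only: clinear_add[OF lin(1)] clinear_add[OF lin(2)]
          clinear_scaleC[OF lin(1)] clinear_scaleC[OF lin(2)])
qed

lemma lact_mult: "m \<rhd> (a * b) = (m \<rhd> a) * b" for a b :: 'a
  by (rule embed_eqD) (simp add: mult_embed[symmetric] embed_mult mult.assoc)

lemma ract_mult: "(a * b) \<lhd> m = a * (b \<lhd> m)" for a b :: 'a
  by (rule embed_eqD) (simp add: embed_mult_multiplier[symmetric] embed_mult mult.assoc)

end


section \<open>Multipliers of tensor products\<close>

lemma lact_tensor [simp]: "(m \<otimes>\<^sub>M n) \<rhd> (a \<otimes> b) = (m \<rhd> a) \<otimes> (n \<rhd> b)"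
  and ract_tensor [simp]: "(a \<otimes> b) \<lhd> (m \<otimes>\<^sub>M n) = (a \<lhd> m) \<otimes> (b \<lhd> n)"
  using tensor_map_pure[OF clinear_lact clinear_lact, of m n a b]
    tensor_map_pure[OF clinear_ract clinear_ract, of m n a b]
  by (auto simp: lact.rep_eq ract.rep_eq multiplier_tensor.rep_eq split_beta)

lemma lact_eq_on_cspan:
  assumes "cspan S = UNIV" "\<And>a. a \<in> S \<Longrightarrow> m \<rhd> a = n \<rhd> a"
  shows "m \<rhd> a = n \<rhd> a"
  by (rule clinear_eq_on_cspan[OF clinear_lact clinear_lact, of a S]) (simp_all add: assms)

lemma ract_eq_on_cspan:
  assumes "cspan S = UNIV" "\<And>a. a \<in> S \<Longrightarrow> a \<lhd> m = a \<lhd> n"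
  shows "a \<lhd> m = a \<lhd> n"
  by (rule clinear_eq_on_cspan[OF clinear_ract clinear_ract, of a S]) (simp_all add: assms)

lemma multiplier_tensor_eqI:
  assumes "\<And>a b. m \<rhd> (a \<otimes> b) = n \<rhd> (a \<otimes> b)" "\<And>a b. (a \<otimes> b) \<lhd> m = (a \<otimes> b) \<lhd> n"
  shows "m = n"
proof -
  have S: "cspan {a \<otimes> b | (a::'a) (b::'b). a \<in> UNIV \<and> b \<in> UNIV} = UNIV"
    by (rule cspan_tensor_UNIV) simp_all
  show ?thesis
    by (rule multiplier_eqI; rule lact_eq_on_cspan[OF S] ract_eq_on_cspan[OF S])
       (auto simp: assms)
qed

lemma multiplier_tensor3_eqI:
  fixes m n :: "(('a::complex_algebra \<otimes> 'b::complex_algebra) \<otimes> 'c::complex_algebra) multiplier"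
  assumes "\<And>a b c. m \<rhd> ((a \<otimes> b) \<otimes> c) = n \<rhd> ((a \<otimes> b) \<otimes> c)"
    and "\<And>a b c. ((a \<otimes> b) \<otimes> c) \<lhd> m = ((a \<otimes> b) \<otimes> c) \<lhd> n"
  shows "m = n"
proof (rule multiplier_eqI)
  show "m \<rhd> t = n \<rhd> t" for t
    by (induction t rule: tensor3_induct) (simp_all add: assms)
  show "t \<lhd> m = t \<lhd> n" for t
    by (induction t rule: tensor3_induct) (simp_all add: assms)
qed

lemma multiplier_tensor_mult: "(m \<otimes>\<^sub>M n) * (m' \<otimes>\<^sub>M n') = (m * m') \<otimes>\<^sub>M (n * n')"
  by (rule multiplier_tensor_eqI) simp_all

lemma multiplier_tensor_one: "1 \<otimes>\<^sub>M 1 = 1"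
  by (rule multiplier_tensor_eqI) simp_all

lemma embed_tensor: "embed (a \<otimes> b) = embed a \<otimes>\<^sub>M embed b"
  by (rule multiplier_tensor_eqI) (simp_all add: tensor_times_pure)

lemma cbilinear_multiplier_tensor: "cbilinear (\<otimes>\<^sub>M)"
  by (rule cbilinearI; rule multiplier_tensor_eqI)
     (simp_all add: tensor_add_left tensor_add_right tensor_scaleC_left tensor_scaleC_right)

lemma clinear_multiplier_tensor_left: "clinear (\<lambda>m. m \<otimes>\<^sub>M n)"
  and clinear_multiplier_tensor_right: "clinear (\<lambda>n. m \<otimes>\<^sub>M n)"
  using cbilinear_multiplier_tensor by (auto simp: cbilinear_def)

lemma multiplier_tensor_0 [simp]: "0 \<otimes>\<^sub>M n = 0" "m \<otimes>\<^sub>M 0 = 0"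
  by (rule clinear_0[OF clinear_multiplier_tensor_left]
      clinear_0[OF clinear_multiplier_tensor_right])+

lemma lact_assoc: "multiplier_assoc m \<rhd> t = tensor_assoc_inv (m \<rhd> tensor_assoc t)"
  and ract_assoc: "t \<lhd> multiplier_assoc m = tensor_assoc_inv (tensor_assoc t \<lhd> m)"
  by (transfer, auto)+

lemma multiplier_assoc_mult: "multiplier_assoc (m * n) = multiplier_assoc m * multiplier_assoc n"
  by (rule multiplier_eqI) (simp_all add: lact_assoc ract_assoc)

lemma clinear_multiplier_assoc: "clinear multiplier_assoc"
  by (rule clinearI; rule multiplier_eqI)
     (simp_all add: lact_assoc ract_assoc clinear_add clinear_scaleC clinear_tensor_assoc_inv)

lemma multiplier_assoc_tensor: "multiplier_assoc (l \<otimes>\<^sub>M (m \<otimes>\<^sub>M n)) = (l \<otimes>\<^sub>M m) \<otimes>\<^sub>M n"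
  by (rule multiplier_tensor3_eqI)
     (simp_all add: lact_assoc ract_assoc tensor_assoc_pure tensor_assoc_inv_pure)

lemma embed_assoc_inv: "embed (tensor_assoc_inv t) = multiplier_assoc (embed t)"
proof -
  have "tensor_assoc_inv (s * t) = tensor_assoc_inv s * tensor_assoc_inv t"
    for s t :: "'a \<otimes> ('b \<otimes> 'c)"
    by (metis tensor_assoc_mult tensor_assoc_assoc_inv tensor_assoc_inv_assoc)
  then show ?thesis by (intro multiplier_eqI) (simp_all add: lact_assoc ract_assoc)
qed


section \<open>Extending non-degenerate homomorphisms to multiplier algebras\<close>

text \<open>A homomorphism \<open>f\<close> from an algebra into the corner $eM(C)e$ is non-degenerate if
  $f(B)C=eC$ and $Cf(B)=Ce$.\<close>

definition nondeg_hom ::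
    "('b::complex_algebra \<Rightarrow> 'c::complex_algebra multiplier) \<Rightarrow> 'c multiplier \<Rightarrow> bool"
  where "nondeg_hom f e \<longleftrightarrow> clinear f \<and> (\<forall>a b. f (a * b) = f a * f b)
    \<and> e * e = e \<and> (\<forall>a. e * f a = f a \<and> f a * e = f a)
    \<and> (\<forall>y. e \<rhd> y \<in> cspan {f a \<rhd> z | a z. True})
    \<and> (\<forall>y. y \<lhd> e \<in> cspan {z \<lhd> f a | a z. True})"

lemma nondeg_homD:
  assumes "nondeg_hom f e"
  shows "clinear f" "f (a * b) = f a * f b" "e * e = e" "e * f a = f a" "f a * e = f a"
    "e \<rhd> y \<in> cspan {f a \<rhd> z | a z. True}" "y \<lhd> e \<in> cspan {z \<lhd> f a | a z. True}"
    "e \<rhd> f a \<rhd> y = f a \<rhd> y" "f a \<rhd> e \<rhd> y = f a \<rhd> y"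
    "y \<lhd> e \<lhd> f a = y \<lhd> f a" "y \<lhd> f a \<lhd> e = y \<lhd> f a"
    "e \<rhd> e \<rhd> y = e \<rhd> y" "y \<lhd> e \<lhd> e = y \<lhd> e"
proof -
  show *: "clinear f" "f (a * b) = f a * f b" "e * e = e" "e * f a = f a" "f a * e = f a"
    "e \<rhd> y \<in> cspan {f a \<rhd> z | a z. True}" "y \<lhd> e \<in> cspan {z \<lhd> f a | a z. True}"
    using assms unfolding nondeg_hom_def by blast+
  show "e \<rhd> f a \<rhd> y = f a \<rhd> y" "f a \<rhd> e \<rhd> y = f a \<rhd> y"
    "y \<lhd> e \<lhd> f a = y \<lhd> f a" "y \<lhd> f a \<lhd> e = y \<lhd> f a"
    "e \<rhd> e \<rhd> y = e \<rhd> y" "y \<lhd> e \<lhd> e = y \<lhd> e"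
    unfolding lact_simps(7)[symmetric] ract_simps(7)[symmetric] * by simp_all
qed

text \<open>A multiplier \<open>m\<close> with \<open>m * e = m\<close> is determined by its products with the elements \<open>f a\<close>.\<close>

lemma nondeg_hom_multiplier_eqI:
  fixes f :: "'b::complex_algebra \<Rightarrow> 'c::complex_algebra multiplier"
  assumes f: "nondeg_hom f e" and C: "nondegenerate (UNIV :: 'c set)"
    and "m * e = m" "n * e = n" and eq: "\<And>a. m * f a = n * f a"
  shows "m = n"
proof (rule multiplier_eqI_left[OF C])
  fix y
  have "m \<rhd> e \<rhd> y = n \<rhd> e \<rhd> y"
  proof (rule clinear_eq_on_cspan[OF clinear_lact clinear_lact nondeg_homD(6)[OF f]])
    fix s assume "s \<in> {f a \<rhd> z | a z. True}"
    then show "m \<rhd> s = n \<rhd> s" using eq by (auto simp flip: lact_simps(7))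
  qed
  then show "m \<rhd> y = n \<rhd> y" using assms(3,4) by (metis lact_simps(7))
qed

text \<open>For \<open>m\<close> in $M(B)$ the extension has to satisfy $f(b)F(m)=f(bm)$ and
  $F(m)f(b)=f(mb)$. The first condition determines $F(m)y$ because $Cf(B)=Ce$ is faithful on $eC$;
  a solution exists because $ey$ is a sum of elements $f(b)z$, for which $f(mb)z$ is one.\<close>

lemma nondeg_hom_extend_multiplier:
  fixes f :: "'b::complex_algebra \<Rightarrow> 'c::complex_algebra multiplier"
  assumes f: "nondeg_hom f e" and C: "nondegenerate (UNIV :: 'c set)"
    and B: "nondegenerate (UNIV :: 'b set)"
  shows "\<exists>n. e * n = n \<and> n * e = n \<and> (\<forall>b. n * f b = f (m \<rhd> b))"
proof -
  note D = nondeg_homD[OF f]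
  define L where "L y z \<longleftrightarrow> e \<rhd> z = z \<and> (\<forall>b. f b \<rhd> z = f (b \<lhd> m) \<rhd> y)" for y z
  define R where "R y z \<longleftrightarrow> z \<lhd> e = z \<and> (\<forall>b. z \<lhd> f b = y \<lhd> f (m \<rhd> b))" for y z
  have L_unique: "z = z'" if "L y z" "L y z'" for y z z'
  proof -
    have "x * (z - z') = 0" for x
    proof -
      have "(x \<lhd> e) * (z - z') = 0"
      proof (rule clinear_eq_on_cspan[OF clinear_mult_right clinear_const_0 D(7)])
        fix s assume "s \<in> {w \<lhd> f a | a w. True}"
        then show "s * (z - z') = 0"
          using that by (auto simp: L_def mult_lact[symmetric])
      qed
      then show ?thesis using that by (simp add: L_def mult_lact[symmetric])
    qed
    from nondegenerate_rightD[OF C this] show ?thesis by simp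
  qed
  have R_unique: "z = z'" if "R y z" "R y z'" for y z z'
  proof -
    have "(z - z') * x = 0" for x
    proof -
      have "(z - z') * (e \<rhd> x) = 0"
      proof (rule clinear_eq_on_cspan[OF clinear_mult_left clinear_const_0 D(6)])
        fix s assume "s \<in> {f a \<rhd> w | a w. True}"
        then show "(z - z') * s = 0"
          using that by (auto simp: R_def mult_lact)
      qed
      then show ?thesis using that by (simp add: R_def mult_lact)
    qed
    from nondegenerate_leftD[OF C this] show ?thesis by simp
  qed
  have L_add: "L (y + y') (z + z')" if "L y z" "L y' z'" for y y' z z'
    using that by (simp add: L_def)
  have R_add: "R (y + y') (z + z')" if "R y z" "R y' z'" for y y' z z'
    using that by (simp add: R_def)
  have L_scale: "L (c *\<^sub>C y) (c *\<^sub>C z)" if "L y z" for c y z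
    using that by (simp add: L_def)
  have R_scale: "R (c *\<^sub>C y) (c *\<^sub>C z)" if "R y z" for c y z
    using that by (simp add: R_def)
  have L_gen: "L (f b \<rhd> z) (f (m \<rhd> b) \<rhd> z)" for b z
    by (simp add: L_def D flip: lact_simps(7)) (simp flip: D(2) add: mult_lact)
  have R_gen: "R (z \<lhd> f b) (z \<lhd> f (b \<lhd> m))" for b z
    by (simp add: R_def D flip: ract_simps(7)) (simp flip: D(2) add: mult_lact)
  have L_e: "L y z" if "L (e \<rhd> y) z" for y z using that by (simp add: L_def D)
  have R_e: "R y z" if "R (y \<lhd> e) z" for y z using that by (simp add: R_def D)
  have "\<exists>z. L w z" if "w \<in> cspan {f a \<rhd> z | a z. True}" for w
    using that
  proof (induction w rule: complex_vector.span_induct_alt)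
    case base
    show ?case by (rule exI[of _ 0]) (simp add: L_def)
  next
    case (step c x y)
    then show ?case using L_add L_scale L_gen by blast
  qed
  then have "\<exists>z. L y z" for y using L_e D(6) by blast
  then obtain l where l: "\<And>y. L y (l y)" by metis
  have "\<exists>z. R w z" if "w \<in> cspan {z \<lhd> f a | a z. True}" for w
    using that
  proof (induction w rule: complex_vector.span_induct_alt)
    case base
    show ?case by (rule exI[of _ 0]) (simp add: R_def)
  next
    case (step c x y)
    then show ?case using R_add R_scale R_gen by blast
  qed
  then have "\<exists>z. R y z" for y using R_e D(7) by blast
  then obtain r where r: "\<And>y. R y (r y)" by metis
  have lin: "clinear l" "clinear r"
    by (rule clinearI; metis l r L_unique R_unique L_add L_scale R_add R_scale)+
  have lr: "a * l b = r a * b" for a b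
  proof -
    have "r (a \<lhd> e) = r a" by (rule R_unique[of a]) (simp_all add: R_e r)
    moreover have "(a \<lhd> e) * l b = r (a \<lhd> e) * b"
    proof (rule clinear_eq_on_cspan[OF clinear_mult_right
          clinear_compose[OF lin(2) clinear_mult_right] D(7)])
      fix s assume "s \<in> {z \<lhd> f a | a z. True}"
      then obtain z c where s: "s = z \<lhd> f c" by blast
      have "r s = z \<lhd> f (c \<lhd> m)" unfolding s by (rule R_unique[OF r R_gen])
      then show "s * l b = r s * b"
        using l[of b] by (simp add: s L_def mult_lact[symmetric])
    qed
    moreover have "a * l b = (a \<lhd> e) * l b"
      using l[of b] by (simp add: L_def mult_lact[symmetric])
    ultimately show ?thesis by simp
  qed
  define n where "n = Abs_multiplier (l, r)"
  have n: "n \<rhd> y = l y" "y \<lhd> n = r y" for y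
    unfolding n_def by (rule lact_Abs_multiplier[OF lin lr] ract_Abs_multiplier[OF lin lr])+
  have "e * n = n"
    by (rule multiplier_eqI_left[OF C]) (use l in \<open>auto simp: n L_def\<close>)
  moreover have "n * e = n"
    by (rule multiplier_eqI_right[OF C]) (use r in \<open>auto simp: n R_def\<close>)
  moreover have "n * f b = f (m \<rhd> b)" for b
    by (rule multiplier_eqI_right[OF C]) (use r in \<open>auto simp: n R_def\<close>)
  ultimately show ?thesis by blast
qed

text \<open>The defining conditions of \<open>multiplier_ext\<close>, for a corner on which \<open>f\<close> is still
  non-degenerate, determine the extension.\<close>

lemma multiplier_ext_unique:
  fixes f :: "'b::complex_algebra \<Rightarrow> 'c::complex_algebra multiplier"
  assumes C: "nondegenerate (UNIV :: 'c set)" and B: "nondegenerate (UNIV :: 'b set)"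
    and p: "p * p = p"
    and span: "\<And>y. e \<rhd> y \<in> cspan {f ((p \<rhd> a) \<lhd> p) \<rhd> z | a z. True}"
    and F: "\<And>m. F (p * m * p) = F m" "\<And>m n. F ((p * m * p) * (p * n * p)) = F m * F n"
      "F p = e" "\<And>a. F (embed ((p \<rhd> a) \<lhd> p)) = f ((p \<rhd> a) \<lhd> p)"
    and F': "\<And>m. F' (p * m * p) = F' m" "\<And>m n. F' ((p * m * p) * (p * n * p)) = F' m * F' n"
      "F' p = e" "\<And>a. F' (embed ((p \<rhd> a) \<lhd> p)) = f ((p \<rhd> a) \<lhd> p)"
  shows "F' = F"
proof
  fix m
  have p': "p * (p * x) = p * x" for x using p by (metis mult.assoc)
  have val: "H m * H p = H m" "H m * f ((p \<rhd> a) \<lhd> p) = f ((p \<rhd> (m \<rhd> ((p \<rhd> a) \<lhd> p))) \<lhd> p)"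
    if H: "\<And>m. H (p * m * p) = H m" "\<And>m n. H ((p * m * p) * (p * n * p)) = H m * H n"
      "\<And>a. H (embed ((p \<rhd> a) \<lhd> p)) = f ((p \<rhd> a) \<lhd> p)" for H a
  proof -
    have "H m * H p = H ((p * m * p) * (p * p * p))" by (simp only: H(2))
    also have "(p * m * p) * (p * p * p) = p * m * p" by (simp add: mult.assoc p p')
    finally show "H m * H p = H m" by (simp only: H(1))
    let ?b = "(p \<rhd> a) \<lhd> p"
    have b: "p * embed ?b * p = embed ?b"
      by (simp add: p p' mult.assoc flip: embed_mult_multiplier[OF B] mult_embed[OF B])
    have "H m * f ?b = H ((p * m * p) * (p * embed ?b * p))" by (simp only: H(2,3))
    also have "(p * m * p) * (p * embed ?b * p) = embed ((p \<rhd> (m \<rhd> ?b)) \<lhd> p)"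
      by (simp add: p p' mult.assoc flip: embed_mult_multiplier[OF B] mult_embed[OF B])
    finally show "H m * f ?b = f ((p \<rhd> (m \<rhd> ?b)) \<lhd> p)" by (simp only: H(3))
  qed
  note v = val[of F, OF F(1,2,4)] and v' = val[of F', OF F'(1,2,4)]
  show "F' m = F m"
  proof (rule multiplier_eqI_left[OF C])
    fix y
    have "F' m \<rhd> e \<rhd> y = F m \<rhd> e \<rhd> y"
    proof (rule clinear_eq_on_cspan[OF clinear_lact clinear_lact span])
      fix s assume "s \<in> {f ((p \<rhd> a) \<lhd> p) \<rhd> z | a z. True}"
      then show "F' m \<rhd> s = F m \<rhd> s" by (auto simp: v v' simp flip: lact_simps(7))
    qed
    then show "F' m \<rhd> y = F m \<rhd> y" using v(1) v'(1) F(3) F'(3) by (metis lact_simps(7))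
  qed
qed

lemma multiplier_ext_eqI:
  fixes f :: "'b::complex_algebra \<Rightarrow> 'c::complex_algebra multiplier"
  assumes C: "nondegenerate (UNIV :: 'c set)" and B: "nondegenerate (UNIV :: 'b set)"
    and p: "p * p = p"
    and span: "\<And>y. e \<rhd> y \<in> cspan {f ((p \<rhd> a) \<lhd> p) \<rhd> z | a z. True}"
    and F: "clinear F" "\<And>m. F (p * m * p) = F m"
      "\<And>m n. F ((p * m * p) * (p * n * p)) = F m * F n"
      "F p = e" "\<And>a. F (embed ((p \<rhd> a) \<lhd> p)) = f ((p \<rhd> a) \<lhd> p)"
  shows "multiplier_ext p f e = F"
  unfolding multiplier_ext_def
proof (rule the_equality)
  show "clinear F \<and> (\<forall>m. F (p * m * p) = F m) \<and> (\<forall>m n. F ((p * m * p) * (p * n * p)) = F m * F n)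
    \<and> F p = e \<and> (\<forall>a. F (embed ((p \<rhd> a) \<lhd> p)) = f ((p \<rhd> a) \<lhd> p))"
    using F by blast
  fix F'
  assume "clinear F' \<and> (\<forall>m. F' (p * m * p) = F' m)
    \<and> (\<forall>m n. F' ((p * m * p) * (p * n * p)) = F' m * F' n)
    \<and> F' p = e \<and> (\<forall>a. F' (embed ((p \<rhd> a) \<lhd> p)) = f ((p \<rhd> a) \<lhd> p))"
  then show "F' = F"
    by (intro multiplier_ext_unique[OF C B p span F(2-5)]) blast+
qed

lemma
  fixes f :: "'b::complex_algebra \<Rightarrow> 'c::complex_algebra multiplier"
  assumes f: "nondeg_hom f e" and C: "nondegenerate (UNIV :: 'c set)"
    and B: "nondegenerate (UNIV :: 'b set)"
  shows clinear_multiplier_ext: "clinear (multiplier_ext 1 f e)"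
    and multiplier_ext_mult: "multiplier_ext 1 f e (m * n) = multiplier_ext 1 f e m * multiplier_ext 1 f e n"
    and multiplier_ext_embed: "multiplier_ext 1 f e (embed a) = f a"
    and multiplier_ext_unit: "e * multiplier_ext 1 f e m = multiplier_ext 1 f e m"
      "multiplier_ext 1 f e m * e = multiplier_ext 1 f e m"
    and multiplier_ext_hom: "multiplier_ext 1 f e m * f a = f (m \<rhd> a)"
proof -
  note D = nondeg_homD[OF f]
  obtain F where F: "e * F m = F m" "F m * e = F m" "F m * f b = f (m \<rhd> b)" for m b
    using nondeg_hom_extend_multiplier[OF f C B] by metis
  have eqI: "F m = n" if "n * e = n" "\<And>b. n * f b = f (m \<rhd> b)" for m n
    by (rule nondeg_hom_multiplier_eqI[OF f C F(2) that(1)]) (simp add: F(3) that(2))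
  have lin: "clinear F"
    by (rule clinearI; rule eqI)
       (simp_all add: F distrib_right mult_scaleC_left clinear_add[OF D(1)] clinear_scaleC[OF D(1)])
  have mult: "F (m * n) = F m * F n" for m n
    by (rule eqI) (simp_all add: F mult.assoc)
  have one: "F 1 = e" by (rule eqI) (simp_all add: D)
  have emb: "F (embed a) = f a" for a by (rule eqI) (simp_all add: D)
  have "multiplier_ext 1 f e = F"
    by (rule multiplier_ext_eqI[OF C B]) (use D(6) in \<open>simp_all add: lin mult one emb D(1)\<close>)
  then show "clinear (multiplier_ext 1 f e)"
    "multiplier_ext 1 f e (m * n) = multiplier_ext 1 f e m * multiplier_ext 1 f e n"
    "multiplier_ext 1 f e (embed a) = f a"
    "e * multiplier_ext 1 f e m = multiplier_ext 1 f e m"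
    "multiplier_ext 1 f e m * e = multiplier_ext 1 f e m"
    "multiplier_ext 1 f e m * f a = f (m \<rhd> a)"
    by (simp_all add: lin mult one emb F)
qed

lemma multiplier_ext_value_eqI:
  fixes f :: "'b::complex_algebra \<Rightarrow> 'c::complex_algebra multiplier"
  assumes f: "nondeg_hom f e" and C: "nondegenerate (UNIV :: 'c set)"
    and B: "nondegenerate (UNIV :: 'b set)"
    and "n * e = n" and S: "cspan S = UNIV" and eq: "\<And>b. b \<in> S \<Longrightarrow> n * f b = f (m \<rhd> b)"
  shows "multiplier_ext 1 f e m = n"
proof (rule nondeg_hom_multiplier_eqI[OF f C multiplier_ext_unit(2)[OF f C B] assms(4)])
  fix b
  note lin = nondeg_homD(1)[OF f]
  have "f (m \<rhd> b) = n * f b"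
    by (rule clinear_eq_on_cspan[OF clinear_compose[OF clinear_lact lin]
          clinear_compose[OF lin clinear_mult_left], of b S]) (simp_all add: S eq)
  then show "multiplier_ext 1 f e m * f b = n * f b"
    by (simp add: multiplier_ext_hom[OF f C B])
qed

text \<open>The extension from a corner $pM(B)p$ is the restriction of the extension from $M(B)$,
  as soon as $pB=(pBp)B$.\<close>

lemma multiplier_ext_corner:
  fixes f :: "'b::complex_algebra \<Rightarrow> 'c::complex_algebra multiplier"
  assumes f: "nondeg_hom f e" and C: "nondegenerate (UNIV :: 'c set)"
    and B: "nondegenerate (UNIV :: 'b set)"
    and p: "p * p = p" and pB: "\<And>b. p \<rhd> b \<in> cspan {((p \<rhd> a) \<lhd> p) * c | a c. True}"
    and e': "multiplier_ext 1 f e p = e'"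
  shows "multiplier_ext p f e' m = multiplier_ext 1 f e (p * m * p)"
proof -
  let ?F = "multiplier_ext 1 f e"
  let ?S = "{f ((p \<rhd> a) \<lhd> p) \<rhd> z | a z. True}"
  note D = nondeg_homD[OF f]
  note E = multiplier_ext_mult[OF f C B] multiplier_ext_embed[OF f C B]
    multiplier_ext_unit[OF f C B] multiplier_ext_hom[OF f C B]
  have p': "p * (p * x) = p * x" for x using p by (metis mult.assoc)
  have pb: "f (p \<rhd> b) \<rhd> z \<in> cspan ?S" for b z
  proof (rule clinear_in_cspan[OF clinear_compose[OF D(1) clinear_lact_arg] pB])
    fix s assume "s \<in> {((p \<rhd> a) \<lhd> p) * c | a c. True}"
    then obtain a c where "f s \<rhd> z = f ((p \<rhd> a) \<lhd> p) \<rhd> f c \<rhd> z" by (auto simp: D(2))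
    then show "f s \<rhd> z \<in> cspan ?S" by (blast intro: complex_vector.span_base)
  qed
  have span: "e' \<rhd> y \<in> cspan ?S" for y
  proof -
    have "e' \<rhd> e \<rhd> y \<in> cspan ?S"
    proof (rule clinear_in_cspan[OF clinear_lact D(6)])
      fix s assume "s \<in> {f a \<rhd> z | a z. True}"
      then show "e' \<rhd> s \<in> cspan ?S"
        using pb by (auto simp: E simp flip: e' lact_simps(7))
    qed
    then show ?thesis using E(4)[of p] by (metis e' lact_simps(7))
  qed
  have corner: "(p \<rhd> ((p \<rhd> a) \<lhd> p)) \<lhd> p = (p \<rhd> a) \<lhd> p" for a
    by (rule embed_eqD[OF B])
       (simp add: p p' mult.assoc flip: embed_mult_multiplier[OF B] mult_embed[OF B])
  have "multiplier_ext p f e' = (\<lambda>m. ?F (p * m * p))"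
  proof (rule multiplier_ext_eqI[OF C B p span])
    show "clinear (\<lambda>m. ?F (p * m * p))"
      by (intro clinear_compose[OF _ clinear_multiplier_ext[OF f C B]]
          clinear_compose[OF clinear_mult_left clinear_mult_right])
    show "?F (p * p * p) = e'" by (simp add: p e')
    show "?F (p * embed ((p \<rhd> a) \<lhd> p) * p) = f ((p \<rhd> a) \<lhd> p)" for a
      by (simp add: embed_mult_multiplier[OF B] mult_embed[OF B] E corner)
    show "?F (p * (p * m * p) * p) = ?F (p * m * p)" for m
      by (simp add: mult.assoc p p')
    show "?F (p * (p * m * p * (p * n * p)) * p) = ?F (p * m * p) * ?F (p * n * p)" for m n
      unfolding E(1)[symmetric] by (simp add: mult.assoc p p')
  qed
  then show ?thesis by simp
qed

lemma nondeg_hom_embed: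
  assumes "idempotent_algebra (UNIV :: 'a::complex_algebra set)"
  shows "nondeg_hom (embed :: 'a \<Rightarrow> _) 1"
proof -
  have "y \<in> cspan {a * z | a z. True}" for y :: 'a
    using assms by (simp add: idempotent_algebra_def)
  moreover have "{a * z | a z. True} = {z * a | a z :: 'a. True}" by blast
  ultimately show ?thesis
    unfolding nondeg_hom_def by (simp add: clinear_embed embed_mult)
qed

text \<open>Non-degenerate homomorphisms are closed under tensor products.\<close>

lemma nondeg_hom_tensor:
  fixes f :: "'a::complex_algebra \<Rightarrow> 'c::complex_algebra multiplier"
    and g :: "'b::complex_algebra \<Rightarrow> 'd::complex_algebra multiplier"
  assumes f: "nondeg_hom f e" and g: "nondeg_hom g e'"
  shows "nondeg_hom (tensor_lift (\<lambda>a b. f a \<otimes>\<^sub>M g b)) (e \<otimes>\<^sub>M e')"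
    and "tensor_lift (\<lambda>a b. f a \<otimes>\<^sub>M g b) (a \<otimes> b) = f a \<otimes>\<^sub>M g b"
proof -
  note D = nondeg_homD[OF f] and D' = nondeg_homD[OF g]
  let ?h = "tensor_lift (\<lambda>a b. f a \<otimes>\<^sub>M g b)"
  have bil: "cbilinear (\<lambda>a b. f a \<otimes>\<^sub>M g b)"
    unfolding cbilinear_def
    using clinear_compose[OF D(1) clinear_multiplier_tensor_left]
      clinear_compose[OF D'(1) clinear_multiplier_tensor_right] by blast
  note lin = clinear_tensor_lift[OF bil]
  show pure: "?h (a \<otimes> b) = f a \<otimes>\<^sub>M g b" for a b by (rule tensor_lift_pure[OF bil])
  note l0 = clinear_0[OF lin] clinear_add[OF lin]
  have "?h ((a \<otimes> b) * t) = ?h (a \<otimes> b) * ?h t" for a b t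
    by (induction t rule: tensor_induct)
       (simp_all add: l0 pure distrib_left tensor_times_pure multiplier_tensor_mult D(2) D'(2))
  then have mult: "?h (s * t) = ?h s * ?h t" for s t
    by (induction s rule: tensor_induct) (simp_all add: l0 distrib_right)
  have unit: "(e \<otimes>\<^sub>M e') * ?h t = ?h t" "?h t * (e \<otimes>\<^sub>M e') = ?h t" for t
    by (induction t rule: tensor_induct)
       (simp_all add: l0 pure distrib_left distrib_right multiplier_tensor_mult D D')
  have left: "(e \<otimes>\<^sub>M e') \<rhd> t \<in> cspan {?h u \<rhd> z | u z. True}" for t
  proof (induction t rule: tensor_induct)
    case zero
    show ?case by (simp add: complex_vector.span_zero)
  next
    case (add x y t)
    have "(e \<rhd> x) \<otimes> (e' \<rhd> y) \<in> cspan {s \<otimes> t | s t. s \<in> {f a \<rhd> z | a z. True}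
        \<and> t \<in> {g a \<rhd> z | a z. True}}"
      by (rule tensor_in_cspan) (rule D D')+
    also have "\<dots> \<subseteq> cspan {?h u \<rhd> z | u z. True}"
    proof (rule complex_vector.span_mono, clarify)
      fix a z b w
      show "\<exists>u v. (f a \<rhd> z) \<otimes> (g b \<rhd> w) = ?h u \<rhd> v \<and> True"
        by (rule exI[of _ "a \<otimes> b"], rule exI[of _ "z \<otimes> w"]) (simp add: pure)
    qed
    finally show ?case using add by (simp add: complex_vector.span_add)
  qed
  have right: "t \<lhd> (e \<otimes>\<^sub>M e') \<in> cspan {z \<lhd> ?h u | u z. True}" for t
  proof (induction t rule: tensor_induct)
    case zero
    show ?case by (simp add: complex_vector.span_zero)
  next
    case (add x y t)
    have "(x \<lhd> e) \<otimes> (y \<lhd> e') \<in> cspan {s \<otimes> t | s t. s \<in> {z \<lhd> f a | a z. True}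
        \<and> t \<in> {z \<lhd> g a | a z. True}}"
      by (rule tensor_in_cspan) (rule D D')+
    also have "\<dots> \<subseteq> cspan {z \<lhd> ?h u | u z. True}"
    proof (rule complex_vector.span_mono, clarify)
      fix a z b w
      show "\<exists>u v. (z \<lhd> f a) \<otimes> (w \<lhd> g b) = v \<lhd> ?h u \<and> True"
        by (rule exI[of _ "a \<otimes> b"], rule exI[of _ "z \<otimes> w"]) (simp add: pure)
    qed
    finally show ?case using add by (simp add: complex_vector.span_add)
  qed
  show "nondeg_hom ?h (e \<otimes>\<^sub>M e')"
    unfolding nondeg_hom_def
    using lin mult unit left right by (simp add: multiplier_tensor_mult D(3) D'(3))
qed

lemma nondeg_hom_assoc:
  assumes f: "nondeg_hom f e"
  shows "nondeg_hom (\<lambda>a. multiplier_assoc (f a)) (multiplier_assoc e)"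
proof -
  note D = nondeg_homD[OF f]
  have "multiplier_assoc e \<rhd> y \<in> cspan {multiplier_assoc (f a) \<rhd> z | a z. True}" for y
    unfolding lact_assoc[of e]
  proof (rule clinear_in_cspan[OF clinear_tensor_assoc_inv D(6)])
    fix s assume "s \<in> {f a \<rhd> z | a z. True}"
    then obtain a z where "s = f a \<rhd> z" by blast
    then have "tensor_assoc_inv s = multiplier_assoc (f a) \<rhd> tensor_assoc_inv z"
      by (simp add: lact_assoc)
    then show "tensor_assoc_inv s \<in> cspan {multiplier_assoc (f a) \<rhd> z | a z. True}"
      by (auto intro: complex_vector.span_base)
  qed
  moreover have "y \<lhd> multiplier_assoc e \<in> cspan {z \<lhd> multiplier_assoc (f a) | a z. True}" for y
    unfolding ract_assoc[of _ e]
  proof (rule clinear_in_cspan[OF clinear_tensor_assoc_inv D(7)])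
    fix s assume "s \<in> {z \<lhd> f a | a z. True}"
    then obtain a z where "s = z \<lhd> f a" by blast
    then have "tensor_assoc_inv s = tensor_assoc_inv z \<lhd> multiplier_assoc (f a)"
      by (simp add: ract_assoc)
    then show "tensor_assoc_inv s \<in> cspan {z \<lhd> multiplier_assoc (f a) | a z. True}"
      by (auto intro: complex_vector.span_base)
  qed
  ultimately show ?thesis
    unfolding nondeg_hom_def
    by (simp add: clinear_compose[OF D(1) clinear_multiplier_assoc] D flip: multiplier_assoc_mult)
qed


section \<open>Strict sums of multipliers\<close>

lemma finite_support_cspan:
  assumes lin: "\<And>i. clinear (f i)" and B: "cspan B = UNIV"
    and fin: "\<And>b. b \<in> B \<Longrightarrow> finite {i\<in>S. f i b \<noteq> 0}"
  shows "finite {i\<in>S. f i a \<noteq> 0}"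
proof -
  have "a \<in> cspan B" by (simp add: B)
  then show ?thesis
  proof (induction a rule: complex_vector.span_induct_alt)
    case base
    show ?case by (simp add: clinear_0[OF lin])
  next
    case (step c x y)
    have "{i\<in>S. f i (c *\<^sub>C x + y) \<noteq> 0} \<subseteq> {i\<in>S. f i x \<noteq> 0} \<union> {i\<in>S. f i y \<noteq> 0}"
      by (auto simp: clinear_add[OF lin] clinear_scaleC[OF lin])
    then show ?case using fin[OF step(1)] step(2) by (meson finite_UnI finite_subset)
  qed
qed

text \<open>A family of multipliers that is locally finite on a spanning set is strictly summable.\<close>

lemma
  fixes f :: "'x \<Rightarrow> 'a::complex_algebra multiplier"
  assumes B: "cspan B = UNIV"
    and fin: "\<And>b. b \<in> B \<Longrightarrow> finite {i\<in>S. f i \<rhd> b \<noteq> 0}" "\<And>b. b \<in> B \<Longrightarrow> finite {i\<in>S. b \<lhd> f i \<noteq> 0}"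
  shows lact_strict_sum:
      "finite T \<Longrightarrow> T \<subseteq> S \<Longrightarrow> (\<And>i. i \<in> S - T \<Longrightarrow> f i \<rhd> a = 0) \<Longrightarrow>
        strict_sum f S \<rhd> a = (\<Sum>i\<in>T. f i \<rhd> a)"
    and ract_strict_sum:
      "finite T \<Longrightarrow> T \<subseteq> S \<Longrightarrow> (\<And>i. i \<in> S - T \<Longrightarrow> a \<lhd> f i = 0) \<Longrightarrow>
        a \<lhd> strict_sum f S = (\<Sum>i\<in>T. a \<lhd> f i)"
proof -
  define L where "L a = {i\<in>S. f i \<rhd> a \<noteq> 0}" for a
  define R where "R a = {i\<in>S. a \<lhd> f i \<noteq> 0}" for a
  define l where "l a = (\<Sum>i\<in>L a. f i \<rhd> a)" for a
  define r where "r a = (\<Sum>i\<in>R a. a \<lhd> f i)" for a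
  define m where "m = Abs_multiplier (l, r)"
  have finL: "finite (L a)" for a
    unfolding L_def by (rule finite_support_cspan[OF clinear_lact B fin(1)])
  have finR: "finite (R a)" for a
    unfolding R_def by (rule finite_support_cspan[OF clinear_ract B fin(2)])
  have l: "l a = (\<Sum>i\<in>T. f i \<rhd> a)" if "finite T" "T \<subseteq> S" "\<And>i. i \<in> S - T \<Longrightarrow> f i \<rhd> a = 0" for T a
    unfolding l_def using that by (intro sum.mono_neutral_left) (auto simp: L_def)
  have r: "r a = (\<Sum>i\<in>T. a \<lhd> f i)" if "finite T" "T \<subseteq> S" "\<And>i. i \<in> S - T \<Longrightarrow> a \<lhd> f i = 0" for T a
    unfolding r_def using that by (intro sum.mono_neutral_left) (auto simp: R_def)
  have "clinear l"
  proof (rule clinearI)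
    fix x y and c :: complex
    let ?T = "L x \<union> L y"
    have T: "finite ?T" "?T \<subseteq> S" by (simp add: finL) (auto simp: L_def)
    have z: "f i \<rhd> x = 0" "f i \<rhd> y = 0" if "i \<in> S - ?T" for i using that by (auto simp: L_def)
    have lxy: "l x = (\<Sum>i\<in>?T. f i \<rhd> x)" "l y = (\<Sum>i\<in>?T. f i \<rhd> y)"
      by (rule l[OF T]; rule z; assumption)+
    have "l (x + y) = (\<Sum>i\<in>?T. f i \<rhd> (x + y))" by (rule l[OF T]) (simp add: z)
    also have "\<dots> = (\<Sum>i\<in>?T. f i \<rhd> x) + (\<Sum>i\<in>?T. f i \<rhd> y)" by (simp add: sum.distrib)
    also have "\<dots> = l x + l y" by (simp add: lxy)
    finally show "l (x + y) = l x + l y" .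
    have "l (c *\<^sub>C x) = (\<Sum>i\<in>?T. f i \<rhd> (c *\<^sub>C x))" by (rule l[OF T]) (simp add: z)
    also have "\<dots> = c *\<^sub>C (\<Sum>i\<in>?T. f i \<rhd> x)" by (simp add: complex_vector.scale_sum_right)
    also have "\<dots> = c *\<^sub>C l x" by (simp add: lxy)
    finally show "l (c *\<^sub>C x) = c *\<^sub>C l x" .
  qed
  moreover have "clinear r"
  proof (rule clinearI)
    fix x y and c :: complex
    let ?T = "R x \<union> R y"
    have T: "finite ?T" "?T \<subseteq> S" by (simp add: finR) (auto simp: R_def)
    have z: "x \<lhd> f i = 0" "y \<lhd> f i = 0" if "i \<in> S - ?T" for i using that by (auto simp: R_def)
    have rxy: "r x = (\<Sum>i\<in>?T. x \<lhd> f i)" "r y = (\<Sum>i\<in>?T. y \<lhd> f i)"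
      by (rule r[OF T]; rule z; assumption)+
    have "r (x + y) = (\<Sum>i\<in>?T. (x + y) \<lhd> f i)" by (rule r[OF T]) (simp add: z)
    also have "\<dots> = (\<Sum>i\<in>?T. x \<lhd> f i) + (\<Sum>i\<in>?T. y \<lhd> f i)" by (simp add: sum.distrib)
    also have "\<dots> = r x + r y" by (simp add: rxy)
    finally show "r (x + y) = r x + r y" .
    have "r (c *\<^sub>C x) = (\<Sum>i\<in>?T. (c *\<^sub>C x) \<lhd> f i)" by (rule r[OF T]) (simp add: z)
    also have "\<dots> = c *\<^sub>C (\<Sum>i\<in>?T. x \<lhd> f i)" by (simp add: complex_vector.scale_sum_right)
    also have "\<dots> = c *\<^sub>C r x" by (simp add: rxy)
    finally show "r (c *\<^sub>C x) = c *\<^sub>C r x" .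
  qed
  moreover have "a * l b = r a * b" for a b
  proof -
    let ?T = "R a \<union> L b"
    have T: "finite ?T" "?T \<subseteq> S" by (simp add: finL finR) (auto simp: L_def R_def)
    have z: "a \<lhd> f i = 0" "f i \<rhd> b = 0" if "i \<in> S - ?T" for i
      using that by (auto simp: L_def R_def)
    have "l b = (\<Sum>i\<in>?T. f i \<rhd> b)" by (rule l[OF T]) (rule z)
    moreover have "r a = (\<Sum>i\<in>?T. a \<lhd> f i)" by (rule r[OF T]) (rule z)
    ultimately show ?thesis by (simp add: sum_distrib_left sum_distrib_right mult_lact)
  qed
  ultimately have m: "m \<rhd> a = l a" "a \<lhd> m = r a" for a
    unfolding m_def by (intro lact_Abs_multiplier ract_Abs_multiplier; blast)+
  have sum_act: "sum f F \<rhd> a = (\<Sum>i\<in>F. f i \<rhd> a)" "a \<lhd> sum f F = (\<Sum>i\<in>F. a \<lhd> f i)" for F a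
    by (rule clinear_sum[OF clinear_lact_arg] clinear_sum[OF clinear_ract_arg])+
  have lim: "strict_limit (\<lambda>F. sum f F) m (finite_subsets_at_top S)"
    unfolding strict_limit_def
  proof
    fix a
    show "eventually (\<lambda>F. sum f F \<rhd> a = m \<rhd> a \<and> a \<lhd> sum f F = a \<lhd> m) (finite_subsets_at_top S)"
      unfolding eventually_finite_subsets_at_top
    proof (intro exI[of _ "L a \<union> R a"] conjI allI impI)
      fix F assume "finite F \<and> L a \<union> R a \<subseteq> F \<and> F \<subseteq> S"
      then have F: "finite F" "L a \<union> R a \<subseteq> F" "F \<subseteq> S" by blast+
      have z: "f i \<rhd> a = 0" "a \<lhd> f i = 0" if "i \<in> S - F" for i
        using F(2) that by (auto simp: L_def R_def)
      show "sum f F \<rhd> a = m \<rhd> a"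
        unfolding sum_act m by (rule l[OF F(1,3), symmetric]) (rule z)
      show "a \<lhd> sum f F = a \<lhd> m"
        unfolding sum_act m by (rule r[OF F(1,3), symmetric]) (rule z)
    qed (use finL finR in simp, auto simp: L_def R_def)
  qed
  have "strict_sum f S = m"
    unfolding strict_sum_def
  proof (rule the_equality[where P = "\<lambda>m. strict_limit (\<lambda>F. sum f F) m (finite_subsets_at_top S)",
        OF lim])
    fix n assume n: "strict_limit (\<lambda>F. sum f F) n (finite_subsets_at_top S)"
    show "n = m"
    proof (rule multiplier_eqI)
      fix a
      have "eventually (\<lambda>F. n \<rhd> a = m \<rhd> a \<and> a \<lhd> n = a \<lhd> m) (finite_subsets_at_top S)"
        using n[unfolded strict_limit_def, rule_format, of a]
          lim[unfolded strict_limit_def, rule_format, of a]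
        by eventually_elim simp
      then show "n \<rhd> a = m \<rhd> a" "a \<lhd> n = a \<lhd> m" by simp_all
    qed
  qed
  then have ss: "strict_sum f S \<rhd> a = l a" "a \<lhd> strict_sum f S = r a"
    by (simp_all add: m)
  show "finite T \<Longrightarrow> T \<subseteq> S \<Longrightarrow> (\<And>i. i \<in> S - T \<Longrightarrow> f i \<rhd> a = 0) \<Longrightarrow>
        strict_sum f S \<rhd> a = (\<Sum>i\<in>T. f i \<rhd> a)"
    unfolding ss by (rule l)
  show "finite T \<Longrightarrow> T \<subseteq> S \<Longrightarrow> (\<And>i. i \<in> S - T \<Longrightarrow> a \<lhd> f i = 0) \<Longrightarrow>
        a \<lhd> strict_sum f S = (\<Sum>i\<in>T. a \<lhd> f i)"
    unfolding ss by (rule r)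
qed


section \<open>Base units of a partial algebra\<close>

text \<open>The projection onto the sum of those components whose index satisfies \<open>Q\<close>.\<close>

lemma partial_algebra_projection:
  fixes G :: "'j \<Rightarrow> 'j \<Rightarrow> 'a::complex_algebra set"
  assumes pa: "partial_algebra J G" and whole: "pa_carrier J G = UNIV"
  shows "\<exists>P. clinear P \<and> (\<forall>p\<in>J. \<forall>q\<in>J. \<forall>a\<in>G p q. P a = (if Q p q then a else 0))"
proof -
  have sub: "csubspace (G p q)" if "p \<in> J" "q \<in> J" for p q
    using pa that by (simp add: partial_algebra_def)
  \<comment> \<open>\<open>a\<close> has a decomposition into components with indices in \<open>F\<close>, and \<open>y\<close> is the sum of those
    whose index satisfies \<open>Q\<close>\<close>
  define R where "R F a y \<longleftrightarrow> (\<exists>x. (\<forall>(p, q)\<in>F. x (p, q) \<in> G p q) \<and> a = sum x F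
    \<and> y = (\<Sum>k\<in>F. if Q (fst k) (snd k) then x k else 0))" for F a y
  have R_mono: "R F' a y" if "R F a y" "F \<subseteq> F'" "finite F'" "F' \<subseteq> J \<times> J" for F F' a y
  proof -
    from that obtain x where x: "\<forall>(p, q)\<in>F. x (p, q) \<in> G p q" "a = sum x F"
      "y = (\<Sum>k\<in>F. if Q (fst k) (snd k) then x k else 0)" by (auto simp: R_def)
    let ?x = "\<lambda>k. if k \<in> F then x k else 0"
    have "sum x F = sum ?x F'" using that by (intro sum.mono_neutral_cong_left) auto
    moreover have "(\<Sum>k\<in>F. if Q (fst k) (snd k) then x k else 0)
        = (\<Sum>k\<in>F'. if Q (fst k) (snd k) then ?x k else 0)"
      using that by (intro sum.mono_neutral_cong_left) auto
    moreover have "\<forall>(p, q)\<in>F'. ?x (p, q) \<in> G p q"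
      using x(1) that(4) complex_vector.subspace_0[OF sub] by auto
    ultimately show ?thesis unfolding R_def x by (intro exI[of _ ?x] conjI)
  qed
  have R_add: "R F (c *\<^sub>C a + b) (c *\<^sub>C y + z)"
    if "R F a y" "R F b z" "F \<subseteq> J \<times> J" for F c a b y z
  proof -
    from that obtain x where x: "\<forall>(p, q)\<in>F. x (p, q) \<in> G p q" "a = sum x F"
      "y = (\<Sum>k\<in>F. if Q (fst k) (snd k) then x k else 0)" by (auto simp: R_def)
    from that obtain w where w: "\<forall>(p, q)\<in>F. w (p, q) \<in> G p q" "b = sum w F"
      "z = (\<Sum>k\<in>F. if Q (fst k) (snd k) then w k else 0)" by (auto simp: R_def)
    let ?x = "\<lambda>k. c *\<^sub>C x k + w k"
    have "c *\<^sub>C a + b = sum ?x F"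
      unfolding x w by (simp add: sum.distrib complex_vector.scale_sum_right)
    moreover have "c *\<^sub>C y + z = (\<Sum>k\<in>F. if Q (fst k) (snd k) then ?x k else 0)"
      unfolding x w complex_vector.scale_sum_right sum.distrib[symmetric]
      by (rule sum.cong) auto
    moreover have "\<forall>(p, q)\<in>F. ?x (p, q) \<in> G p q"
      using x(1) w(1) that(3) sub
      by (auto intro!: complex_vector.subspace_add complex_vector.subspace_scale)
    ultimately show ?thesis unfolding R_def by (intro exI[of _ ?x] conjI)
  qed
  have R_zero: "y = 0" if "R F 0 y" "finite F" "F \<subseteq> J \<times> J" for F y
  proof -
    from that obtain x where x: "\<forall>(p, q)\<in>F. x (p, q) \<in> G p q" "sum x F = 0"
      "y = (\<Sum>k\<in>F. if Q (fst k) (snd k) then x k else 0)" by (auto simp: R_def)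
    have "\<forall>k\<in>F. x k = 0"
      using pa x(1,2) that(2,3) unfolding partial_algebra_def by blast
    then show ?thesis unfolding x by (intro sum.neutral) auto
  qed
  define D where "D F \<longleftrightarrow> finite F \<and> F \<subseteq> J \<times> J" for F :: "('j \<times> 'j) set"
  have D: "D (F \<union> F')" if "D F" "D F'" for F F' using that by (simp add: D_def)
  have R_both: "R (F \<union> F') (c *\<^sub>C a + b) (c *\<^sub>C y + z)"
    if "R F a y" "R F' b z" "D F" "D F'" for F F' c a b y z
    using that D[of F F'] by (intro R_add R_mono[of _ _ _ "F \<union> F'"]) (auto simp: D_def intro: R_mono)
  have unique: "y = z" if "R F a y" "R F' a z" "D F" "D F'" for F F' a y z
  proof -
    have "R (F' \<union> F) ((- 1) *\<^sub>C a + a) ((- 1) *\<^sub>C z + y)" by (rule R_both) (use that in auto)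
    then have "R (F' \<union> F) 0 (y - z)" by simp
    then show ?thesis using R_zero[of "F' \<union> F" "y - z"] D[of F' F] that(3,4) by (simp add: D_def)
  qed
  have gen: "R {(p, q)} a (if Q p q then a else 0)" if "a \<in> G p q" for p q a
    unfolding R_def using that by (intro exI[of _ "\<lambda>_. a"]) auto
  have "\<exists>F y. D F \<and> R F a y" for a
  proof -
    have "a \<in> cspan (\<Union>p\<in>J. \<Union>q\<in>J. G p q)" using whole by (simp add: pa_carrier_def)
    then show ?thesis
    proof (induction a rule: complex_vector.span_induct_alt)
      case base
      show ?case by (rule exI[of _ "{}"]) (simp add: D_def R_def)
    next
      case (step c x y)
      then obtain p q where "p \<in> J" "q \<in> J" "x \<in> G p q" by blast
      then have "D {(p, q)}" "R {(p, q)} x (if Q p q then x else 0)"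
        using gen by (simp_all add: D_def)
      then show ?case using step(2) D R_both by meson
    qed
  qed
  then obtain \<phi> P where P: "\<And>a. D (\<phi> a)" "\<And>a. R (\<phi> a) a (P a)" by metis
  have lin: "P (c *\<^sub>C a + b) = c *\<^sub>C P a + P b" for c a b
    by (rule unique[OF P(2) R_both[OF P(2) P(2)]]) (simp_all add: P D)
  have "P 0 = 0" using lin[of "- 1" 0 0] by simp
  then have "clinear P"
    using lin[of 1] lin[of _ _ 0] by (intro clinearI) (simp_all add: scaleC_one)
  moreover have "P a = (if Q p q then a else 0)" if "p \<in> J" "q \<in> J" "a \<in> G p q" for p q a
    by (rule unique[OF P(2) gen]) (use that P in \<open>simp_all add: D_def\<close>)
  ultimately show ?thesis by blast
qed

lemma
  fixes G :: "'j \<Rightarrow> 'j \<Rightarrow> 'a::complex_algebra set"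
  assumes pa: "partial_algebra J G" and whole: "pa_carrier J G = UNIV" and r: "r \<in> J"
    and a: "p \<in> J" "q \<in> J" "a \<in> G p q"
  shows lact_base_unit: "base_unit J G r \<rhd> a = (if r = p then a else 0)"
    and ract_base_unit: "a \<lhd> base_unit J G r = (if r = q then a else 0)"
proof -
  obtain lf where lf: "clinear lf"
    "\<And>p q a. p \<in> J \<Longrightarrow> q \<in> J \<Longrightarrow> a \<in> G p q \<Longrightarrow> lf a = (if r = p then a else 0)"
    using partial_algebra_projection[OF pa whole, of "\<lambda>p q. r = p"] by blast
  obtain rf where rf: "clinear rf"
    "\<And>p q a. p \<in> J \<Longrightarrow> q \<in> J \<Longrightarrow> a \<in> G p q \<Longrightarrow> rf a = (if r = q then a else 0)"
    using partial_algebra_projection[OF pa whole, of "\<lambda>p q. r = q"] by blast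
  let ?S = "\<Union>p\<in>J. \<Union>q\<in>J. G p q"
  have S: "x \<in> cspan ?S" for x using whole by (simp add: pa_carrier_def)
  have 0: "x * y = 0" if "p \<in> J" "q \<in> J" "p' \<in> J" "q' \<in> J" "x \<in> G p q" "y \<in> G p' q'" "q \<noteq> p'"
    for p q p' q' x y
    using pa that unfolding partial_algebra_def by blast
  have mem: "x * lf y = rf x * y" for x y
  proof (rule clinear_eq_on_cspan[OF clinear_mult_right clinear_compose[OF rf(1) clinear_mult_right] S])
    fix x assume x: "x \<in> ?S"
    show "x * lf y = rf x * y"
    proof (rule clinear_eq_on_cspan[OF clinear_compose[OF lf(1) clinear_mult_left] clinear_mult_left S])
      fix y assume "y \<in> ?S"
      then show "x * lf y = rf x * y" using x by (auto simp: lf(2) rf(2) 0)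
    qed
  qed
  define m where "m = Abs_multiplier (lf, rf)"
  have m: "m \<rhd> x = lf x" "x \<lhd> m = rf x" for x
    unfolding m_def
    by (rule lact_Abs_multiplier[OF lf(1) rf(1) mem] ract_Abs_multiplier[OF lf(1) rf(1) mem])+
  have "base_unit J G r = m"
    unfolding base_unit_def
  proof (rule the_equality)
    show "\<forall>r'\<in>J. \<forall>s'\<in>J. \<forall>a\<in>G r' s'. m \<rhd> a = (if r = r' then a else 0)
        \<and> a \<lhd> m = (if r = s' then a else 0)"
      by (simp add: m lf(2) rf(2))
    fix n assume n: "\<forall>r'\<in>J. \<forall>s'\<in>J. \<forall>a\<in>G r' s'. n \<rhd> a = (if r = r' then a else 0)
        \<and> a \<lhd> n = (if r = s' then a else 0)"
    show "n = m"
    proof (rule multiplier_eqI)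
      show "n \<rhd> x = m \<rhd> x" for x
        by (rule clinear_eq_on_cspan[OF clinear_lact clinear_lact S])
           (use n in \<open>auto simp: m lf(2)\<close>)
      show "x \<lhd> n = x \<lhd> m" for x
        by (rule clinear_eq_on_cspan[OF clinear_ract clinear_ract S])
           (use n in \<open>auto simp: m rf(2)\<close>)
    qed
  qed
  then show "base_unit J G r \<rhd> a = (if r = p then a else 0)"
    "a \<lhd> base_unit J G r = (if r = q then a else 0)"
    using a by (simp_all add: m lf(2) rf(2))
qed

text \<open>A non-degenerate idempotent partial algebra whose underlying algebra is the whole type.\<close>

locale whole_partial_algebra =
  fixes J :: "'j set" and G :: "'j \<Rightarrow> 'j \<Rightarrow> 'a::complex_algebra set"
  assumes pa: "partial_algebra J G" and whole: "pa_carrier J G = UNIV"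
    and pa_nondeg: "pa_nondegenerate J G" and pa_idem: "pa_idempotent J G"
begin

text \<open>The union of the components.\<close>

definition homogeneous :: "'a set"
  where "homogeneous = {a. \<exists>p\<in>J. \<exists>q\<in>J. a \<in> G p q}"

lemma cspan_homogeneous: "cspan homogeneous = UNIV"
proof -
  have "homogeneous = (\<Union>p\<in>J. \<Union>q\<in>J. G p q)" by (auto simp: homogeneous_def)
  then show ?thesis using whole by (simp add: pa_carrier_def)
qed

lemma mult_0: "a * b = 0"
  if "p \<in> J" "q \<in> J" "p' \<in> J" "q' \<in> J" "a \<in> G p q" "b \<in> G p' q'" "q \<noteq> p'"
  using pa that unfolding partial_algebra_def by blast

lemmas lact_base = lact_base_unit[OF pa whole]
  and ract_base = ract_base_unit[OF pa whole]

lemma finite_base_unit: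
  assumes "inj_on \<sigma> S" "\<sigma> ` S \<subseteq> J" "a \<in> homogeneous"
  shows "finite {i\<in>S. base_unit J G (\<sigma> i) \<rhd> a \<noteq> 0}" "finite {i\<in>S. a \<lhd> base_unit J G (\<sigma> i) \<noteq> 0}"
proof -
  from assms(3) obtain p q where a: "p \<in> J" "q \<in> J" "a \<in> G p q" by (auto simp: homogeneous_def)
  have "{i\<in>S. base_unit J G (\<sigma> i) \<rhd> a \<noteq> 0} \<subseteq> {i\<in>S. \<sigma> i = p}"
    "{i\<in>S. a \<lhd> base_unit J G (\<sigma> i) \<noteq> 0} \<subseteq> {i\<in>S. \<sigma> i = q}"
    using assms(2) a by (auto simp: lact_base ract_base split: if_splits)
  moreover have "finite {i\<in>S. \<sigma> i = x}" for x
    using finite_vimage_IntI[OF _ assms(1), of "{x}"] by (simp add: vimage_def Int_def conj_commute)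
  ultimately show "finite {i\<in>S. base_unit J G (\<sigma> i) \<rhd> a \<noteq> 0}"
    "finite {i\<in>S. a \<lhd> base_unit J G (\<sigma> i) \<noteq> 0}" by (meson finite_subset)+
qed

text \<open>The base units sum up strictly to \<open>1\<close>, so they separate the elements of the algebra.\<close>

lemma eq_0_base_unit:
  shows "(\<And>r. r \<in> J \<Longrightarrow> base_unit J G r \<rhd> a = 0) \<Longrightarrow> a = 0"
    and "(\<And>r. r \<in> J \<Longrightarrow> a \<lhd> base_unit J G r = 0) \<Longrightarrow> a = 0"
proof -
  note fin = finite_base_unit[of "\<lambda>r. r" J, simplified]
  note L = lact_strict_sum[OF cspan_homogeneous fin]
  note R = ract_strict_sum[OF cspan_homogeneous fin]
  have "strict_sum (base_unit J G) J \<rhd> b = b" for b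
  proof -
    have "strict_sum (base_unit J G) J \<rhd> b = 1 \<rhd> b"
    proof (rule lact_eq_on_cspan[OF cspan_homogeneous])
      fix b assume "b \<in> homogeneous"
      then obtain p q where "p \<in> J" "q \<in> J" "b \<in> G p q" by (auto simp: homogeneous_def)
      then show "strict_sum (base_unit J G) J \<rhd> b = 1 \<rhd> b"
        using L[of "{p}" b] by (simp add: lact_base)
    qed
    then show ?thesis by simp
  qed
  then show "a = 0" if "\<And>r. r \<in> J \<Longrightarrow> base_unit J G r \<rhd> a = 0"
    using L[of "{}" a] that by simp
  have "b \<lhd> strict_sum (base_unit J G) J = b" for b
  proof -
    have "b \<lhd> strict_sum (base_unit J G) J = b \<lhd> 1"
    proof (rule ract_eq_on_cspan[OF cspan_homogeneous])
      fix b assume "b \<in> homogeneous"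
      then obtain p q where "p \<in> J" "q \<in> J" "b \<in> G p q" by (auto simp: homogeneous_def)
      then show "b \<lhd> strict_sum (base_unit J G) J = b \<lhd> 1"
        using R[of "{q}" b] by (simp add: ract_base)
    qed
    then show ?thesis by simp
  qed
  then show "a = 0" if "\<And>r. r \<in> J \<Longrightarrow> a \<lhd> base_unit J G r = 0"
    using R[of "{}" a] that by simp
qed

lemma nondegenerate_UNIV: "nondegenerate (UNIV :: 'a set)"
proof -
  have "b = 0" if b: "\<And>x. b * x = 0" for b :: 'a
  proof (rule eq_0_base_unit(2))
    fix r assume r: "r \<in> J"
    have "b \<lhd> base_unit J G r \<in> pa_col J G r"
      unfolding pa_col_def
    proof (rule clinear_in_cspan[OF clinear_ract, of _ homogeneous])
      fix s assume "s \<in> homogeneous"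
      then have "s \<lhd> base_unit J G r = 0 \<or> (\<exists>p\<in>J. s \<lhd> base_unit J G r \<in> G p r)"
        by (auto simp: homogeneous_def ract_base r)
      then show "s \<lhd> base_unit J G r \<in> cspan (\<Union>p\<in>J. G p r)"
        using complex_vector.span_zero complex_vector.span_base by (metis UN_I)
    qed (simp add: cspan_homogeneous)
    moreover have "(b \<lhd> base_unit J G r) * x = 0" for x by (simp add: b flip: mult_lact)
    ultimately show "b \<lhd> base_unit J G r = 0"
      using pa_nondeg r unfolding pa_nondegenerate_def left_nondegenerate_def by blast
  qed
  moreover have "b = 0" if b: "\<And>x. x * b = 0" for b :: 'a
  proof (rule eq_0_base_unit(1))
    fix r assume r: "r \<in> J"
    have "base_unit J G r \<rhd> b \<in> pa_row J G r"
      unfolding pa_row_def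
    proof (rule clinear_in_cspan[OF clinear_lact, of _ homogeneous])
      fix s assume "s \<in> homogeneous"
      then have "base_unit J G r \<rhd> s = 0 \<or> (\<exists>p\<in>J. base_unit J G r \<rhd> s \<in> G r p)"
        by (auto simp: homogeneous_def lact_base r)
      then show "base_unit J G r \<rhd> s \<in> cspan (\<Union>p\<in>J. G r p)"
        using complex_vector.span_zero complex_vector.span_base by (metis UN_I)
    qed (simp add: cspan_homogeneous)
    moreover have "x * (base_unit J G r \<rhd> b) = 0" for x by (simp add: b mult_lact)
    ultimately show "base_unit J G r \<rhd> b = 0"
      using pa_nondeg r unfolding pa_nondegenerate_def right_nondegenerate_def by blast
  qed
  ultimately show ?thesis
    unfolding nondegenerate_def left_nondegenerate_def right_nondegenerate_def by blast
qed

text \<open>Since ${\bf 1}(p)A$ is idempotent and products $xy$ with $x\in A(p,s)$ and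
  $y\in{\bf 1}(p)A$ vanish for $s\neq p$, one has $A(p,q)\subseteq A(p,p)A$.\<close>

lemma row_local_units:
  assumes "p \<in> J" "q \<in> J" "a \<in> G p q"
  shows "a \<in> cspan {x * y | x y. x \<in> G p p}"
proof -
  let ?R = "\<Union>s\<in>J. G p s"
  have "a \<in> pa_row J G p"
    unfolding pa_row_def using assms by (intro complex_vector.span_base) blast
  also have "\<dots> = cspan {x * y | x y. x \<in> cspan ?R \<and> y \<in> cspan ?R}"
    using pa_idem assms(1) unfolding pa_idempotent_def idempotent_algebra_def pa_row_def by simp
  finally have "id a \<in> cspan {x * y | x y. x \<in> G p p}"
  proof (rule clinear_in_cspan[rotated])
    show "clinear id" by (simp add: id_def)
    fix s assume "s \<in> {x * y | x y. x \<in> cspan ?R \<and> y \<in> cspan ?R}"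
    then obtain x y where s: "s = x * y" "x \<in> cspan ?R" "y \<in> cspan ?R" by blast
    have "x * y \<in> cspan {x * y | x y. x \<in> G p p}"
    proof (rule clinear_in_cspan[OF clinear_mult_right s(2)])
      fix x assume x: "x \<in> ?R"
      show "x * y \<in> cspan {x * y | x y. x \<in> G p p}"
      proof (rule clinear_in_cspan[OF clinear_mult_left s(3)])
        fix y assume y: "y \<in> ?R"
        show "x * y \<in> cspan {x * y | x y. x \<in> G p p}"
        proof (cases "x \<in> G p p")
          case True
          then show ?thesis by (blast intro: complex_vector.span_base)
        next
          case False
          then have "x * y = 0" using x y assms(1) mult_0 by blast
          then show ?thesis by (simp add: complex_vector.span_zero)
        qed
      qed
    qed
    then show "id s \<in> cspan {x * y | x y. x \<in> G p p}" by (simp add: s(1))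
  qed
  then show ?thesis by simp
qed

lemma col_local_units:
  assumes "p \<in> J" "q \<in> J" "a \<in> G p q"
  shows "a \<in> cspan {y * x | x y. x \<in> G q q}"
proof -
  let ?R = "\<Union>s\<in>J. G s q"
  have "a \<in> pa_col J G q"
    unfolding pa_col_def using assms by (intro complex_vector.span_base) blast
  also have "\<dots> = cspan {x * y | x y. x \<in> cspan ?R \<and> y \<in> cspan ?R}"
    using pa_idem assms(2) unfolding pa_idempotent_def idempotent_algebra_def pa_col_def by simp
  finally have "id a \<in> cspan {y * x | x y. x \<in> G q q}"
  proof (rule clinear_in_cspan[rotated])
    show "clinear id" by (simp add: id_def)
    fix s assume "s \<in> {x * y | x y. x \<in> cspan ?R \<and> y \<in> cspan ?R}"
    then obtain x y where s: "s = x * y" "x \<in> cspan ?R" "y \<in> cspan ?R" by blast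
    have "x * y \<in> cspan {y * x | x y. x \<in> G q q}"
    proof (rule clinear_in_cspan[OF clinear_mult_right s(2)])
      fix x assume x: "x \<in> ?R"
      show "x * y \<in> cspan {y * x | x y. x \<in> G q q}"
      proof (rule clinear_in_cspan[OF clinear_mult_left s(3)])
        fix y assume y: "y \<in> ?R"
        show "x * y \<in> cspan {y * x | x y. x \<in> G q q}"
        proof (cases "y \<in> G q q")
          case True
          then show ?thesis by (blast intro: complex_vector.span_base)
        next
          case False
          then have "x * y = 0" using x y assms(2) mult_0 by blast
          then show ?thesis by (simp add: complex_vector.span_zero)
        qed
      qed
    qed
    then show "id s \<in> cspan {y * x | x y. x \<in> G q q}" by (simp add: s(1))
  qed
  then show ?thesis by simp
qed

lemma idempotent_UNIV: "idempotent_algebra (UNIV :: 'a set)"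
proof -
  have "id a \<in> cspan {x * y | x y :: 'a. x \<in> UNIV \<and> y \<in> UNIV}" for a
  proof (rule clinear_in_cspan[of id a homogeneous])
    fix s assume "s \<in> homogeneous"
    then obtain p q where "p \<in> J" "q \<in> J" "s \<in> G p q" by (auto simp: homogeneous_def)
    then have "s \<in> cspan {x * y | x y. x \<in> G p p}" by (rule row_local_units)
    also have "\<dots> \<subseteq> cspan {x * y | x y. x \<in> UNIV \<and> y \<in> UNIV}"
      by (rule complex_vector.span_mono) blast
    finally show "id s \<in> cspan {x * y | x y. x \<in> UNIV \<and> y \<in> UNIV}" by simp
  qed (simp_all add: id_def cspan_homogeneous)
  then show ?thesis by (auto simp: idempotent_algebra_def)
qed

end


section \<open>The canonical idempotent of a partial multiplier bialgebra\<close>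

text \<open>A regular partial multiplier bialgebra together with a choice of its counit. The multipliers
  \<open>up r\<close> and \<open>low t\<close> are ${\bf 1}^r$ and ${\bf 1}_t$, \<open>E\<close> is $\sum_t{\bf 1}_t\otimes{\bf 1}^t$,
  and \<open>H\<close> is the grading of $A\otimes^I A$.\<close>

locale partial_multiplier_bialgebra = whole_partial_algebra "I \<times> I" G
  for I :: "'i set" and G :: "('i, 'a::complex_algebra) grading2" +
  fixes \<Delta> :: "'a \<Rightarrow> ('a \<otimes> 'a) multiplier" and \<epsilon> :: "'a \<Rightarrow> complex"
  assumes comult: "regular_comultiplication I G \<Delta>" and counit: "partial_counit I G \<Delta> \<epsilon>"
begin

abbreviation up :: "'i \<Rightarrow> 'a multiplier" where "up \<equiv> upper_unit I G"
abbreviation low :: "'i \<Rightarrow> 'a multiplier" where "low \<equiv> lower_unit I G"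
abbreviation E :: "('a \<otimes> 'a) multiplier" where "E \<equiv> tensor_unit I G"
abbreviation H :: "('i, 'a \<otimes> 'a) grading2" where "H \<equiv> tensor_grading I G"

text \<open>Pure tensors of two or three homogeneous elements.\<close>

definition homogeneous2 :: "('a \<otimes> 'a) set"
  where "homogeneous2 = {a \<otimes> b | a b. a \<in> homogeneous \<and> b \<in> homogeneous}"

definition homogeneous3 :: "(('a \<otimes> 'a) \<otimes> 'a) set"
  where "homogeneous3 = {t \<otimes> c | t c. t \<in> homogeneous2 \<and> c \<in> homogeneous}"

lemma cspan_homogeneous2: "cspan homogeneous2 = UNIV"
  unfolding homogeneous2_def by (rule cspan_tensor_UNIV; rule cspan_homogeneous)

lemma cspan_homogeneous3: "cspan homogeneous3 = UNIV"
  unfolding homogeneous3_def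
  by (rule cspan_tensor_UNIV[OF cspan_homogeneous2 cspan_homogeneous])

lemma homogeneousE:
  assumes "a \<in> homogeneous"
  obtains r t s u where "r \<in> I" "t \<in> I" "s \<in> I" "u \<in> I" "a \<in> G (r, t) (s, u)"
  using assms by (auto simp: homogeneous_def)

lemma nondegenerate2: "nondegenerate (UNIV :: ('a \<otimes> 'a) set)"
  by (intro nondegenerate_tensor nondegenerate_UNIV)

lemma nondegenerate3: "nondegenerate (UNIV :: (('a \<otimes> 'a) \<otimes> 'a) set)"
  by (intro nondegenerate_tensor nondegenerate_UNIV)

context
  fixes r t s u :: 'i and a :: 'a
  assumes a: "r \<in> I" "t \<in> I" "s \<in> I" "u \<in> I" "a \<in> G (r, t) (s, u)"
begin

lemma lact_up: "x \<in> I \<Longrightarrow> up x \<rhd> a = (if x = r then a else 0)"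
  and ract_up: "x \<in> I \<Longrightarrow> a \<lhd> up x = (if x = s then a else 0)"
  and lact_low: "x \<in> I \<Longrightarrow> low x \<rhd> a = (if x = t then a else 0)"
  and ract_low: "x \<in> I \<Longrightarrow> a \<lhd> low x = (if x = u then a else 0)"
proof -
  assume x: "x \<in> I"
  have inj: "inj_on (\<lambda>t. (x, t)) I" "(\<lambda>t. (x, t)) ` I \<subseteq> I \<times> I"
    "inj_on (\<lambda>r. (r, x)) I" "(\<lambda>r. (r, x)) ` I \<subseteq> I \<times> I"
    using x by (auto intro: inj_onI)
  note fin1 = finite_base_unit[OF inj(1,2)] and fin2 = finite_base_unit[OF inj(3,4)]
  note B = lact_base[OF _ _ _ a(5)] ract_base[OF _ _ _ a(5)]
  show "up x \<rhd> a = (if x = r then a else 0)"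
    unfolding upper_unit_def
    using lact_strict_sum[OF cspan_homogeneous fin1, where T = "{t}" and a = a] a x by (auto simp: B)
  show "a \<lhd> up x = (if x = s then a else 0)"
    unfolding upper_unit_def
    using ract_strict_sum[OF cspan_homogeneous fin1, where T = "{u}" and a = a] a x by (auto simp: B)
  show "low x \<rhd> a = (if x = t then a else 0)"
    unfolding lower_unit_def
    using lact_strict_sum[OF cspan_homogeneous fin2, where T = "{r}" and a = a] a x by (auto simp: B)
  show "a \<lhd> low x = (if x = u then a else 0)"
    unfolding lower_unit_def
    using ract_strict_sum[OF cspan_homogeneous fin2, where T = "{s}" and a = a] a x by (auto simp: B)
qed

end

lemmas act_units = lact_up ract_up lact_low ract_low

text \<open>On a homogeneous tensor $a\otimes b$ the multiplier \<open>E\<close> acts from the left as $1$ or $0$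
  according to whether the left lower index of \<open>a\<close> agrees with the left upper index of \<open>b\<close>, and from
  the right likewise with the right indices.\<close>

lemma
  assumes a: "r \<in> I" "t \<in> I" "s \<in> I" "u \<in> I" "a \<in> G (r, t) (s, u)"
    and b: "r' \<in> I" "t' \<in> I" "s' \<in> I" "u' \<in> I" "b \<in> G (r', t') (s', u')"
  shows lact_E: "E \<rhd> (a \<otimes> b) = (if t = r' then a \<otimes> b else 0)"
    and ract_E: "(a \<otimes> b) \<lhd> E = (if u = s' then a \<otimes> b else 0)"
proof -
  have fin: "finite {x\<in>I. (low x \<otimes>\<^sub>M up x) \<rhd> z \<noteq> 0}" "finite {x\<in>I. z \<lhd> (low x \<otimes>\<^sub>M up x) \<noteq> 0}"
    if z: "z \<in> homogeneous2" for z
  proof -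
    from z obtain a b where z: "z = a \<otimes> b" "a \<in> homogeneous" "b \<in> homogeneous"
      by (auto simp: homogeneous2_def)
    obtain r t s u where a: "r \<in> I" "t \<in> I" "s \<in> I" "u \<in> I" "a \<in> G (r, t) (s, u)"
      using homogeneousE[OF z(2)] .
    have "{x\<in>I. (low x \<otimes>\<^sub>M up x) \<rhd> z \<noteq> 0} \<subseteq> {t}" "{x\<in>I. z \<lhd> (low x \<otimes>\<^sub>M up x) \<noteq> 0} \<subseteq> {u}"
      by (auto simp: z(1) act_units[OF a] split: if_splits)
    then show "finite {x\<in>I. (low x \<otimes>\<^sub>M up x) \<rhd> z \<noteq> 0}" "finite {x\<in>I. z \<lhd> (low x \<otimes>\<^sub>M up x) \<noteq> 0}"
      by (meson finite.emptyI finite.insertI finite_subset)+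
  qed
  show "E \<rhd> (a \<otimes> b) = (if t = r' then a \<otimes> b else 0)"
    unfolding tensor_unit_def
    using lact_strict_sum[OF cspan_homogeneous2 fin, where T = "{t}" and a = "a \<otimes> b"] a
    by (auto simp: act_units[OF a] act_units[OF b])
  show "(a \<otimes> b) \<lhd> E = (if u = s' then a \<otimes> b else 0)"
    unfolding tensor_unit_def
    using ract_strict_sum[OF cspan_homogeneous2 fin, where T = "{u}" and a = "a \<otimes> b"] a
    by (auto simp: act_units[OF a] act_units[OF b])
qed

lemma multiplier2_eqI:
  assumes "\<And>r t s u a r' t' s' u' b. r \<in> I \<Longrightarrow> t \<in> I \<Longrightarrow> s \<in> I \<Longrightarrow> u \<in> I \<Longrightarrow> a \<in> G (r, t) (s, u) \<Longrightarrow>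
      r' \<in> I \<Longrightarrow> t' \<in> I \<Longrightarrow> s' \<in> I \<Longrightarrow> u' \<in> I \<Longrightarrow> b \<in> G (r', t') (s', u') \<Longrightarrow>
      m \<rhd> (a \<otimes> b) = n \<rhd> (a \<otimes> b)"
  shows "m = n"
proof (rule multiplier_eqI_left[OF nondegenerate2], rule lact_eq_on_cspan[OF cspan_homogeneous2])
  fix z assume "z \<in> homogeneous2"
  then show "m \<rhd> z = n \<rhd> z" by (auto simp: homogeneous2_def elim!: homogeneousE intro: assms)
qed

lemma units_idem:
  assumes "x \<in> I"
  shows "up x * up x = up x" "low x * low x = low x"
  by (rule multiplier_eqI_left[OF nondegenerate_UNIV], rule lact_eq_on_cspan[OF cspan_homogeneous],
      auto elim!: homogeneousE simp: lact_up[OF _ _ _ _ _ assms] lact_low[OF _ _ _ _ _ assms])+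

lemma E_idem: "E * E = E"
proof (rule multiplier2_eqI, goal_cases)
  case (1 r t s u a r' t' s' u' b)
  then show ?case by (simp add: lact_E[OF 1])
qed

lemma E_units:
  assumes "v \<in> I" "s \<in> I"
  shows "E * (low v \<otimes>\<^sub>M up s) = (if v = s then low v \<otimes>\<^sub>M up s else 0)"
    and "(low v \<otimes>\<^sub>M up s) * E = (if v = s then low v \<otimes>\<^sub>M up s else 0)"
    and "E * (up v \<otimes>\<^sub>M low s) = (up v \<otimes>\<^sub>M low s) * E"
    and "E * (1 \<otimes>\<^sub>M up s) = low s \<otimes>\<^sub>M up s"
    and "(1 \<otimes>\<^sub>M up s) * E = low s \<otimes>\<^sub>M up s"
proof -
  show "E * (low v \<otimes>\<^sub>M up s) = (if v = s then low v \<otimes>\<^sub>M up s else 0)"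
  proof (rule multiplier2_eqI, goal_cases)
    case (1 r t s u a r' t' s' u' b)
    show ?case using assms 1(1-4,6-9) by (simp add: lact_E[OF 1] act_units[OF 1(1-5)] act_units[OF 1(6-10)])
  qed
  show "(low v \<otimes>\<^sub>M up s) * E = (if v = s then low v \<otimes>\<^sub>M up s else 0)"
  proof (rule multiplier2_eqI, goal_cases)
    case (1 r t s u a r' t' s' u' b)
    show ?case using assms 1(1-4,6-9) by (simp add: lact_E[OF 1] act_units[OF 1(1-5)] act_units[OF 1(6-10)])
  qed
  show "E * (up v \<otimes>\<^sub>M low s) = (up v \<otimes>\<^sub>M low s) * E"
  proof (rule multiplier2_eqI, goal_cases)
    case (1 r t s u a r' t' s' u' b)
    show ?case using assms 1(1-4,6-9) by (simp add: lact_E[OF 1] act_units[OF 1(1-5)] act_units[OF 1(6-10)])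
  qed
  show "E * (1 \<otimes>\<^sub>M up s) = low s \<otimes>\<^sub>M up s"
  proof (rule multiplier2_eqI, goal_cases)
    case (1 r t s u a r' t' s' u' b)
    show ?case using assms 1(1-4,6-9) by (simp add: lact_E[OF 1] act_units[OF 1(1-5)] act_units[OF 1(6-10)])
  qed
  show "(1 \<otimes>\<^sub>M up s) * E = low s \<otimes>\<^sub>M up s"
  proof (rule multiplier2_eqI, goal_cases)
    case (1 r t s u a r' t' s' u' b)
    show ?case using assms 1(1-4,6-9) by (simp add: lact_E[OF 1] act_units[OF 1(1-5)] act_units[OF 1(6-10)])
  qed
qed

lemma E_commute:
  "(E \<otimes>\<^sub>M 1) * multiplier_assoc (1 \<otimes>\<^sub>M E) = multiplier_assoc (1 \<otimes>\<^sub>M E) * (E \<otimes>\<^sub>M 1)"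
proof (rule multiplier_eqI_left[OF nondegenerate3], rule lact_eq_on_cspan[OF cspan_homogeneous3])
  fix z assume "z \<in> homogeneous3"
  then obtain a b c where z: "z = (a \<otimes> b) \<otimes> c" "a \<in> homogeneous" "b \<in> homogeneous" "c \<in> homogeneous"
    by (auto simp: homogeneous3_def homogeneous2_def)
  obtain r t s u where a: "r \<in> I" "t \<in> I" "s \<in> I" "u \<in> I" "a \<in> G (r, t) (s, u)"
    using homogeneousE[OF z(2)] .
  obtain r' t' s' u' where b: "r' \<in> I" "t' \<in> I" "s' \<in> I" "u' \<in> I" "b \<in> G (r', t') (s', u')"
    using homogeneousE[OF z(3)] .
  obtain r'' t'' s'' u'' where c: "r'' \<in> I" "t'' \<in> I" "s'' \<in> I" "u'' \<in> I" "c \<in> G (r'', t'') (s'', u'')"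
    using homogeneousE[OF z(4)] .
  have 1: "(E \<otimes>\<^sub>M 1) \<rhd> z = (if t = r' then z else 0)"
    by (simp add: z(1) lact_E[OF a b])
  have 2: "multiplier_assoc (1 \<otimes>\<^sub>M E) \<rhd> z = (if t' = r'' then z else 0)"
    by (simp add: z(1) lact_assoc tensor_assoc_pure tensor_assoc_inv_pure lact_E[OF b c]
        clinear_0[OF clinear_tensor_assoc_inv])
  show "((E \<otimes>\<^sub>M 1) * multiplier_assoc (1 \<otimes>\<^sub>M E)) \<rhd> z = (multiplier_assoc (1 \<otimes>\<^sub>M E) * (E \<otimes>\<^sub>M 1)) \<rhd> z"
    by (simp add: 1 2)
qed

lemma pure_in_H:
  assumes "r \<in> I" "t \<in> I" "v \<in> I" "x \<in> G (r, t) (r, t)" "y \<in> G (t, v) (t, v)"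
  shows "x \<otimes> y \<in> H (r, v) (r, v)"
  unfolding tensor_grading_def using assms by (auto intro!: complex_vector.span_base)

text \<open>$E(A\otimes A)=B(A\otimes A)$ and $(A\otimes A)E=(A\otimes A)B$ for $B=A\otimes^I A$; diagonal
  components of \<open>B\<close> suffice.\<close>

lemma E_left_span: "E \<rhd> z \<in> cspan {x * y | x y. \<exists>p\<in>I \<times> I. x \<in> H p p}" (is "_ \<in> cspan ?T")
proof (rule clinear_in_cspan[OF clinear_lact, of _ homogeneous2])
  fix s assume "s \<in> homogeneous2"
  then obtain a b where s: "s = a \<otimes> b" "a \<in> homogeneous" "b \<in> homogeneous"
    by (auto simp: homogeneous2_def)
  obtain r t q u where a: "r \<in> I" "t \<in> I" "q \<in> I" "u \<in> I" "a \<in> G (r, t) (q, u)"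
    using homogeneousE[OF s(2)] .
  obtain r' t' q' u' where b: "r' \<in> I" "t' \<in> I" "q' \<in> I" "u' \<in> I" "b \<in> G (r', t') (q', u')"
    using homogeneousE[OF s(3)] .
  show "E \<rhd> s \<in> cspan ?T"
  proof (cases "t = r'")
    case True
    have "a \<otimes> b \<in> cspan {x \<otimes> y | x y. x \<in> {x * y | x y. x \<in> G (r, t) (r, t)}
        \<and> y \<in> {x * y | x y. x \<in> G (t, t') (t, t')}}"
      by (rule tensor_in_cspan; rule row_local_units) (use a b True in auto)
    also have "\<dots> \<subseteq> cspan ?T"
    proof (rule complex_vector.span_mono, clarify)
      fix x y x' y' assume "x \<in> G (r, t) (r, t)" "x' \<in> G (t, t') (t, t')"
      then show "\<exists>z w. (x * y) \<otimes> (x' * y') = z * w \<and> (\<exists>p\<in>I \<times> I. z \<in> H p p)"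
        using pure_in_H[of r t t' x x'] a b
        by (intro exI[of _ "x \<otimes> x'"] exI[of _ "y \<otimes> y'"]) (auto simp: tensor_times_pure)
    qed
    finally show ?thesis by (simp add: s lact_E[OF a b] True)
  next
    case False
    then show ?thesis by (simp add: s lact_E[OF a b] complex_vector.span_zero)
  qed
qed (simp add: cspan_homogeneous2)

lemma E_right_span: "z \<lhd> E \<in> cspan {y * x | x y. \<exists>p\<in>I \<times> I. x \<in> H p p}" (is "_ \<in> cspan ?T")
proof (rule clinear_in_cspan[OF clinear_ract, of _ homogeneous2])
  fix s assume "s \<in> homogeneous2"
  then obtain a b where s: "s = a \<otimes> b" "a \<in> homogeneous" "b \<in> homogeneous"
    by (auto simp: homogeneous2_def)
  obtain r t q u where a: "r \<in> I" "t \<in> I" "q \<in> I" "u \<in> I" "a \<in> G (r, t) (q, u)"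
    using homogeneousE[OF s(2)] .
  obtain r' t' q' u' where b: "r' \<in> I" "t' \<in> I" "q' \<in> I" "u' \<in> I" "b \<in> G (r', t') (q', u')"
    using homogeneousE[OF s(3)] .
  show "s \<lhd> E \<in> cspan ?T"
  proof (cases "u = q'")
    case True
    have "a \<otimes> b \<in> cspan {x \<otimes> y | x y. x \<in> {y * x | x y. x \<in> G (q, u) (q, u)}
        \<and> y \<in> {y * x | x y. x \<in> G (u, u') (u, u')}}"
      by (rule tensor_in_cspan; rule col_local_units) (use a b True in auto)
    also have "\<dots> \<subseteq> cspan ?T"
    proof (rule complex_vector.span_mono, clarify)
      fix x y x' y' assume "x \<in> G (q, u) (q, u)" "x' \<in> G (u, u') (u, u')"
      then show "\<exists>z w. (y * x) \<otimes> (y' * x') = w * z \<and> (\<exists>p\<in>I \<times> I. z \<in> H p p)"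
        using pure_in_H[of q u u' x x'] a b
        by (intro exI[of _ "x \<otimes> x'"] exI[of _ "y \<otimes> y'"]) (auto simp: tensor_times_pure)
    qed
    finally show ?thesis by (simp add: s ract_E[OF a b] True)
  next
    case False
    then show ?thesis by (simp add: s ract_E[OF a b] complex_vector.span_zero)
  qed
qed (simp add: cspan_homogeneous2)

lemma act_H:
  assumes p: "r \<in> I" "v \<in> I" and x: "x \<in> H (r, v) (r, v)"
  shows "E \<rhd> x = x" "x \<lhd> E = x"
    and "r' \<in> I \<Longrightarrow> v' \<in> I \<Longrightarrow> x \<lhd> (up r' \<otimes>\<^sub>M low v') = (if r' = r \<and> v' = v then x else 0)"
proof -
  let ?S = "\<Union>t\<in>I. \<Union>u\<in>I. {a \<otimes> b | a b. a \<in> G (r, t) (r, u) \<and> b \<in> G (t, v) (u, v)}"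
  have x: "x \<in> cspan ?S" using x by (simp add: tensor_grading_def)
  have lin: "clinear (\<lambda>x :: 'a \<otimes> 'a. if Q then x else 0)" for Q
    by (cases Q) (simp_all add: clinear_const_0)
  show "E \<rhd> x = x"
    by (rule clinear_eq_on_cspan[OF clinear_lact clinear_id x]) (use p in \<open>auto simp: lact_E\<close>)
  show "x \<lhd> E = x"
    by (rule clinear_eq_on_cspan[OF clinear_ract clinear_id x]) (use p in \<open>auto simp: ract_E\<close>)
  show "x \<lhd> (up r' \<otimes>\<^sub>M low v') = (if r' = r \<and> v' = v then x else 0)" if "r' \<in> I" "v' \<in> I"
    by (rule clinear_eq_on_cspan[OF clinear_ract lin x])
       (use p that in \<open>auto simp: act_units\<close>)
qed

lemma
  assumes "r \<in> I" "v \<in> I"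
  shows H_in_row: "x \<in> H (r, v) (r, v) \<Longrightarrow> x \<in> pa_row (I \<times> I) H (r, v)"
    and H_in_col: "x \<in> H (r, v) (r, v) \<Longrightarrow> x \<in> pa_col (I \<times> I) H (r, v)"
  unfolding pa_row_def pa_col_def using assms by (blast intro: complex_vector.span_base)+

lemma comult_morphism: "pa_morphism (I \<times> I) G H E \<Delta>"
  and comult_coassoc: "coassociative I G \<Delta>"
  and comult_range: "\<Delta> a * (embed b \<otimes>\<^sub>M 1) \<in> range embed" "\<Delta> a * (1 \<otimes>\<^sub>M embed b) \<in> range embed"
    "(embed b \<otimes>\<^sub>M 1) * \<Delta> a \<in> range embed" "(1 \<otimes>\<^sub>M embed b) * \<Delta> a \<in> range embed"
  using comult unfolding regular_comultiplication_def by blast+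

lemma comult_linear: "clinear \<Delta>" and comult_mult: "\<Delta> (a * b) = \<Delta> a * \<Delta> b"
  and comult_corner: "E * \<Delta> a * E = \<Delta> a"
  using comult_morphism unfolding pa_morphism_def by blast+

lemma comult_E: "E * \<Delta> a = \<Delta> a" "\<Delta> a * E = \<Delta> a"
proof -
  have "E * (E * \<Delta> a * E) = E * \<Delta> a * E" "E * \<Delta> a * E * E = E * \<Delta> a * E"
    by (metis E_idem mult.assoc)+
  from this[unfolded comult_corner] show "E * \<Delta> a = \<Delta> a" "\<Delta> a * E = \<Delta> a" .
qed

lemma comult_col:
  assumes "p \<in> I \<times> I"
  shows "cspan {b \<lhd> \<Delta> a | a b. a \<in> pa_col (I \<times> I) G p \<and> b \<in> pa_col (I \<times> I) H p} = pa_col (I \<times> I) H p"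
  using comult_morphism assms unfolding pa_morphism_def by blast

lemma comult_row:
  assumes "p \<in> I \<times> I"
  shows "cspan {\<Delta> a \<rhd> b | a b. a \<in> pa_row (I \<times> I) G p \<and> b \<in> pa_row (I \<times> I) H p} = pa_row (I \<times> I) H p"
  using comult_morphism assms unfolding pa_morphism_def by blast

lemma nondeg_hom_comult: "nondeg_hom \<Delta> E"
proof -
  have "E \<rhd> z \<in> cspan {\<Delta> a \<rhd> y | a y. True}" (is "_ \<in> cspan ?T") for z
  proof -
    have "id (E \<rhd> z) \<in> cspan ?T"
    proof (rule clinear_in_cspan[OF _ E_left_span])
      fix s assume "s \<in> {x * y | x y. \<exists>p\<in>I \<times> I. x \<in> H p p}"
      then obtain r v x y where s: "s = x * y" "r \<in> I" "v \<in> I" "x \<in> H (r, v) (r, v)" by blast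
      have "x \<in> cspan {\<Delta> a \<rhd> b | a b. a \<in> pa_row (I \<times> I) G (r, v) \<and> b \<in> pa_row (I \<times> I) H (r, v)}"
        using comult_row[of "(r, v)"] H_in_row[OF s(2-4)] s(2,3) by simp
      then have "x * y \<in> cspan ?T"
      proof (rule clinear_in_cspan[OF clinear_mult_right])
        fix s assume "s \<in> {\<Delta> a \<rhd> b | a b. a \<in> pa_row (I \<times> I) G (r, v) \<and> b \<in> pa_row (I \<times> I) H (r, v)}"
        then obtain a b where "s * y = \<Delta> a \<rhd> (b * y)" by (auto simp: lact_mult[OF nondegenerate2])
        then show "s * y \<in> cspan ?T" by (blast intro: complex_vector.span_base)
      qed
      then show "id s \<in> cspan ?T" by (simp add: s(1))
    qed (simp add: id_def)
    then show ?thesis by simp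
  qed
  moreover have "z \<lhd> E \<in> cspan {y \<lhd> \<Delta> a | a y. True}" (is "_ \<in> cspan ?T") for z
  proof -
    have "id (z \<lhd> E) \<in> cspan ?T"
    proof (rule clinear_in_cspan[OF _ E_right_span])
      fix s assume "s \<in> {y * x | x y. \<exists>p\<in>I \<times> I. x \<in> H p p}"
      then obtain r v x y where s: "s = y * x" "r \<in> I" "v \<in> I" "x \<in> H (r, v) (r, v)" by blast
      have "x \<in> cspan {b \<lhd> \<Delta> a | a b. a \<in> pa_col (I \<times> I) G (r, v) \<and> b \<in> pa_col (I \<times> I) H (r, v)}"
        using comult_col[of "(r, v)"] H_in_col[OF s(2-4)] s(2,3) by simp
      then have "y * x \<in> cspan ?T"
      proof (rule clinear_in_cspan[OF clinear_mult_left])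
        fix s assume "s \<in> {b \<lhd> \<Delta> a | a b. a \<in> pa_col (I \<times> I) G (r, v) \<and> b \<in> pa_col (I \<times> I) H (r, v)}"
        then obtain a b where "y * s = (y * b) \<lhd> \<Delta> a" by (auto simp: ract_mult[OF nondegenerate2])
        then show "y * s \<in> cspan ?T" by (blast intro: complex_vector.span_base)
      qed
      then show "id s \<in> cspan ?T" by (simp add: s(1))
    qed (simp add: id_def)
    then show ?thesis by simp
  qed
  ultimately show ?thesis
    unfolding nondeg_hom_def by (simp add: comult_linear comult_mult E_idem comult_E)
qed

text \<open>The extension of \<open>\<Delta>\<close> sends a base unit to the corresponding base unit of $A\otimes^I A$.
  Indeed, an element of \<open>B\<close> with right index \<open>p\<close> is a sum of elements $b\Delta(a')$ with
  $a'\in A{\bf 1}(p)$, and $a'a=0$ if \<open>a\<close> has a left index other than \<open>p\<close>.\<close>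

lemma comult_base_unit:
  assumes a: "r \<in> I" "v \<in> I" "q \<in> I \<times> I" "a \<in> G (r, v) q"
  shows "(up r \<otimes>\<^sub>M low v) * \<Delta> a = \<Delta> a"
proof (rule multiplier_eqI_right[OF nondegenerate2])
  fix z
  let ?u = "up r \<otimes>\<^sub>M low v"
  have "(z \<lhd> E) \<lhd> (?u * \<Delta> a) = (z \<lhd> E) \<lhd> \<Delta> a"
  proof (rule clinear_eq_on_cspan[OF clinear_ract clinear_ract E_right_span])
    fix s assume "s \<in> {y * x | x y. \<exists>p\<in>I \<times> I. x \<in> H p p}"
    then obtain r' v' x y where s: "s = y * x" "r' \<in> I" "v' \<in> I" "x \<in> H (r', v') (r', v')" by blast
    have "x \<lhd> (?u * \<Delta> a) = x \<lhd> \<Delta> a"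
    proof (cases "r' = r \<and> v' = v")
      case True
      then show ?thesis using act_H(3)[OF s(2-4) a(1,2)] by simp
    next
      case False
      have "x \<in> cspan {b \<lhd> \<Delta> a | a b. a \<in> pa_col (I \<times> I) G (r', v') \<and> b \<in> pa_col (I \<times> I) H (r', v')}"
        using comult_col[of "(r', v')"] H_in_col[OF s(2-4)] s(2,3) by simp
      then have "x \<lhd> \<Delta> a = 0"
      proof (rule clinear_eq_on_cspan[OF clinear_ract clinear_const_0])
        fix s assume "s \<in> {b \<lhd> \<Delta> a | a b. a \<in> pa_col (I \<times> I) G (r', v') \<and> b \<in> pa_col (I \<times> I) H (r', v')}"
        then obtain a' b where s': "s = b \<lhd> \<Delta> a'" "a' \<in> pa_col (I \<times> I) G (r', v')" by blast
        have "a' * a = 0"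
        proof (rule clinear_eq_on_cspan[OF clinear_mult_right clinear_const_0 s'(2)[unfolded pa_col_def]])
          fix w assume "w \<in> (\<Union>p\<in>I \<times> I. G p (r', v'))"
          then show "w * a = 0" using mult_0[of _ "(r', v')" "(r, v)" q w a] a s(2,3) False by auto
        qed
        then have "\<Delta> a' * \<Delta> a = 0"
          by (metis comult_mult clinear_0[OF comult_linear])
        then show "s \<lhd> \<Delta> a = 0" unfolding s'(1) ract_simps(7)[symmetric] by simp
      qed
      then show ?thesis using act_H(3)[OF s(2-4) a(1,2)] False by auto
    qed
    then show "s \<lhd> (?u * \<Delta> a) = s \<lhd> \<Delta> a" by (simp only: s(1) ract_mult[OF nondegenerate2])
  qed
  then have "z \<lhd> (E * (?u * \<Delta> a)) = z \<lhd> (E * \<Delta> a)" by simp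
  moreover have "E * (?u * \<Delta> a) = ?u * \<Delta> a"
    by (simp only: mult.assoc[of E ?u, symmetric] E_units(3)[OF a(1,2)] mult.assoc[of ?u E] comult_E)
  ultimately show "z \<lhd> (?u * \<Delta> a) = z \<lhd> \<Delta> a" by (simp only: comult_E)
qed


section \<open>Coassociativity and the exchange law\<close>

lemma cbilinear_comult_products:
  "cbilinear (\<lambda>a b. \<Delta> a * (1 \<otimes>\<^sub>M embed b))" "cbilinear (\<lambda>a b. (embed a \<otimes>\<^sub>M 1) * \<Delta> b)"
  "cbilinear (\<lambda>a b. (1 \<otimes>\<^sub>M embed b) * \<Delta> a)" "cbilinear (\<lambda>a b. \<Delta> b * (embed a \<otimes>\<^sub>M 1))"
  unfolding cbilinear_def
  by (intro conjI allI clinear_compose[OF comult_linear clinear_mult_left]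
      clinear_compose[OF comult_linear clinear_mult_right]
      clinear_compose[OF clinear_compose[OF clinear_embed clinear_multiplier_tensor_left]
        clinear_mult_left]
      clinear_compose[OF clinear_compose[OF clinear_embed clinear_multiplier_tensor_left]
        clinear_mult_right]
      clinear_compose[OF clinear_compose[OF clinear_embed clinear_multiplier_tensor_right]
        clinear_mult_left]
      clinear_compose[OF clinear_compose[OF clinear_embed clinear_multiplier_tensor_right]
        clinear_mult_right])+

lemmas T_bilinear = cbilinear_the_inv_embed[OF nondegenerate2 cbilinear_comult_products(1) comult_range(2)]
  cbilinear_the_inv_embed[OF nondegenerate2 cbilinear_comult_products(2) comult_range(3)]
  cbilinear_the_inv_embed[OF nondegenerate2 cbilinear_comult_products(3) comult_range(4)]
  cbilinear_the_inv_embed[OF nondegenerate2 cbilinear_comult_products(4) comult_range(1)]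

abbreviation T1 :: "'a \<otimes> 'a \<Rightarrow> 'a \<otimes> 'a" where "T1 \<equiv> comult_T1 \<Delta>"
abbreviation T2 :: "'a \<otimes> 'a \<Rightarrow> 'a \<otimes> 'a" where "T2 \<equiv> comult_T2 \<Delta>"

text \<open>The remaining canonical maps $T_3(a\otimes b)=(1\otimes b)\Delta(a)$ and
  $T_4(a\otimes b)=\Delta(b)(a\otimes1)$.\<close>

definition T3 :: "'a \<otimes> 'a \<Rightarrow> 'a \<otimes> 'a"
  where "T3 = tensor_lift (\<lambda>a b. the_inv embed ((1 \<otimes>\<^sub>M embed b) * \<Delta> a))"

definition T4 :: "'a \<otimes> 'a \<Rightarrow> 'a \<otimes> 'a"
  where "T4 = tensor_lift (\<lambda>a b. the_inv embed (\<Delta> b * (embed a \<otimes>\<^sub>M 1)))"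

lemma clinear_T: "clinear T1" "clinear T2" "clinear T3" "clinear T4"
  unfolding comult_T1_def comult_T2_def T3_def T4_def by (rule clinear_tensor_lift, rule T_bilinear)+

lemma T_pure: "T1 (a \<otimes> b) = the_inv embed (\<Delta> a * (1 \<otimes>\<^sub>M embed b))"
  "T2 (a \<otimes> b) = the_inv embed ((embed a \<otimes>\<^sub>M 1) * \<Delta> b)"
  "T3 (a \<otimes> b) = the_inv embed ((1 \<otimes>\<^sub>M embed b) * \<Delta> a)"
  "T4 (a \<otimes> b) = the_inv embed (\<Delta> b * (embed a \<otimes>\<^sub>M 1))"
  unfolding comult_T1_def comult_T2_def T3_def T4_def by (rule tensor_lift_pure, rule T_bilinear)+

lemma embed_T: "embed (T1 (a \<otimes> b)) = \<Delta> a * (1 \<otimes>\<^sub>M embed b)"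
  "embed (T2 (a \<otimes> b)) = (embed a \<otimes>\<^sub>M 1) * \<Delta> b"
  "embed (T3 (a \<otimes> b)) = (1 \<otimes>\<^sub>M embed b) * \<Delta> a"
  "embed (T4 (a \<otimes> b)) = \<Delta> b * (embed a \<otimes>\<^sub>M 1)"
  unfolding T_pure by (rule embed_the_inv[OF nondegenerate2 comult_range(2)]
    embed_the_inv[OF nondegenerate2 comult_range(3)] embed_the_inv[OF nondegenerate2 comult_range(4)]
    embed_the_inv[OF nondegenerate2 comult_range(1)])+

lemma nondeg_hom_comult_id: "nondeg_hom (comult_id \<Delta>) (E \<otimes>\<^sub>M 1)"
  and comult_id_pure: "comult_id \<Delta> (a \<otimes> b) = \<Delta> a \<otimes>\<^sub>M embed b"
  unfolding comult_id_def
  by (rule nondeg_hom_tensor[OF nondeg_hom_comult nondeg_hom_embed[OF idempotent_UNIV]])+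

lemma nondeg_hom_id_comult: "nondeg_hom (id_comult \<Delta>) (multiplier_assoc (1 \<otimes>\<^sub>M E))"
  and id_comult_pure: "id_comult \<Delta> (a \<otimes> b) = multiplier_assoc (embed a \<otimes>\<^sub>M \<Delta> b)"
proof -
  let ?h = "tensor_lift (\<lambda>a b. embed a \<otimes>\<^sub>M \<Delta> b)"
  note h = nondeg_hom_tensor[OF nondeg_hom_embed[OF idempotent_UNIV] nondeg_hom_comult]
  have "id_comult \<Delta> = (\<lambda>t. multiplier_assoc (?h t))"
    unfolding id_comult_def
    by (rule tensor_lift_eqI)
       (simp_all add: h(2) clinear_compose[OF nondeg_homD(1)[OF h(1)] clinear_multiplier_assoc])
  then show "nondeg_hom (id_comult \<Delta>) (multiplier_assoc (1 \<otimes>\<^sub>M E))"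
    "id_comult \<Delta> (a \<otimes> b) = multiplier_assoc (embed a \<otimes>\<^sub>M \<Delta> b)"
    using nondeg_hom_assoc[OF h(1)] by (simp_all add: h(2))
qed

text \<open>The extensions of $\Delta\otimes\mathrm{id}$ and $\mathrm{id}\otimes\Delta$ to $M(A\otimes A)$.\<close>

abbreviation F1 :: "('a \<otimes> 'a) multiplier \<Rightarrow> (('a \<otimes> 'a) \<otimes> 'a) multiplier"
  where "F1 \<equiv> multiplier_ext 1 (comult_id \<Delta>) (E \<otimes>\<^sub>M 1)"
abbreviation F2 :: "('a \<otimes> 'a) multiplier \<Rightarrow> (('a \<otimes> 'a) \<otimes> 'a) multiplier"
  where "F2 \<equiv> multiplier_ext 1 (id_comult \<Delta>) (multiplier_assoc (1 \<otimes>\<^sub>M E))"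

lemmas F1_args = nondeg_hom_comult_id nondegenerate3 nondegenerate2
lemmas F2_args = nondeg_hom_id_comult nondegenerate3 nondegenerate2

lemma cspan_pure: "cspan {a \<otimes> b | (a :: 'a) (b :: 'a). True} = UNIV"
  using cspan_tensor_UNIV[of "UNIV :: 'a set" "UNIV :: 'a set"] by simp

lemma F1_second_leg: "F1 (1 \<otimes>\<^sub>M n) = E \<otimes>\<^sub>M n"
proof (rule multiplier_ext_value_eqI[OF F1_args _ cspan_pure])
  show "(E \<otimes>\<^sub>M n) * (E \<otimes>\<^sub>M 1) = E \<otimes>\<^sub>M n" by (simp add: multiplier_tensor_mult E_idem)
  fix z :: "'a \<otimes> 'a" assume "z \<in> {a \<otimes> b | a b. True}"
  then show "(E \<otimes>\<^sub>M n) * comult_id \<Delta> z = comult_id \<Delta> ((1 \<otimes>\<^sub>M n) \<rhd> z)"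
    by (auto simp: comult_id_pure multiplier_tensor_mult comult_E mult_embed[OF nondegenerate_UNIV])
qed

lemma F2_first_leg: "F2 (n \<otimes>\<^sub>M 1) = multiplier_assoc (n \<otimes>\<^sub>M E)"
proof (rule multiplier_ext_value_eqI[OF F2_args _ cspan_pure])
  show "multiplier_assoc (n \<otimes>\<^sub>M E) * multiplier_assoc (1 \<otimes>\<^sub>M E) = multiplier_assoc (n \<otimes>\<^sub>M E)"
    by (simp add: multiplier_tensor_mult E_idem flip: multiplier_assoc_mult)
  fix z :: "'a \<otimes> 'a" assume "z \<in> {a \<otimes> b | a b. True}"
  then show "multiplier_assoc (n \<otimes>\<^sub>M E) * id_comult \<Delta> z = id_comult \<Delta> ((n \<otimes>\<^sub>M 1) \<rhd> z)"
    by (auto simp: id_comult_pure multiplier_tensor_mult comult_E mult_embed[OF nondegenerate_UNIV]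
        simp flip: multiplier_assoc_mult)
qed

text \<open>For $a$ with left lower index \<open>v\<close> and \<open>b\<close> with left upper index \<open>s\<close>, both $\Delta(a)\otimes b$ and
  $a\otimes\Delta(b)$ absorb the base units ${\bf 1}_v\otimes{\bf 1}^s$ in the adjacent legs, on which
  \<open>E\<close> acts as the Kronecker symbol $\delta_{v,s}$.\<close>

lemma F1_E: "F1 E = (E \<otimes>\<^sub>M 1) * multiplier_assoc (1 \<otimes>\<^sub>M E)"
proof (rule multiplier_ext_value_eqI[OF F1_args _ cspan_homogeneous2])
  have EE: "(E \<otimes>\<^sub>M 1) * (E \<otimes>\<^sub>M 1) = E \<otimes>\<^sub>M (1 :: 'a multiplier)"
    by (simp add: multiplier_tensor_mult E_idem)
  show "(E \<otimes>\<^sub>M 1) * multiplier_assoc (1 \<otimes>\<^sub>M E) * (E \<otimes>\<^sub>M 1) = (E \<otimes>\<^sub>M 1) * multiplier_assoc (1 \<otimes>\<^sub>M E)"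
    by (simp add: E_commute mult.assoc EE)
  fix z assume "z \<in> homogeneous2"
  then obtain a b where z: "z = a \<otimes> b" "a \<in> homogeneous" "b \<in> homogeneous"
    by (auto simp: homogeneous2_def)
  obtain r v q u where a: "r \<in> I" "v \<in> I" "q \<in> I" "u \<in> I" "a \<in> G (r, v) (q, u)"
    using homogeneousE[OF z(2)] .
  obtain s t q' u' where b: "s \<in> I" "t \<in> I" "q' \<in> I" "u' \<in> I" "b \<in> G (s, t) (q', u')"
    using homogeneousE[OF z(3)] .
  have "(1 \<otimes>\<^sub>M low v) * \<Delta> a = (1 \<otimes>\<^sub>M low v) * ((up r \<otimes>\<^sub>M low v) * \<Delta> a)"
    using comult_base_unit[OF a(1,2) _ a(5)] a(3,4) by simp
  also have "\<dots> = (up r \<otimes>\<^sub>M low v) * \<Delta> a"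
    by (simp add: multiplier_tensor_mult units_idem a(2) flip: mult.assoc)
  finally have 1: "(1 \<otimes>\<^sub>M low v) * \<Delta> a = \<Delta> a"
    using comult_base_unit[OF a(1,2) _ a(5)] a(3,4) by simp
  have 2: "up s * embed b = embed b"
    by (simp add: mult_embed[OF nondegenerate_UNIV] lact_up[OF b b(1)])
  have abs: "((1 \<otimes>\<^sub>M low v) \<otimes>\<^sub>M up s) * (\<Delta> a \<otimes>\<^sub>M embed b) = \<Delta> a \<otimes>\<^sub>M embed b"
    by (simp add: multiplier_tensor_mult 1 2)
  have "multiplier_assoc (1 \<otimes>\<^sub>M E) * (\<Delta> a \<otimes>\<^sub>M embed b)
      = multiplier_assoc (1 \<otimes>\<^sub>M E) * ((1 \<otimes>\<^sub>M low v) \<otimes>\<^sub>M up s) * (\<Delta> a \<otimes>\<^sub>M embed b)"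
    by (simp only: mult.assoc abs)
  also have "multiplier_assoc (1 \<otimes>\<^sub>M E) * ((1 \<otimes>\<^sub>M low v) \<otimes>\<^sub>M up s)
      = (if v = s then (1 \<otimes>\<^sub>M low v) \<otimes>\<^sub>M up s else 0)"
    unfolding multiplier_assoc_tensor[symmetric] multiplier_assoc_mult[symmetric]
    by (simp add: multiplier_tensor_mult E_units(1)[OF a(2) b(1)] clinear_0[OF clinear_multiplier_assoc])
  finally have 3: "multiplier_assoc (1 \<otimes>\<^sub>M E) * (\<Delta> a \<otimes>\<^sub>M embed b)
      = (if v = s then \<Delta> a \<otimes>\<^sub>M embed b else 0)"
    using abs by (simp split: if_splits)
  have "(E \<otimes>\<^sub>M 1) * multiplier_assoc (1 \<otimes>\<^sub>M E) * (\<Delta> a \<otimes>\<^sub>M embed b)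
      = (if v = s then \<Delta> a \<otimes>\<^sub>M embed b else 0)"
    by (simp add: mult.assoc 3 multiplier_tensor_mult comult_E)
  then show "(E \<otimes>\<^sub>M 1) * multiplier_assoc (1 \<otimes>\<^sub>M E) * comult_id \<Delta> z = comult_id \<Delta> (E \<rhd> z)"
    by (simp add: z(1) comult_id_pure lact_E[OF a b] clinear_0[OF nondeg_homD(1)[OF nondeg_hom_comult_id]])
qed

lemma F2_E: "F2 E = (E \<otimes>\<^sub>M 1) * multiplier_assoc (1 \<otimes>\<^sub>M E)"
proof (rule multiplier_ext_value_eqI[OF F2_args _ cspan_homogeneous2])
  have EE: "multiplier_assoc (1 \<otimes>\<^sub>M E) * multiplier_assoc (1 \<otimes>\<^sub>M E) =
      multiplier_assoc ((1 :: 'a multiplier) \<otimes>\<^sub>M E)"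
    by (simp add: multiplier_tensor_mult E_idem flip: multiplier_assoc_mult)
  show "(E \<otimes>\<^sub>M 1) * multiplier_assoc (1 \<otimes>\<^sub>M E) * multiplier_assoc (1 \<otimes>\<^sub>M E) =
      (E \<otimes>\<^sub>M 1) * multiplier_assoc (1 \<otimes>\<^sub>M E)"
    by (simp add: mult.assoc EE)
  fix z assume "z \<in> homogeneous2"
  then obtain a b where z: "z = a \<otimes> b" "a \<in> homogeneous" "b \<in> homogeneous"
    by (auto simp: homogeneous2_def)
  obtain r v q u where a: "r \<in> I" "v \<in> I" "q \<in> I" "u \<in> I" "a \<in> G (r, v) (q, u)"
    using homogeneousE[OF z(2)] .
  obtain s t q' u' where b: "s \<in> I" "t \<in> I" "q' \<in> I" "u' \<in> I" "b \<in> G (s, t) (q', u')"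
    using homogeneousE[OF z(3)] .
  have "(up s \<otimes>\<^sub>M 1) * \<Delta> b = (up s \<otimes>\<^sub>M 1) * ((up s \<otimes>\<^sub>M low t) * \<Delta> b)"
    using comult_base_unit[OF b(1,2) _ b(5)] b(3,4) by simp
  also have "\<dots> = (up s \<otimes>\<^sub>M low t) * \<Delta> b"
    by (simp add: multiplier_tensor_mult units_idem b(1) flip: mult.assoc)
  finally have 1: "(up s \<otimes>\<^sub>M 1) * \<Delta> b = \<Delta> b"
    using comult_base_unit[OF b(1,2) _ b(5)] b(3,4) by simp
  have 2: "low v * embed a = embed a"
    by (simp add: mult_embed[OF nondegenerate_UNIV] lact_low[OF a a(2)])
  have abs: "multiplier_assoc (low v \<otimes>\<^sub>M (up s \<otimes>\<^sub>M 1)) * multiplier_assoc (embed a \<otimes>\<^sub>M \<Delta> b)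
      = multiplier_assoc (embed a \<otimes>\<^sub>M \<Delta> b)"
    by (simp add: multiplier_tensor_mult 1 2 flip: multiplier_assoc_mult)
  have "(E \<otimes>\<^sub>M 1) * multiplier_assoc (embed a \<otimes>\<^sub>M \<Delta> b)
      = (E \<otimes>\<^sub>M 1) * multiplier_assoc (low v \<otimes>\<^sub>M (up s \<otimes>\<^sub>M 1)) * multiplier_assoc (embed a \<otimes>\<^sub>M \<Delta> b)"
    by (simp only: mult.assoc abs)
  also have "(E \<otimes>\<^sub>M 1) * multiplier_assoc (low v \<otimes>\<^sub>M (up s \<otimes>\<^sub>M 1))
      = (if v = s then multiplier_assoc (low v \<otimes>\<^sub>M (up s \<otimes>\<^sub>M 1)) else 0)"
    by (simp add: multiplier_assoc_tensor multiplier_tensor_mult E_units(1)[OF a(2) b(1)])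
  finally have 3: "(E \<otimes>\<^sub>M 1) * multiplier_assoc (embed a \<otimes>\<^sub>M \<Delta> b)
      = (if v = s then multiplier_assoc (embed a \<otimes>\<^sub>M \<Delta> b) else 0)"
    using abs by (simp split: if_splits)
  have 4: "multiplier_assoc (1 \<otimes>\<^sub>M E) * multiplier_assoc (embed a \<otimes>\<^sub>M \<Delta> b)
      = multiplier_assoc (embed a \<otimes>\<^sub>M \<Delta> b)"
    by (simp add: multiplier_tensor_mult comult_E flip: multiplier_assoc_mult)
  show "(E \<otimes>\<^sub>M 1) * multiplier_assoc (1 \<otimes>\<^sub>M E) * id_comult \<Delta> z = id_comult \<Delta> (E \<rhd> z)"
    by (simp add: z(1) id_comult_pure lact_E[OF a b] mult.assoc 3 4
        clinear_0[OF nondeg_homD(1)[OF nondeg_hom_id_comult]])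
qed

text \<open>Coassociativity is an equation between extensions from the corner $M(A\otimes^I A)$; it
  transfers to the extensions from $M(A\otimes A)$.\<close>

lemma F_comult: "F1 (\<Delta> a) = F2 (\<Delta> a)"
proof -
  let ?E3 = "(E \<otimes>\<^sub>M 1) * multiplier_assoc (1 \<otimes>\<^sub>M E)"
  have span: "E \<rhd> b \<in> cspan {((E \<rhd> x) \<lhd> E) * y | x y. True}" for b
  proof -
    have "{x * y | x y. \<exists>p\<in>I \<times> I. x \<in> H p p} \<subseteq> {((E \<rhd> x) \<lhd> E) * y | x y. True}"
    proof clarify
      fix x y r v assume "r \<in> I" "v \<in> I" "x \<in> H (r, v) (r, v)"
      then have "(E \<rhd> x) \<lhd> E = x" by (simp add: act_H)
      then show "\<exists>x' y'. x * y = ((E \<rhd> x') \<lhd> E) * y' \<and> True" by metis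
    qed
    from complex_vector.span_mono[OF this] show ?thesis using E_left_span by blast
  qed
  have corner: "E * \<Delta> a * E = \<Delta> a" by (rule comult_corner)
  have "multiplier_ext E (comult_id \<Delta>) ?E3 (\<Delta> a) = multiplier_ext E (id_comult \<Delta>) ?E3 (\<Delta> a)"
    using comult_coassoc by (simp add: coassociative_def Let_def)
  then show ?thesis
    by (simp only: multiplier_ext_corner[OF F1_args E_idem span F1_E]
        multiplier_ext_corner[OF F2_args E_idem span F2_E] corner)
qed

text \<open>At $a\otimes b\otimes c$ the two sides are $(a\otimes1\otimes1)F_i(\Delta(b))(1\otimes1\otimes c)$
  for $i=1$ and $i=2$.\<close>

lemma exchange_law:
  "tensor_map T2 (\<lambda>x. x) (tensor_assoc_inv (tensor_map (\<lambda>x. x) T1 (tensor_assoc t)))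
    = tensor_assoc_inv (tensor_map (\<lambda>x. x) T1 (tensor_assoc (tensor_map T2 (\<lambda>x. x) t)))"
proof -
  note lin = clinear_tensor_map[OF clinear_T(2) clinear_id] clinear_tensor_map[OF clinear_id clinear_T(1)]
    clinear_tensor_assoc clinear_tensor_assoc_inv
  note pure = tensor_map_pure[OF clinear_T(2) clinear_id] tensor_map_pure[OF clinear_id clinear_T(1)]
    tensor_assoc_pure tensor_assoc_inv_pure
  have left: "embed (tensor_map T2 (\<lambda>x. x) (tensor_assoc_inv (a \<otimes> z)))
      = ((embed a \<otimes>\<^sub>M 1) \<otimes>\<^sub>M 1) * comult_id \<Delta> z" for a z
  proof (induction z rule: tensor_induct)
    case zero
    show ?case
      by (simp add: clinear_0[OF lin(1)] clinear_0[OF lin(4)] clinear_0[OF clinear_embed]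
          clinear_0[OF nondeg_homD(1)[OF nondeg_hom_comult_id]])
  next
    case (add x y z)
    then show ?case
      by (simp add: tensor_add_right clinear_add[OF lin(1)] clinear_add[OF lin(4)]
          clinear_add[OF clinear_embed] clinear_add[OF nondeg_homD(1)[OF nondeg_hom_comult_id]]
          distrib_left pure embed_tensor embed_T comult_id_pure multiplier_tensor_mult)
  qed
  have right: "embed (tensor_assoc_inv (tensor_map (\<lambda>x. x) T1 (tensor_assoc (z \<otimes> c))))
      = id_comult \<Delta> z * (1 \<otimes>\<^sub>M embed c)" for c z
  proof (induction z rule: tensor_induct)
    case zero
    show ?case
      by (simp add: clinear_0[OF lin(2)] clinear_0[OF lin(3)] clinear_0[OF lin(4)]
          clinear_0[OF clinear_embed] clinear_0[OF nondeg_homD(1)[OF nondeg_hom_id_comult]])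
  next
    case (add x y z)
    have "embed (tensor_assoc_inv (x \<otimes> T1 (y \<otimes> c)))
        = multiplier_assoc (embed x \<otimes>\<^sub>M (\<Delta> y * (1 \<otimes>\<^sub>M embed c)))"
      by (simp add: embed_assoc_inv embed_tensor embed_T)
    also have "\<dots> = multiplier_assoc (embed x \<otimes>\<^sub>M \<Delta> y) * multiplier_assoc (1 \<otimes>\<^sub>M (1 \<otimes>\<^sub>M embed c))"
      by (simp add: multiplier_tensor_mult flip: multiplier_assoc_mult)
    also have "\<dots> = id_comult \<Delta> (x \<otimes> y) * (1 \<otimes>\<^sub>M embed c)"
      by (simp only: multiplier_assoc_tensor[of 1 1] multiplier_tensor_one id_comult_pure)
    finally show ?case using add
      by (simp add: tensor_add_left clinear_add[OF lin(2)] clinear_add[OF lin(3)]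
          clinear_add[OF lin(4)] clinear_add[OF clinear_embed]
          clinear_add[OF nondeg_homD(1)[OF nondeg_hom_id_comult]] distrib_right pure)
  qed
  have "tensor_map T2 (\<lambda>x. x) (tensor_assoc_inv (tensor_map (\<lambda>x. x) T1 (tensor_assoc ((a \<otimes> b) \<otimes> c))))
      = tensor_assoc_inv (tensor_map (\<lambda>x. x) T1 (tensor_assoc (tensor_map T2 (\<lambda>x. x) ((a \<otimes> b) \<otimes> c))))" for a b c
  proof (rule embed_eqD[OF nondegenerate3])
    let ?a = "(embed a \<otimes>\<^sub>M 1) \<otimes>\<^sub>M 1" and ?c = "1 \<otimes>\<^sub>M embed c"
    have 1: "comult_id \<Delta> (T1 (b \<otimes> c)) = F1 (\<Delta> b) * ?c"
    proof -
      have "comult_id \<Delta> (T1 (b \<otimes> c)) = F1 (embed (T1 (b \<otimes> c)))"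
        by (simp only: multiplier_ext_embed[OF F1_args])
      also have "\<dots> = F1 (\<Delta> b) * (E \<otimes>\<^sub>M embed c)"
        by (simp only: embed_T multiplier_ext_mult[OF F1_args] F1_second_leg)
      also have "E \<otimes>\<^sub>M embed c = (E \<otimes>\<^sub>M 1) * ?c" by (simp add: multiplier_tensor_mult)
      finally show ?thesis
        by (simp only: mult.assoc[symmetric] multiplier_ext_unit(2)[OF F1_args])
    qed
    have 2: "id_comult \<Delta> (T2 (a \<otimes> b)) = ?a * F2 (\<Delta> b)"
    proof -
      have "id_comult \<Delta> (T2 (a \<otimes> b)) = F2 (embed (T2 (a \<otimes> b)))"
        by (simp only: multiplier_ext_embed[OF F2_args])
      also have "\<dots> = multiplier_assoc (embed a \<otimes>\<^sub>M E) * F2 (\<Delta> b)"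
        by (simp only: embed_T multiplier_ext_mult[OF F2_args] F2_first_leg)
      also have "multiplier_assoc (embed a \<otimes>\<^sub>M E) = ?a * multiplier_assoc (1 \<otimes>\<^sub>M E)"
        by (simp add: multiplier_tensor_mult flip: multiplier_assoc_tensor multiplier_assoc_mult)
          (simp add: multiplier_tensor_one multiplier_tensor_mult flip: multiplier_assoc_mult)
      finally show ?thesis
        by (simp only: mult.assoc multiplier_ext_unit(1)[OF F2_args])
    qed
    show "embed (tensor_map T2 (\<lambda>x. x) (tensor_assoc_inv (tensor_map (\<lambda>x. x) T1 (tensor_assoc ((a \<otimes> b) \<otimes> c)))))
      = embed (tensor_assoc_inv (tensor_map (\<lambda>x. x) T1 (tensor_assoc (tensor_map T2 (\<lambda>x. x) ((a \<otimes> b) \<otimes> c)))))"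
      by (simp only: pure(1,3) pure(2)[of a] left right 1 2 F_comult mult.assoc)
  qed
  then show ?thesis
    by (induction t rule: tensor3_induct) (simp_all add: clinear_0 clinear_add lin)
qed


section \<open>The counit\<close>

lemma counit_linear: "clinear \<epsilon>"
  and counit_0: "r \<in> I \<Longrightarrow> t \<in> I \<Longrightarrow> s \<in> I \<Longrightarrow> u \<in> I \<Longrightarrow> a \<in> G (r, t) (s, u) \<Longrightarrow> r \<noteq> t \<or> s \<noteq> u \<Longrightarrow> \<epsilon> a = 0"
  and counit_mult: "s \<in> I \<Longrightarrow> t \<in> I \<Longrightarrow> a \<in> pa_col (I \<times> I) G (s, t) \<Longrightarrow> b \<in> pa_row (I \<times> I) G (s, t) \<Longrightarrow>
    \<epsilon> (a * b) = \<epsilon> a * \<epsilon> b"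
  and counit_slice: "id_slice_multiplier \<epsilon> (\<Delta> a) = embed a" "slice_id_multiplier \<epsilon> (\<Delta> a) = embed a"
  using counit unfolding partial_counit_def by blast+

lemmas slice = slice_id_pure[OF counit_linear] id_slice_pure[OF counit_linear]
lemmas slice_linear = clinear_slice_id[OF counit_linear] clinear_id_slice[OF counit_linear]

text \<open>The counit axiom is stated for multipliers; before it can be evaluated, the two slice maps have
  to be seen to form a multiplier, which follows from $(1\otimes c)T_1(a\otimes b)=T_3(a\otimes c)(1\otimes b)$,
  and similarly for $T_2$ and $T_4$.\<close>

lemma slice_id_T: "slice_id \<epsilon> (T1 (a \<otimes> b)) = a * b" "slice_id \<epsilon> (T3 (a \<otimes> b)) = b * a"
proof -
  note l = clinear_0[OF slice_linear(1)] clinear_add[OF slice_linear(1)]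
  have act: "c * slice_id \<epsilon> w = slice_id \<epsilon> ((1 \<otimes>\<^sub>M embed c) \<rhd> w)"
    "slice_id \<epsilon> w * c = slice_id \<epsilon> (w \<lhd> (1 \<otimes>\<^sub>M embed c))" for c w
    by (induction w rule: tensor_induct)
       (simp_all add: l slice distrib_left distrib_right mult_scaleC_left mult_scaleC_right)
  have "c * slice_id \<epsilon> (T1 (a \<otimes> b)) = slice_id \<epsilon> (T3 (a \<otimes> c)) * b" for b c
  proof -
    have "(1 \<otimes>\<^sub>M embed c) \<rhd> T1 (a \<otimes> b) = T3 (a \<otimes> c) \<lhd> (1 \<otimes>\<^sub>M embed b)"
      by (rule embed_eqD[OF nondegenerate2])
         (simp add: embed_T mult.assoc flip: mult_embed[OF nondegenerate2]
           embed_mult_multiplier[OF nondegenerate2])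
    then show ?thesis by (simp add: act)
  qed
  moreover have "clinear (\<lambda>b. slice_id \<epsilon> (T1 (a \<otimes> b)))" "clinear (\<lambda>b. slice_id \<epsilon> (T3 (a \<otimes> b)))"
    by (intro clinear_compose[OF clinear_compose[OF clinear_tensor_right] slice_linear(1)] clinear_T)+
  moreover have "slice_id_multiplier \<epsilon> (\<Delta> a)
      = Abs_multiplier (\<lambda>b. slice_id \<epsilon> (T1 (a \<otimes> b)), \<lambda>b. slice_id \<epsilon> (T3 (a \<otimes> b)))"
    by (simp add: slice_id_multiplier_def T_pure)
  ultimately have "slice_id_multiplier \<epsilon> (\<Delta> a) \<rhd> b = slice_id \<epsilon> (T1 (a \<otimes> b))"
    "b \<lhd> slice_id_multiplier \<epsilon> (\<Delta> a) = slice_id \<epsilon> (T3 (a \<otimes> b))"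
    by (simp_all add: lact_Abs_multiplier ract_Abs_multiplier)
  then show "slice_id \<epsilon> (T1 (a \<otimes> b)) = a * b" "slice_id \<epsilon> (T3 (a \<otimes> b)) = b * a"
    by (simp_all add: counit_slice)
qed

lemma id_slice_T2: "id_slice \<epsilon> (T2 (a \<otimes> b)) = a * b"
proof -
  note l = clinear_0[OF slice_linear(2)] clinear_add[OF slice_linear(2)]
  have act: "c * id_slice \<epsilon> w = id_slice \<epsilon> ((embed c \<otimes>\<^sub>M 1) \<rhd> w)"
    "id_slice \<epsilon> w * c = id_slice \<epsilon> (w \<lhd> (embed c \<otimes>\<^sub>M 1))" for c w
    by (induction w rule: tensor_induct)
       (simp_all add: l slice distrib_left distrib_right mult_scaleC_left mult_scaleC_right)
  have "c * id_slice \<epsilon> (T4 (a \<otimes> b)) = id_slice \<epsilon> (T2 (c \<otimes> b)) * a" for a c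
  proof -
    have "(embed c \<otimes>\<^sub>M 1) \<rhd> T4 (a \<otimes> b) = T2 (c \<otimes> b) \<lhd> (embed a \<otimes>\<^sub>M 1)"
      by (rule embed_eqD[OF nondegenerate2])
         (simp add: embed_T mult.assoc flip: mult_embed[OF nondegenerate2]
           embed_mult_multiplier[OF nondegenerate2])
    then show ?thesis by (simp add: act)
  qed
  moreover have "clinear (\<lambda>a. id_slice \<epsilon> (T4 (a \<otimes> b)))" "clinear (\<lambda>a. id_slice \<epsilon> (T2 (a \<otimes> b)))"
    by (intro clinear_compose[OF clinear_compose[OF clinear_tensor_left] slice_linear(2)] clinear_T)+
  moreover have "id_slice_multiplier \<epsilon> (\<Delta> b)
      = Abs_multiplier (\<lambda>a. id_slice \<epsilon> (T4 (a \<otimes> b)), \<lambda>a. id_slice \<epsilon> (T2 (a \<otimes> b)))"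
    by (simp add: id_slice_multiplier_def T_pure)
  ultimately have "a \<lhd> id_slice_multiplier \<epsilon> (\<Delta> b) = id_slice \<epsilon> (T2 (a \<otimes> b))"
    by (simp add: ract_Abs_multiplier)
  then show ?thesis by (simp add: counit_slice)
qed

text \<open>The counit is multiplicative up to a base unit: if \<open>x\<close> is homogeneous with right index $(r,t)$,
  this is the multiplicativity of $\varepsilon$; for other \<open>x\<close> both sides vanish.\<close>

lemma counit_mult_right:
  assumes b: "r \<in> I" "t \<in> I" "s \<in> I" "u \<in> I" "b \<in> G (r, t) (s, u)"
  shows "\<epsilon> (x * b) = \<epsilon> (x \<lhd> low t) * \<epsilon> b"
proof -
  have "clinear (\<lambda>x. \<epsilon> (x \<lhd> low t) * \<epsilon> b)"
    using clinear_compose[OF clinear_ract counit_linear, of "low t"]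
    by (simp add: clinear_iff distrib_right scaleC_complex_def)
  then show ?thesis
  proof (rule clinear_eq_on_cspan[OF clinear_compose[OF clinear_mult_right counit_linear], of _ _ homogeneous])
    fix x assume "x \<in> homogeneous"
    then obtain k l p q where x: "k \<in> I" "l \<in> I" "p \<in> I" "q \<in> I" "x \<in> G (k, l) (p, q)"
      using homogeneousE by blast
    show "\<epsilon> (x * b) = \<epsilon> (x \<lhd> low t) * \<epsilon> b"
    proof (cases "(p, q) = (r, t)")
      case True
      have "x \<in> pa_col (I \<times> I) G (r, t)" "b \<in> pa_row (I \<times> I) G (r, t)"
        unfolding pa_col_def pa_row_def using x b True by (auto intro!: complex_vector.span_base)
      from counit_mult[OF b(1,2) this] show ?thesis using True b by (simp add: ract_low[OF x])
    next
      case False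
      have "x * b = 0" by (rule mult_0[OF _ _ _ _ x(5) b(5)]) (use x b False in auto)
      moreover have "\<epsilon> (x \<lhd> low t) * \<epsilon> b = 0"
      proof (cases "q = t")
        case True
        with False have "p \<noteq> q \<or> r \<noteq> t" by auto
        then have "\<epsilon> x = 0 \<or> \<epsilon> b = 0" using counit_0[OF x] counit_0[OF b] by blast
        then show ?thesis using True b by (auto simp: ract_low[OF x])
      next
        case False
        then show ?thesis using b by (simp add: ract_low[OF x] clinear_0[OF counit_linear])
      qed
      ultimately show ?thesis by (simp add: clinear_0[OF counit_linear])
    qed
  qed (simp add: cspan_homogeneous)
qed

lemma counit_mult_left:
  assumes b: "s \<in> I" "u \<in> I" "r \<in> I" "t \<in> I" "b \<in> G (s, u) (r, t)"
  shows "\<epsilon> (b * x) = \<epsilon> b * \<epsilon> (low t \<rhd> x)"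
proof -
  have "clinear (\<lambda>x. \<epsilon> b * \<epsilon> (low t \<rhd> x))"
    using clinear_compose[OF clinear_lact counit_linear, of "low t"]
    by (simp add: clinear_iff distrib_left scaleC_complex_def)
  then show ?thesis
  proof (rule clinear_eq_on_cspan[OF clinear_compose[OF clinear_mult_left counit_linear], of _ _ homogeneous])
    fix x assume "x \<in> homogeneous"
    then obtain p q k l where x: "p \<in> I" "q \<in> I" "k \<in> I" "l \<in> I" "x \<in> G (p, q) (k, l)"
      using homogeneousE by blast
    show "\<epsilon> (b * x) = \<epsilon> b * \<epsilon> (low t \<rhd> x)"
    proof (cases "(p, q) = (r, t)")
      case True
      have "b \<in> pa_col (I \<times> I) G (r, t)" "x \<in> pa_row (I \<times> I) G (r, t)"
        unfolding pa_col_def pa_row_def using x b True by (auto intro!: complex_vector.span_base)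
      from counit_mult[OF b(3,4) this] show ?thesis using True b by (simp add: lact_low[OF x])
    next
      case False
      have "b * x = 0" by (rule mult_0[OF _ _ _ _ b(5) x(5)]) (use x b False in auto)
      moreover have "\<epsilon> b * \<epsilon> (low t \<rhd> x) = 0"
      proof (cases "q = t")
        case True
        with False have "p \<noteq> q \<or> r \<noteq> t" by auto
        then have "\<epsilon> x = 0 \<or> \<epsilon> b = 0" using counit_0[OF x] counit_0[OF b] by blast
        then show ?thesis using True b by (auto simp: lact_low[OF x])
      next
        case False
        then show ?thesis using b by (simp add: lact_low[OF x] clinear_0[OF counit_linear])
      qed
      ultimately show ?thesis by (simp add: clinear_0[OF counit_linear])
    qed
  qed (simp add: cspan_homogeneous)
qed

text \<open>Let \<open>b\<close> have left lower index \<open>t\<close> and \<open>c\<close> have left upper index \<open>r'\<close>. The element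
  $\Delta(a)(b\otimes c)=T_1(a\otimes c)(b\otimes1)$ has the slice
  $\varepsilon(b)\,(\varepsilon\otimes\mathrm{id})(T_1(a\otimes c)({\bf 1}_t\otimes1))$, and
  $T_1(a\otimes c)({\bf 1}_t\otimes1)$ is $T_1(a\otimes c)$ or $0$, depending on whether $t=r'$,
  because $\Delta(a)=\Delta(a)E$.\<close>

lemma counit_comult_right:
  "slice_id \<epsilon> ((1 \<otimes>\<^sub>M embed a) \<rhd> E \<rhd> (b \<otimes> c)) = slice_id \<epsilon> (\<Delta> a \<rhd> (b \<otimes> c))"
proof -
  have hom: "slice_id \<epsilon> ((1 \<otimes>\<^sub>M embed a) \<rhd> E \<rhd> z) = slice_id \<epsilon> (\<Delta> a \<rhd> z)" if "z \<in> homogeneous2" for z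
  proof -
    from that obtain b c where z: "z = b \<otimes> c" "b \<in> homogeneous" "c \<in> homogeneous"
      by (auto simp: homogeneous2_def)
    obtain r t s u where b: "r \<in> I" "t \<in> I" "s \<in> I" "u \<in> I" "b \<in> G (r, t) (s, u)"
      using homogeneousE[OF z(2)] .
    obtain r' t' s' u' where c: "r' \<in> I" "t' \<in> I" "s' \<in> I" "u' \<in> I" "c \<in> G (r', t') (s', u')"
      using homogeneousE[OF z(3)] .
    let ?w = "T1 (a \<otimes> c)"
    note embeds = mult_embed[OF nondegenerate2] embed_mult_multiplier[OF nondegenerate2]
    have "\<Delta> a \<rhd> (b \<otimes> c) = ?w \<lhd> (embed b \<otimes>\<^sub>M 1)"
      by (rule embed_eqD[OF nondegenerate2])
         (simp add: embed_T embed_tensor mult.assoc multiplier_tensor_mult flip: embeds)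
    also have "slice_id \<epsilon> (w \<lhd> (embed b \<otimes>\<^sub>M 1)) = \<epsilon> b *\<^sub>C slice_id \<epsilon> (w \<lhd> (low t \<otimes>\<^sub>M 1))" for w
      by (induction w rule: tensor_induct)
         (simp_all add: clinear_0[OF slice_linear(1)] clinear_add[OF slice_linear(1)] slice
           counit_mult_right[OF b] scaleC_add_right scaleC_scaleC mult.commute)
    also have "?w \<lhd> (low t \<otimes>\<^sub>M 1) = (if t = r' then ?w else 0)"
    proof (rule embed_eqD[OF nondegenerate2])
      have c': "(1 \<otimes>\<^sub>M up r') * (1 \<otimes>\<^sub>M embed c) = 1 \<otimes>\<^sub>M embed c"
        by (simp add: multiplier_tensor_mult mult_embed[OF nondegenerate_UNIV] lact_up[OF c c(1)])
      have "embed (?w \<lhd> (low t \<otimes>\<^sub>M 1)) = \<Delta> a * ((low t \<otimes>\<^sub>M up r') * (1 \<otimes>\<^sub>M embed c))"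
      proof -
        have "(low t \<otimes>\<^sub>M up r') * (1 \<otimes>\<^sub>M embed c) = (1 \<otimes>\<^sub>M embed c) * (low t \<otimes>\<^sub>M 1)"
          using c' by (simp add: multiplier_tensor_mult mult_embed[OF nondegenerate_UNIV] lact_up[OF c c(1)])
        then show ?thesis by (simp add: embed_T mult.assoc flip: embeds)
      qed
      also have "\<dots> = \<Delta> a * ((E * (low t \<otimes>\<^sub>M up r')) * (1 \<otimes>\<^sub>M embed c))"
        by (simp only: mult.assoc[symmetric] comult_E)
      also have "\<dots> = (if t = r' then \<Delta> a * ((E * (1 \<otimes>\<^sub>M up r')) * (1 \<otimes>\<^sub>M embed c)) else 0)"
        by (simp add: E_units(1,4)[OF b(2) c(1)])
      also have "\<Delta> a * ((E * (1 \<otimes>\<^sub>M up r')) * (1 \<otimes>\<^sub>M embed c)) = \<Delta> a * (1 \<otimes>\<^sub>M embed c)"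
        by (simp only: mult.assoc c') (simp only: mult.assoc[symmetric] comult_E)
      finally show "embed (?w \<lhd> (low t \<otimes>\<^sub>M 1)) = embed (if t = r' then ?w else 0)"
        by (simp add: embed_T clinear_0[OF clinear_embed])
    qed
    finally show ?thesis
      by (simp add: z(1) lact_E[OF b c] slice slice_id_T clinear_0[OF slice_linear(1)])
  qed
  show ?thesis
    by (rule clinear_eq_on_cspan[OF
          clinear_compose[OF clinear_compose[OF clinear_lact clinear_lact] slice_linear(1)]
          clinear_compose[OF clinear_lact slice_linear(1)], of _ homogeneous2])
       (simp_all add: cspan_homogeneous2 hom)
qed

lemma counit_comult_left:
  "slice_id \<epsilon> ((a \<otimes> b) \<lhd> E \<lhd> (1 \<otimes>\<^sub>M embed c)) = slice_id \<epsilon> ((a \<otimes> b) \<lhd> \<Delta> c)"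
proof -
  have hom: "slice_id \<epsilon> (z \<lhd> E \<lhd> (1 \<otimes>\<^sub>M embed c)) = slice_id \<epsilon> (z \<lhd> \<Delta> c)" if "z \<in> homogeneous2" for z
  proof -
    from that obtain a b where z: "z = a \<otimes> b" "a \<in> homogeneous" "b \<in> homogeneous"
      by (auto simp: homogeneous2_def)
    obtain s u r t where a: "s \<in> I" "u \<in> I" "r \<in> I" "t \<in> I" "a \<in> G (s, u) (r, t)"
      using homogeneousE[OF z(2)] .
    obtain s' u' r' t' where b: "s' \<in> I" "u' \<in> I" "r' \<in> I" "t' \<in> I" "b \<in> G (s', u') (r', t')"
      using homogeneousE[OF z(3)] .
    let ?w = "T3 (c \<otimes> b)"
    note embeds = mult_embed[OF nondegenerate2] embed_mult_multiplier[OF nondegenerate2]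
    have "(a \<otimes> b) \<lhd> \<Delta> c = (embed a \<otimes>\<^sub>M 1) \<rhd> ?w"
      by (rule embed_eqD[OF nondegenerate2])
         (simp add: embed_T embed_tensor multiplier_tensor_mult flip: embeds mult.assoc)
    also have "slice_id \<epsilon> ((embed a \<otimes>\<^sub>M 1) \<rhd> w) = \<epsilon> a *\<^sub>C slice_id \<epsilon> ((low t \<otimes>\<^sub>M 1) \<rhd> w)" for w
      by (induction w rule: tensor_induct)
         (simp_all add: clinear_0[OF slice_linear(1)] clinear_add[OF slice_linear(1)] slice
           counit_mult_left[OF a] scaleC_add_right scaleC_scaleC)
    also have "(low t \<otimes>\<^sub>M 1) \<rhd> ?w = (if t = r' then ?w else 0)"
    proof (rule embed_eqD[OF nondegenerate2])
      have b': "(1 \<otimes>\<^sub>M embed b) * (1 \<otimes>\<^sub>M up r') = 1 \<otimes>\<^sub>M embed b"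
        by (simp add: multiplier_tensor_mult embed_mult_multiplier[OF nondegenerate_UNIV] ract_up[OF b b(3)])
      have "embed ((low t \<otimes>\<^sub>M 1) \<rhd> ?w) = ((1 \<otimes>\<^sub>M embed b) * (low t \<otimes>\<^sub>M up r')) * \<Delta> c"
      proof -
        have "(1 \<otimes>\<^sub>M embed b) * (low t \<otimes>\<^sub>M up r') = (low t \<otimes>\<^sub>M 1) * (1 \<otimes>\<^sub>M embed b)"
          by (simp add: multiplier_tensor_mult embed_mult_multiplier[OF nondegenerate_UNIV] ract_up[OF b b(3)])
        then show ?thesis by (simp add: embed_T flip: embeds mult.assoc)
      qed
      also have "\<dots> = ((1 \<otimes>\<^sub>M embed b) * ((low t \<otimes>\<^sub>M up r') * E)) * \<Delta> c"
        by (simp only: mult.assoc comult_E)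
      also have "\<dots> = (if t = r' then ((1 \<otimes>\<^sub>M embed b) * ((1 \<otimes>\<^sub>M up r') * E)) * \<Delta> c else 0)"
        by (simp add: E_units(2,5)[OF a(4) b(3)])
      also have "((1 \<otimes>\<^sub>M embed b) * ((1 \<otimes>\<^sub>M up r') * E)) * \<Delta> c = (1 \<otimes>\<^sub>M embed b) * \<Delta> c"
        by (simp only: mult.assoc[symmetric] b') (simp only: mult.assoc comult_E)
      finally show "embed ((low t \<otimes>\<^sub>M 1) \<rhd> ?w) = embed (if t = r' then ?w else 0)"
        by (simp add: embed_T clinear_0[OF clinear_embed])
    qed
    finally show ?thesis
      by (simp add: z(1) ract_E[OF a b] slice slice_id_T clinear_0[OF slice_linear(1)])
  qed
  show ?thesis
    by (rule clinear_eq_on_cspan[OF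
          clinear_compose[OF clinear_compose[OF clinear_ract clinear_ract] slice_linear(1)]
          clinear_compose[OF clinear_ract slice_linear(1)], of _ homogeneous2])
       (simp_all add: cspan_homogeneous2 hom)
qed


section \<open>The weak multiplier bialgebra\<close>

lemma E_comult_span:
  "cspan {\<Delta> a \<rhd> (b \<otimes> c) | a b c. True} = cspan {E \<rhd> (b \<otimes> c) | b c. True}"
  "cspan {(a \<otimes> b) \<lhd> \<Delta> c | a b c. True} = cspan {(a \<otimes> b) \<lhd> E | a b. True}"
proof -
  note D = nondeg_homD[OF nondeg_hom_comult]
  have subset: "cspan S \<subseteq> cspan T" if "\<And>s. s \<in> S \<Longrightarrow> s \<in> cspan T" for S T :: "('a \<otimes> 'a) set"
    using that by (intro complex_vector.span_minimal complex_vector.subspace_span) blast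
  have pure: "z \<in> cspan {a \<otimes> b | (a :: 'a) (b :: 'a). True}" for z by (simp only: cspan_pure UNIV_I)
  have L: "m \<rhd> z \<in> cspan {m \<rhd> (b \<otimes> c) | b c. True}" for m and z :: "'a \<otimes> 'a"
    by (rule clinear_in_cspan[OF clinear_lact pure]) (blast intro: complex_vector.span_base)
  have R: "z \<lhd> m \<in> cspan {(b \<otimes> c) \<lhd> m | b c. True}" for m and z :: "'a \<otimes> 'a"
    by (rule clinear_in_cspan[OF clinear_ract pure]) (blast intro: complex_vector.span_base)
  show "cspan {\<Delta> a \<rhd> (b \<otimes> c) | a b c. True} = cspan {E \<rhd> (b \<otimes> c) | b c. True}"
  proof (rule antisym; rule subset)
    fix s assume "s \<in> {\<Delta> a \<rhd> (b \<otimes> c) | a b c. True}"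
    then obtain a b c where "s = \<Delta> a \<rhd> (b \<otimes> c)" by blast
    then have "E \<rhd> s = s" by (simp add: D)
    then show "s \<in> cspan {E \<rhd> (b \<otimes> c) | b c. True}" using L[of E s] by simp
  next
    fix s assume "s \<in> {E \<rhd> (b \<otimes> c) | b c. True}"
    then have "s \<in> cspan {\<Delta> a \<rhd> y | a y. True}" using D(6) by blast
    moreover have "cspan {\<Delta> a \<rhd> y | a y. True} \<subseteq> cspan {\<Delta> a \<rhd> (b \<otimes> c) | a b c. True}"
    proof (rule subset)
      fix s assume "s \<in> {\<Delta> a \<rhd> y | a y. True}"
      then obtain a y where s: "s = \<Delta> a \<rhd> y" by blast
      have "cspan {\<Delta> a \<rhd> (b \<otimes> c) | b c. True} \<subseteq> cspan {\<Delta> a \<rhd> (b \<otimes> c) | a b c. True}"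
        by (rule complex_vector.span_mono) blast
      then show "s \<in> cspan {\<Delta> a \<rhd> (b \<otimes> c) | a b c. True}" unfolding s using L by blast
    qed
    ultimately show "s \<in> cspan {\<Delta> a \<rhd> (b \<otimes> c) | a b c. True}" by blast
  qed
  show "cspan {(a \<otimes> b) \<lhd> \<Delta> c | a b c. True} = cspan {(a \<otimes> b) \<lhd> E | a b. True}"
  proof (rule antisym; rule subset)
    fix s assume "s \<in> {(a \<otimes> b) \<lhd> \<Delta> c | a b c. True}"
    then obtain a b c where "s = (a \<otimes> b) \<lhd> \<Delta> c" by blast
    then have "s \<lhd> E = s" by (simp add: D)
    then show "s \<in> cspan {(a \<otimes> b) \<lhd> E | a b. True}" using R[of s E] by simp
  next
    fix s assume "s \<in> {(a \<otimes> b) \<lhd> E | a b. True}"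
    then have "s \<in> cspan {y \<lhd> \<Delta> c | c y. True}" using D(7) by blast
    moreover have "cspan {y \<lhd> \<Delta> c | c y. True} \<subseteq> cspan {(a \<otimes> b) \<lhd> \<Delta> c | a b c. True}"
    proof (rule subset)
      fix s assume "s \<in> {y \<lhd> \<Delta> c | c y. True}"
      then obtain c y where s: "s = y \<lhd> \<Delta> c" by blast
      have "cspan {(a \<otimes> b) \<lhd> \<Delta> c | a b. True} \<subseteq> cspan {(a \<otimes> b) \<lhd> \<Delta> c | a b c. True}"
        by (rule complex_vector.span_mono) blast
      then show "s \<in> cspan {(a \<otimes> b) \<lhd> \<Delta> c | a b c. True}" unfolding s using R by blast
    qed
    ultimately show "s \<in> cspan {(a \<otimes> b) \<lhd> \<Delta> c | a b c. True}" by blast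
  qed
qed

theorem weak_multiplier_bialgebra: "regular_weak_multiplier_bialgebra \<Delta>"
  unfolding regular_weak_multiplier_bialgebra_def Let_def
proof (intro conjI exI[of _ E] exI[of _ \<epsilon>] allI)
  show "idempotent_algebra (UNIV :: 'a set)" by (rule idempotent_UNIV)
  show "left_nondegenerate (UNIV :: 'a set)" "right_nondegenerate (UNIV :: 'a set)"
    using nondegenerate_UNIV by (simp_all only: nondegenerate_def)
  show "clinear \<Delta>" by (rule comult_linear)
  show "\<Delta> (a * b) = \<Delta> a * \<Delta> b" for a b by (rule comult_mult)
  show "E * E = E" by (rule E_idem)
  show "clinear \<epsilon>" by (rule counit_linear)
  show "\<Delta> a * (1 \<otimes>\<^sub>M embed b) \<in> range embed" "(embed a \<otimes>\<^sub>M 1) * \<Delta> b \<in> range embed"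
    "(1 \<otimes>\<^sub>M embed b) * \<Delta> a \<in> range embed" "\<Delta> b * (embed a \<otimes>\<^sub>M 1) \<in> range embed" for a b
    by (rule comult_range)+
  show "tensor_map T2 id \<circ> (tensor_assoc_inv \<circ> tensor_map id T1 \<circ> tensor_assoc)
      = tensor_assoc_inv \<circ> tensor_map id T1 \<circ> tensor_assoc \<circ> tensor_map T2 id"
    by (rule ext) (simp add: exchange_law id_def)
  show "slice_id \<epsilon> \<circ> T1 = tensor_lift (*)"
    by (rule tensor_lift_eqI[symmetric])
       (simp_all add: slice_id_T comp_def clinear_compose[OF clinear_T(1) slice_linear(1)])
  show "id_slice \<epsilon> \<circ> T2 = tensor_lift (*)"
    by (rule tensor_lift_eqI[symmetric])
       (simp_all add: id_slice_T2 comp_def clinear_compose[OF clinear_T(2) slice_linear(2)])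
  show "cspan {\<Delta> a \<rhd> (b \<otimes> c) | a b c. True} = cspan {E \<rhd> (b \<otimes> c) | b c. True}"
    "cspan {(a \<otimes> b) \<lhd> \<Delta> c | a b c. True} = cspan {(a \<otimes> b) \<lhd> E | a b. True}"
    by (rule E_comult_span)+
  show "(E \<otimes>\<^sub>M 1) * multiplier_assoc (1 \<otimes>\<^sub>M E) = multiplier_assoc (1 \<otimes>\<^sub>M E) * (E \<otimes>\<^sub>M 1)"
    by (rule E_commute)
  show "multiplier_assoc (1 \<otimes>\<^sub>M E) * (E \<otimes>\<^sub>M 1) = F1 E"
    by (simp only: F1_E E_commute)
  show "F1 E = F2 E"
    by (simp only: F1_E F2_E)
  show "slice_id \<epsilon> ((1 \<otimes>\<^sub>M embed a) \<rhd> E \<rhd> (b \<otimes> c)) = slice_id \<epsilon> (\<Delta> a \<rhd> (b \<otimes> c))" for a b c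
    by (rule counit_comult_right)
  show "slice_id \<epsilon> ((a \<otimes> b) \<lhd> E \<lhd> (1 \<otimes>\<^sub>M embed c)) = slice_id \<epsilon> ((a \<otimes> b) \<lhd> \<Delta> c)" for a b c
    by (rule counit_comult_left)
qed

end

theorem proposition1p23:
  fixes I :: "'i set"
    and G :: "('i, 'a::complex_algebra) grading2"
    and \<Delta> :: "'a \<Rightarrow> ('a \<otimes> 'a) multiplier"
  assumes "regular_partial_multiplier_bialgebra I G \<Delta>"
  shows "regular_weak_multiplier_bialgebra \<Delta>"
proof -
  obtain \<epsilon> where "partial_counit I G \<Delta> \<epsilon>"
    using assms unfolding regular_partial_multiplier_bialgebra_def by blast
  with assms interpret partial_multiplier_bialgebra I G \<Delta> \<epsilon>
    unfolding regular_partial_multiplier_bialgebra_def by unfold_locales blast+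
  show ?thesis by (rule weak_multiplier_bialgebra)
qed

end
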